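(* Let $\ell\ge1$ be an integer, $N=\tfrac12\ell(\ell+1)$, $\Lambda=\{1,2,\dots,\ell\}$, $\tau\in\mathbb C$ with $\mathrm{Im}\,\tau>0$, and let $\eta\in\mathbb C$ be generic (i.e. $m\eta\notin\mathbb Z+\tau\mathbb Z$ for every nonzero integer $m$). Let $K\in\mathbb C\setminus\{0\}$ (with a fixed choice of $\log K$ used to define $K^{x/\eta}$) and $\zeta\in\mathbb C\setminus(\mathbb Z+\tau\mathbb Z)$. Then there exists $E\in\mathbb C$ such that the difference Lamé equation $$\frac{\theta_1(x-\ell\eta)}{\theta_1(x)}\Psi(x+\eta)+\frac{\theta_1(x+\ell\eta)}{\theta_1(x)}\Psi(x-\eta)=E\,\Psi(x)$$ has a nonzero solution of the form $$\Psi(x)=K^{x/\eta}\Big(\prod_{j=1}^{\ell}\theta_1(x-j\eta)\Big)\sum_{m=1}^{\ell}s_m\,\Phi(x-m\eta,\zeta),\qquad s_m\in\mathbb C,$$ if and only if $$\det\big(K^{2m}\delta_{mn}+G_{mn}(\zeta)\big)_{1\le m,n\le\ell}=0,\qquad G_{mn}(\zeta)=(-1)^{\ell+1}\theta_1(2m\eta)\Big(\prod_{j=1,\,j\ne m}^{\ell}\frac{[m+j]}{[m-j]}\Big)\Phi(-(m+n)\eta,\zeta).$$ Moreover this equation is equivalent to $$\sum_{j=0}^{N}(-1)^j\,C^{(\ell)}_j\,\theta_1(\zeta-2j\eta)\,K^{2(N-j)}=0,$$ where $$C^{(\ell)}_j=\sum_{J\subseteq\Lambda,\ \sigma(J)=j}\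 \prod_{k\in J}\ \prod_{k'\in\Lambda\setminus J}\frac{[k+k']}{[|k-k'|]},\qquad \sigma(J)=\sum_{k\in J}k,$$ and these coefficients satisfy $C^{(\ell)}_0=1$ and $C^{(\ell)}_j=C^{(\ell)}_{N-j}$ for $0\le j\le N$.
   Context: $\theta_1(x)=\theta_1(x|\tau)=-\sum_{k\in\mathbb Z}\exp\big(\pi i\tau(k+\tfrac12)^2+2\pi i(x+\tfrac12)(k+\tfrac12)\big)$ is the odd Jacobi theta function, with simple zeros exactly at $\mathbb Z+\tau\mathbb Z$. $[j]=\theta_1(j\eta)/\theta_1(\eta)$ for $j\in\mathbb Z$. $\Phi(x,\zeta)=\dfrac{\theta_1(\zeta+x)}{\theta_1(x)\theta_1(\zeta)}$. $\delta_{mn}$ is the Kronecker delta; empty products equal $1$ and empty sums equal $0$. *)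

theory Defs
  imports
    "HOL-Complex_Analysis.Complex_Analysis"
    "Jordan_Normal_Form.Determinant"
begin

definition theta1 :: "complex \<Rightarrow> complex \<Rightarrow> complex" where
  "theta1 \<tau> x = - (\<Sum>\<^sub>\<infinity>k\<in>(UNIV :: int set).
     exp (of_real pi * \<i> * \<tau> * (of_int k + 1/2)\<^sup>2
          + 2 * of_real pi * \<i> * (x + 1/2) * (of_int k + 1/2)))"

definition period_lattice :: "complex \<Rightarrow> complex set" where
  "period_lattice \<tau> = {of_int a + of_int b * \<tau> | a b. True}"

definition elliptic_num :: "complex \<Rightarrow> complex \<Rightarrow> int \<Rightarrow> complex" where
  "elliptic_num \<tau> \<eta> j = theta1 \<tau> (of_int j * \<eta>) / theta1 \<tau> \<eta>"

definition Phi :: "complex \<Rightarrow> complex \<Rightarrow> complex \<Rightarrow> complex" where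
  "Phi \<tau> x \<zeta> = theta1 \<tau> (\<zeta> + x) / (theta1 \<tau> x * theta1 \<tau> \<zeta>)"

text \<open>
  The poles of \<open>Phi \<tau> (x - m * \<eta>) \<zeta>\<close> in \<open>x\<close> are cancelled by the zeros of the theta product,
  so the ansatz is an entire function of \<open>x\<close>. Evaluated naively at such a pole, the formula would
  yield 0 (division by zero), hence \<open>remove_sings\<close>, which fills in the limit. The power
  \<open>K\<close> to the \<open>x / \<eta>\<close> is defined by means of a logarithm \<open>logK\<close> of \<open>K\<close>.
\<close>
definition lame_ansatz ::
    "complex \<Rightarrow> complex \<Rightarrow> nat \<Rightarrow> complex \<Rightarrow> complex \<Rightarrow> (nat \<Rightarrow> complex) \<Rightarrow> complex \<Rightarrow> complex" where
  "lame_ansatz \<tau> \<eta> l logK \<zeta> s = remove_sings (\<lambda>x.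
     exp (x / \<eta> * logK) * (\<Prod>j=1..l. theta1 \<tau> (x - of_nat j * \<eta>))
       * (\<Sum>m=1..l. s m * Phi \<tau> (x - of_nat m * \<eta>) \<zeta>))"

text \<open>
  The equation is an identity of meromorphic functions; it is required at every point where its
  coefficients are defined.
\<close>
definition difference_lame ::
    "complex \<Rightarrow> complex \<Rightarrow> nat \<Rightarrow> complex \<Rightarrow> (complex \<Rightarrow> complex) \<Rightarrow> bool" where
  "difference_lame \<tau> \<eta> l E \<Psi> \<longleftrightarrow> (\<forall>x. theta1 \<tau> x \<noteq> 0 \<longrightarrow>
     theta1 \<tau> (x - of_nat l * \<eta>) / theta1 \<tau> x * \<Psi> (x + \<eta>)
     + theta1 \<tau> (x + of_nat l * \<eta>) / theta1 \<tau> x * \<Psi> (x - \<eta>) = E * \<Psi> x)"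

definition lame_G :: "complex \<Rightarrow> complex \<Rightarrow> nat \<Rightarrow> complex \<Rightarrow> nat \<Rightarrow> nat \<Rightarrow> complex" where
  "lame_G \<tau> \<eta> l \<zeta> m n = (-1) ^ (l + 1) * theta1 \<tau> (2 * of_nat m * \<eta>)
     * (\<Prod>j\<in>{1..l} - {m}. elliptic_num \<tau> \<eta> (int m + int j) / elliptic_num \<tau> \<eta> (int m - int j))
     * Phi \<tau> (- (of_nat m + of_nat n) * \<eta>) \<zeta>"

text \<open>Matrix entries are indexed from 0, so row \<open>i\<close> and column \<open>j\<close> stand for the indices
  \<open>m = i + 1\<close> and \<open>n = j + 1\<close>.\<close>
definition lame_mat :: "complex \<Rightarrow> complex \<Rightarrow> nat \<Rightarrow> complex \<Rightarrow> complex \<Rightarrow> complex mat" where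
  "lame_mat \<tau> \<eta> l K \<zeta> = mat l l (\<lambda>(i, j).
     (if i = j then K ^ (2 * (i + 1)) else 0) + lame_G \<tau> \<eta> l \<zeta> (i + 1) (j + 1))"

definition lame_C :: "complex \<Rightarrow> complex \<Rightarrow> nat \<Rightarrow> nat \<Rightarrow> complex" where
  "lame_C \<tau> \<eta> l j = (\<Sum>J | J \<subseteq> {1..l} \<and> \<Sum>J = j.
     \<Prod>k\<in>J. \<Prod>k'\<in>{1..l} - J.
       elliptic_num \<tau> \<eta> (int k + int k') / elliptic_num \<tau> \<eta> \<bar>int k - int k'\<bar>)"

end

theory Submission
  imports Defs "HOL-Computational_Algebra.Fundamental_Theorem_Algebra"
begin

text \<open>
  Write \<open>L\<close> for the difference Lame operator. At \<open>x = 0\<close>, and then recursively at \<open>x = \<plusminus> m\<eta>\<close>, the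
  equation \<open>L \<Psi> = E \<Psi>\<close> forces \<open>\<Psi> (m\<eta>) = \<Psi> (- m\<eta>)\<close> for \<open>1 \<le> m \<le> l\<close>. On the ansatz these \<open>l\<close> linear
  conditions say exactly that \<open>s\<close> lies in the kernel of \<open>K\<^sup>2\<^sup>m \<delta> + G\<close>. Conversely, entire functions with
  the multipliers of the ansatz are determined by their values at \<open>\<eta>, \<dots>, l\<eta>\<close>, so they are all of the
  ansatz form, and \<open>L\<close> maps the finite-dimensional space of those satisfying the \<open>l\<close> conditions to
  itself; if this space is nonzero, \<open>L\<close> has an eigenvector in it.

  The determinant is expanded with the elliptic Cauchy determinant of Frobenius, which follows from
  Fay's identity by taking Schur complements. All identities between theta functions come from
  Liouville's theorem, once the zeros of \<open>\<theta>\<^sub>1\<close> are known; these are read off from its infinite product.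
\<close>

subsection \<open>Entire functions with simple zeros\<close>

text \<open>The conditions stop at \<open>m = l\<close> because adding the equations at
  \<open>m\<eta>\<close> and \<open>- m\<eta>\<close> leaves \<open>\<theta> ((m - l)\<eta>)\<close>
  times the defect of condition \<open>m + 1\<close>. For \<open>m < l\<close> genericity makes this
  factor nonzero, so that the conditions propagate; at \<open>m = l\<close> it vanishes, so that no
  further condition arises and the space is invariant under \<open>L\<close>. The condition at
  \<open>m = 1\<close> also cancels the pole of \<open>L\<close> at 0, and quasi-periodicity carries
  this to all lattice points. The eigenvalue is not constructed: evaluation at the \<open>l\<close>
  nodes is injective, which bounds the dimension, and the complex field is algebraically closed.
  Injectivity is where \<zeta> outside the lattice enters: a function vanishing at the nodes is a
  product of theta functions and an exponential, times an entire function with multipliers 1 and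
  \<open>exp (- 2\<pi>i\<zeta>)\<close>. Zeros are never counted by contour integrals. Dividing by a
  shifted theta function lowers the degree of a quasi-periodic function by one, until a function of
  degree 0 remains, which Liouville's theorem makes an exponential.\<close>

definition simple_zeros :: "(complex \<Rightarrow> complex) \<Rightarrow> bool" where
  "simple_zeros g \<longleftrightarrow> g holomorphic_on UNIV \<and> (\<forall>z. g z = 0 \<longrightarrow> deriv g z \<noteq> 0)"

lemma entire_factor_root:
  assumes "f holomorphic_on UNIV" and "f a = 0"
  obtains F where "F holomorphic_on UNIV" "\<And>z. f z = (z - a) * F z" "F a = deriv f a"
proof -
  define F where "F = (\<lambda>z. if z = a then deriv f a else (f z - f a) / (z - a))"
  have "F holomorphic_on UNIV"
    unfolding F_def by (rule pole_lemma) (use assms in auto)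
  moreover have "f z = (z - a) * F z" for z
    using assms by (auto simp: F_def)
  ultimately show ?thesis using that by (auto simp: F_def)
qed

lemma continuous_nonzero_nearby:
  fixes G :: "complex \<Rightarrow> complex"
  assumes "G holomorphic_on UNIV" and "G a \<noteq> 0"
  obtains e where "e > 0" "\<And>z. z \<in> ball a e \<Longrightarrow> G z \<noteq> 0"
proof -
  have "continuous (at a) G"
    using assms(1) holomorphic_on_imp_continuous_on continuous_on_eq_continuous_at by blast
  from continuous_at_avoid[OF this assms(2)] show ?thesis
    using that by (auto simp: dist_commute)
qed

lemma simple_zeros_eventually_nonzero:
  assumes "simple_zeros g"
  shows "eventually (\<lambda>w. g w \<noteq> 0) (at z)"
proof (cases "g z = 0")
  case True
  obtain G where G: "G holomorphic_on UNIV" "\<And>w. g w = (w - z) * G w" "G z = deriv g z"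
    using entire_factor_root[of g z] assms True by (auto simp: simple_zeros_def)
  have "G z \<noteq> 0" using assms True G by (auto simp: simple_zeros_def)
  from continuous_nonzero_nearby[OF G(1) this] obtain e where
    e: "e > 0" "\<And>w. w \<in> ball z e \<Longrightarrow> G w \<noteq> 0" by auto
  show ?thesis
    unfolding eventually_at using e G(2) by (intro exI[of _ e]) (auto simp: dist_commute)
next
  case False
  obtain e where e: "e > 0" "\<And>w. w \<in> ball z e \<Longrightarrow> g w \<noteq> 0"
    using continuous_nonzero_nearby[of g z] assms False by (auto simp: simple_zeros_def)
  show ?thesis
    unfolding eventually_at using e by (intro exI[of _ e]) (auto simp: dist_commute)
qed

lemma continuous_eq_of_eventually_eq:
  fixes u v :: "complex \<Rightarrow> complex"
  assumes "isCont u z" "isCont v z" "eventually (\<lambda>w. u w = v w) (at z)"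
  shows "u z = v z"
proof -
  have "(u \<longlongrightarrow> v z) (at z)"
    using assms(2,3) by (metis (mono_tags, lifting) continuous_within eventually_mono tendsto_cong)
  moreover have "(u \<longlongrightarrow> u z) (at z)"
    using assms(1) by (simp add: continuous_within)
  ultimately show ?thesis by (metis LIM_unique)
qed

lemma entire_isCont:
  assumes "f holomorphic_on UNIV" shows "isCont f z"
  using assms holomorphic_on_imp_continuous_on continuous_on_eq_continuous_at by blast

text \<open>The hypothesis says nothing at the zeros of \<open>g\<close>; these are isolated, so
  continuity fills them in.\<close>

lemma simple_zeros_mult_cancel:
  assumes "simple_zeros g" "u holomorphic_on UNIV" "v holomorphic_on UNIV"
    and "\<And>z. g z * u z = g z * v z"
  shows "u z = v z"
proof (rule continuous_eq_of_eventually_eq[where u = u and v = v])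
  show "eventually (\<lambda>w. u w = v w) (at z)"
    using simple_zeros_eventually_nonzero[OF assms(1), of z]
    by eventually_elim (use assms(4) in auto)
qed (use assms entire_isCont in auto)

lemma simple_zeros_shift:
  assumes "simple_zeros g"
  shows "simple_zeros (\<lambda>x. g (x - a))"
proof -
  have g: "g holomorphic_on UNIV" using assms by (simp add: simple_zeros_def)
  have "deriv (\<lambda>x. g (x - a)) z = deriv g (z - a)" for z
    using holomorphic_derivI[OF g open_UNIV, of "z - a" UNIV] DERIV_shift[of g _ z "- a"]
    by (intro DERIV_imp_deriv) simp
  moreover have "(\<lambda>x. g (x - a)) holomorphic_on UNIV"
    by (rule holomorphic_on_compose_gen[OF _ g, unfolded o_def]) (auto intro!: holomorphic_intros)
  ultimately show ?thesis using assms by (auto simp: simple_zeros_def)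
qed

text \<open>At a zero of \<open>g\<close> the quotient takes l'Hopital's value
  \<open>f' / g'\<close>. Simplicity of the zeros makes plain vanishing of \<open>f\<close>
  sufficient, with no comparison of orders.\<close>

lemma entire_divide_simple_zeros:
  assumes "f holomorphic_on UNIV" and g: "simple_zeros g" and "\<And>z. g z = 0 \<Longrightarrow> f z = 0"
  obtains h where "h holomorphic_on UNIV" "\<And>z. f z = g z * h z"
proof -
  define h where "h = (\<lambda>z. if g z = 0 then deriv f z / deriv g z else f z / g z)"
  have hg: "g holomorphic_on UNIV" using g by (simp add: simple_zeros_def)
  have "h analytic_on {a}" for a
  proof (cases "g a = 0")
    case True
    obtain G where G: "G holomorphic_on UNIV" "\<And>w. g w = (w - a) * G w" "G a = deriv g a"
      using entire_factor_root[of g a] hg True by auto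
    obtain F where F: "F holomorphic_on UNIV" "\<And>w. f w = (w - a) * F w" "F a = deriv f a"
      using entire_factor_root[of f a] assms True by auto
    have "G a \<noteq> 0" using g True G by (auto simp: simple_zeros_def)
    from continuous_nonzero_nearby[OF G(1) this] obtain e where
      e: "e > 0" "\<And>w. w \<in> ball a e \<Longrightarrow> G w \<noteq> 0" by auto
    have "(\<lambda>z. F z / G z) holomorphic_on ball a e"
      by (intro holomorphic_on_divide holomorphic_on_subset[OF F(1)] holomorphic_on_subset[OF G(1)])
         (use e in auto)
    moreover have "F z / G z = h z" if "z \<in> ball a e" for z
      using e that by (cases "z = a") (simp_all add: h_def True F G)
    ultimately have "h holomorphic_on ball a e"
      using holomorphic_transform by blast
    thus ?thesis using e by (auto simp: analytic_on_def)
  next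
    case False
    from continuous_nonzero_nearby[OF hg this] obtain e where
      e: "e > 0" "\<And>w. w \<in> ball a e \<Longrightarrow> g w \<noteq> 0" by auto
    have "(\<lambda>z. f z / g z) holomorphic_on ball a e"
      by (intro holomorphic_on_divide holomorphic_on_subset[OF assms(1)] holomorphic_on_subset[OF hg])
         (use e in auto)
    hence "h holomorphic_on ball a e"
      by (rule holomorphic_transform) (use e in \<open>auto simp: h_def\<close>)
    thus ?thesis using e by (auto simp: analytic_on_def)
  qed
  hence "h holomorphic_on UNIV"
    by (meson analytic_imp_holomorphic analytic_on_analytic_at)
  moreover have "f z = g z * h z" for z
    using assms by (auto simp: h_def)
  ultimately show ?thesis using that by blast
qed

subsection \<open>Quasi-periodic entire functions\<close>

locale theta =
  fixes \<tau> :: complex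
  assumes Im_tau_pos: "Im \<tau> > 0"
begin

text \<open>Entire functions with the multipliers of a product of \<open>n\<close> shifted theta functions.\<close>
definition qp :: "nat \<Rightarrow> complex \<Rightarrow> complex \<Rightarrow> (complex \<Rightarrow> complex) \<Rightarrow> bool" where
  "qp n \<alpha> \<beta> f \<longleftrightarrow> f holomorphic_on UNIV \<and> (\<forall>x. f (x + 1) = \<alpha> * f x)
     \<and> (\<forall>x. f (x + \<tau>) = \<beta> * exp (- 2 * pi * \<i> * n * x) * f x)"

lemma lattice_induct:
  assumes "P 1" "P \<tau>" "\<And>u v. P u \<Longrightarrow> P v \<Longrightarrow> P (u + v)" "\<And>u. P u \<Longrightarrow> P (- u)" "w \<in> period_lattice \<tau>"
  shows "P w"
proof -
  have P0: "P 0" using assms(1) assms(4)[OF assms(1)] assms(3)[of 1 "-1"] by simp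
  have nat: "P (of_nat n * u)" if "P u" for u and n :: nat
    using P0 that assms(3) by (induction n) (auto simp: distrib_right)
  have int: "P (of_int a * u)" if "P u" for u and a :: int
    using nat[OF that] assms(4) by (cases a rule: int_cases2) auto
  from assms(5) obtain a b where "w = of_int a + of_int b * \<tau>"
    by (auto simp: period_lattice_def)
  thus ?thesis using int[OF assms(1), of a] int[OF assms(2), of b] assms(3) by auto
qed

text \<open>Only the existence of a nowhere vanishing factor of automorphy is recorded. It is
  composed from the two generating periods, and its explicit form is never computed.\<close>

lemma qp_lattice_shift:
  assumes "w \<in> period_lattice \<tau>" and "\<alpha> \<noteq> 0" "\<beta> \<noteq> 0"
  obtains e where "e holomorphic_on UNIV" "\<And>x. e x \<noteq> 0"
    "\<And>f x. qp n \<alpha> \<beta> f \<Longrightarrow> f (x + w) = e x * f x"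
proof -
  define Q where "Q = (\<lambda>w. \<exists>e. e holomorphic_on UNIV \<and> (\<forall>x. e x \<noteq> 0) \<and>
    (\<forall>f x. qp n \<alpha> \<beta> f \<longrightarrow> f (x + w) = e x * f x))"
  have "Q w"
  proof (rule lattice_induct[of Q, OF _ _ _ _ assms(1)])
    show "Q 1" unfolding Q_def using assms
      by (intro exI[of _ "\<lambda>_. \<alpha>"]) (auto simp: qp_def)
    show "Q \<tau>" unfolding Q_def using assms
      by (intro exI[of _ "\<lambda>x. \<beta> * exp (- 2 * pi * \<i> * n * x)"])
         (auto simp: qp_def intro!: holomorphic_intros)
  next
    fix u v assume "Q u" "Q v"
    then obtain a b where a: "a holomorphic_on UNIV" "\<And>x. a x \<noteq> 0" "\<And>f x. qp n \<alpha> \<beta> f \<Longrightarrow> f (x + u) = a x * f x"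
      and b: "b holomorphic_on UNIV" "\<And>x. b x \<noteq> 0" "\<And>f x. qp n \<alpha> \<beta> f \<Longrightarrow> f (x + v) = b x * f x"
      unfolding Q_def by metis
    have "f (x + (u + v)) = b (x + u) * a x * f x" if "qp n \<alpha> \<beta> f" for f x
      using b(3)[OF that, of "x + u"] a(3)[OF that, of x] by (simp add: add.assoc)
    moreover have "(\<lambda>x. b (x + u) * a x) holomorphic_on UNIV"
      by (intro holomorphic_intros a holomorphic_on_compose_gen[OF _ b(1), unfolded o_def]) auto
    ultimately show "Q (u + v)" unfolding Q_def using a b
      by (intro exI[of _ "\<lambda>x. b (x + u) * a x"]) auto
  next
    fix u assume "Q u"
    then obtain a where a: "a holomorphic_on UNIV" "\<And>x. a x \<noteq> 0" "\<And>f x. qp n \<alpha> \<beta> f \<Longrightarrow> f (x + u) = a x * f x"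
      unfolding Q_def by metis
    have "f (x + - u) = (1 / a (x - u)) * f x" if "qp n \<alpha> \<beta> f" for f x
      using a(3)[OF that, of "x - u"] a(2)[of "x - u"] by (simp add: field_simps)
    moreover have "(\<lambda>x. 1 / a (x - u)) holomorphic_on UNIV"
      by (intro holomorphic_intros holomorphic_on_compose_gen[OF _ a(1), unfolded o_def] a(2)) auto
    ultimately show "Q (- u)" unfolding Q_def using a
      by (intro exI[of _ "\<lambda>x. 1 / a (x - u)"]) auto
  qed
  thus ?thesis using that unfolding Q_def by auto
qed

lemma qp_zero_shift:
  assumes "qp n \<alpha> \<beta> f" "\<alpha> \<noteq> 0" "\<beta> \<noteq> 0" "f a = 0" "x - a \<in> period_lattice \<tau>"
  shows "f x = 0"
proof -
  obtain e where "\<And>f y. qp n \<alpha> \<beta> f \<Longrightarrow> f (y + (x - a)) = e y * f y"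
    using qp_lattice_shift[OF assms(5,2,3)] by metis
  from this[OF assms(1), of a] show ?thesis using assms by simp
qed

text \<open>At a zero of \<open>f\<close> the derivative of the automorphy factor drops out of the
  product rule, so simplicity of a zero spreads over its lattice translates.\<close>

lemma qp_deriv_shift:
  assumes "qp n \<alpha> \<beta> f" "\<alpha> \<noteq> 0" "\<beta> \<noteq> 0" "f a = 0" "deriv f a \<noteq> 0" "x - a \<in> period_lattice \<tau>"
  shows "deriv f x \<noteq> 0"
proof -
  obtain e where e: "e holomorphic_on UNIV" "\<And>y. e y \<noteq> 0" "\<And>f y. qp n \<alpha> \<beta> f \<Longrightarrow> f (y + (x - a)) = e y * f y"
    using qp_lattice_shift[OF assms(6,2,3)] by metis
  have hf: "f holomorphic_on UNIV" using assms by (simp add: qp_def)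
  have df: "(f has_field_derivative deriv f z) (at z)" for z
    using hf by (simp add: holomorphic_derivI)
  have de: "(e has_field_derivative deriv e z) (at z)" for z
    using e(1) by (simp add: holomorphic_derivI)
  have "((\<lambda>y. f (y + (x - a))) has_field_derivative deriv f x) (at a)"
    using df[of x] DERIV_shift[of f "deriv f x" a "x - a"] by simp
  moreover have "((\<lambda>y. e y * f y) has_field_derivative (deriv e a * f a + deriv f a * e a)) (at a)"
    by (rule DERIV_mult[OF de df])
  ultimately have "deriv f x = deriv e a * f a + deriv f a * e a"
    using e(3)[OF assms(1)] DERIV_unique by auto
  thus ?thesis using assms e(2) by simp
qed

lemma lattice_decomp:
  obtains w s t where "w \<in> period_lattice \<tau>" "s \<in> {0..1}" "t \<in> {0..1}"
    "x = of_real s + of_real t * \<tau> + w"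
proof -
  define T where "T = Im x / Im \<tau>"
  define S where "S = Re x - T * Re \<tau>"
  have x: "x = of_real S + of_real T * \<tau>"
    using Im_tau_pos by (simp add: complex_eq_iff S_def T_def)
  show ?thesis
  proof (rule that[of "of_int \<lfloor>S\<rfloor> + of_int \<lfloor>T\<rfloor> * \<tau>" "frac S" "frac T"])
    show "x = of_real (frac S) + of_real (frac T) * \<tau> + (of_int \<lfloor>S\<rfloor> + of_int \<lfloor>T\<rfloor> * \<tau>)"
      unfolding x frac_def by (simp add: algebra_simps)
  qed (auto simp: period_lattice_def frac_lt_1 less_imp_le)
qed

text \<open>Twisting by the exponential makes both multipliers unimodular, so that Liouville applies.\<close>
lemma qp_0_exponential:
  assumes "qp 0 \<alpha> \<beta> f" "\<alpha> \<noteq> 0" "\<beta> \<noteq> 0"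
  obtains C c where "\<And>x. f x = C * exp (c * x)"
proof -
  \<comment> \<open>The solution of the real linear equations
    \<open>Re c = ln (norm \<alpha>)\<close> and \<open>Re (c * \<tau>) = ln (norm \<beta>)\<close>;
    it exists since \<open>Im \<tau>\<close> is not 0.\<close>
  define c where "c = Complex (ln (norm \<alpha>)) ((ln (norm \<alpha>) * Re \<tau> - ln (norm \<beta>)) / Im \<tau>)"
  define g where "g = (\<lambda>x. f x * exp (- c * x))"
  have hf: "f holomorphic_on UNIV" using assms by (simp add: qp_def)
  have hg: "g holomorphic_on UNIV" unfolding g_def by (intro holomorphic_intros hf)
  have "Re (c * \<tau>) = ln (norm \<beta>)"
    using Im_tau_pos by (simp add: c_def)
  hence b: "norm (exp (- c * \<tau>)) = 1 / norm \<beta>"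
    using assms(3) unfolding norm_exp_eq_Re by (simp add: exp_minus inverse_eq_divide del: times_complex.sel)
  have a: "norm (exp (- c)) = 1 / norm \<alpha>"
    using assms(2) unfolding norm_exp_eq_Re by (simp add: c_def exp_minus inverse_eq_divide)
  have inv: "\<forall>x. norm (g (x + w)) = norm (g x)" if "w \<in> period_lattice \<tau>" for w
  proof (rule lattice_induct[OF _ _ _ _ that])
    show "\<forall>x. norm (g (x + 1)) = norm (g x)"
    proof
      fix x
      have "f (x + 1) = \<alpha> * f x" using assms(1) by (simp add: qp_def)
      moreover have "exp (- c * (x + 1)) = exp (- c) * exp (- c * x)"
        unfolding exp_add[symmetric] by (simp add: algebra_simps)
      ultimately have "g (x + 1) = \<alpha> * exp (- c) * g x" by (simp add: g_def)
      thus "norm (g (x + 1)) = norm (g x)" using a assms(2) by (simp add: norm_mult)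
    qed
    show "\<forall>x. norm (g (x + \<tau>)) = norm (g x)"
    proof
      fix x
      have "f (x + \<tau>) = \<beta> * f x" using assms(1) by (simp add: qp_def)
      moreover have "exp (- c * (x + \<tau>)) = exp (- c * \<tau>) * exp (- c * x)"
        unfolding exp_add[symmetric] by (simp add: algebra_simps)
      ultimately have "g (x + \<tau>) = \<beta> * exp (- c * \<tau>) * g x" by (simp add: g_def)
      thus "norm (g (x + \<tau>)) = norm (g x)" using b assms(3) by (simp only: norm_mult) simp
    qed
    show "\<forall>x. norm (g (x + (u + v))) = norm (g x)"
      if "\<forall>x. norm (g (x + u)) = norm (g x)" "\<forall>x. norm (g (x + v)) = norm (g x)" for u v
      using that by (metis add.assoc)
    show "\<forall>x. norm (g (x + - u)) = norm (g x)" if "\<forall>x. norm (g (x + u)) = norm (g x)" for u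
      using that by (metis add.right_neutral add.right_inverse add.assoc add.commute)
  qed
  \<comment> \<open>The compact period parallelogram. Although \<open>g\<close> need not be
    periodic, its modulus is, so a bound on \<open>D\<close> is a global bound.\<close>
  define D where "D = (\<lambda>(s, t). of_real s + of_real t * \<tau>) ` ({0..1::real} \<times> {0..1::real})"
  have "compact D"
    unfolding D_def by (intro compact_continuous_image compact_Times compact_Icc)
      (auto simp: case_prod_unfold intro!: continuous_intros)
  hence "bounded (g ` D)"
    by (intro compact_imp_bounded compact_continuous_image holomorphic_on_imp_continuous_on
        holomorphic_on_subset[OF hg]) auto
  then obtain B where B: "\<And>y. y \<in> D \<Longrightarrow> norm (g y) \<le> B" by (auto simp: bounded_iff)
  have "norm (g x) \<le> B" for x
  proof -
    obtain w s t where w: "w \<in> period_lattice \<tau>" "s \<in> {0..1}" "t \<in> {0..1}" "x = of_real s + of_real t * \<tau> + w"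
      using lattice_decomp by metis
    have "norm (g x) = norm (g (of_real s + of_real t * \<tau>))" using inv[OF w(1)] w(4) by simp
    also have "\<dots> \<le> B" using w by (intro B) (auto simp: D_def)
    finally show ?thesis .
  qed
  hence "bounded (range g)" by (auto simp: bounded_iff)
  then obtain C where "\<And>x. g x = C"
    using Liouville_theorem[OF hg] by (auto simp: constant_on_def)
  hence "f x = C * exp (c * x)" for x
    by (metis (no_types, lifting) exp_minus_inverse g_def mult.assoc mult.commute mult.right_neutral mult_minus_left)
  thus ?thesis using that by blast
qed

text \<open>Period 1 forces the rate of an exponential into \<open>2\<pi>i\<close> times the
  integers; its factor under the shift by \<tau> is then determined, which leaves only lattice
  values for \<open>z\<close>.\<close>

lemma exp_eq_one_lattice:
  assumes "exp (c :: complex) = 1" "exp (c * \<tau>) = exp (- (2 * pi * \<i> * z))"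
  shows "\<exists>k m. c = 2 * pi * \<i> * of_int k \<and> z = of_int m - of_int k * \<tau>"
proof -
  obtain k :: int where k: "c = 2 * pi * \<i> * k"
    using assms(1) by (subst (asm) exp_eq_1) (auto simp: complex_eq_iff)
  from assms(2) obtain m :: int where m: "c * \<tau> = - (2 * pi * \<i> * z) + (of_int (2 * m) * pi) * \<i>"
    by (auto simp: exp_eq)
  have "2 * pi * \<i> * z = 2 * pi * \<i> * (of_int m - of_int k * \<tau>)"
    using m unfolding k by (simp add: algebra_simps)
  hence "z = m - k * \<tau>" by (subst (asm) mult_cancel_left) simp
  thus ?thesis using k by blast
qed

text \<open>These are the multipliers of a line bundle of degree 0, which is trivial only for
  \<open>z\<close> in the lattice. Applied with \<open>z = \<zeta>\<close>, this gives uniqueness of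
  interpolation at the nodes.\<close>

lemma qp_0_zero:
  assumes "qp 0 1 (exp (- (2 * pi * \<i> * z))) f" "z \<notin> period_lattice \<tau>"
  shows "f x = 0"
proof -
  obtain C c where C: "\<And>x. f x = C * exp (c * x)"
    using qp_0_exponential[OF assms(1)] by auto
  have "C = 0"
  proof (rule ccontr)
    assume "C \<noteq> 0"
    have "f (x + 1) = f x" "f (x + \<tau>) = exp (- (2 * pi * \<i> * z)) * f x" for x
      using assms(1) by (simp_all add: qp_def)
    from this[of 0] have "f 1 = f 0" "f \<tau> = exp (- (2 * pi * \<i> * z)) * f 0" by simp_all
    hence "exp c = 1" "exp (c * \<tau>) = exp (- (2 * pi * \<i> * z))"
      using \<open>C \<noteq> 0\<close> by (auto simp: C)
    then obtain k m :: int where "z = m - k * \<tau>"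
      using exp_eq_one_lattice by blast
    hence "z = of_int m + of_int (- k) * \<tau>" by simp
    thus False using assms(2) unfolding period_lattice_def by blast
  qed
  thus ?thesis by (simp add: C)
qed

lemma qp_0_constant:
  assumes "qp 0 1 1 f"
  shows "f x = f y"
proof -
  obtain C c where C: "\<And>x. f x = C * exp (c * x)"
    using qp_0_exponential[OF assms(1)] by auto
  show ?thesis
  proof (cases "C = 0")
    case False
    have "f (x + 1) = f x" "f (x + \<tau>) = f x" for x
      using assms(1) by (simp_all add: qp_def)
    from this[of 0] have "f 1 = f 0" "f \<tau> = f 0" by simp_all
    hence "exp c = 1" "exp (c * \<tau>) = exp (- (2 * pi * \<i> * 0))"
      using False by (auto simp: C)
    then obtain k m :: int where km: "c = 2 * pi * \<i> * k" "0 = m - k * \<tau>"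
      using exp_eq_one_lattice by blast
    have "Im (m - k * \<tau>) = 0" using km(2) by (metis zero_complex.sel(2))
    hence "k = 0" using Im_tau_pos by simp
    thus ?thesis by (simp add: C km(1))
  qed (simp add: C)
qed

end

subsection \<open>The theta series\<close>

lemma exp_minus_abs_summable_on_int:
  "(\<lambda>k::int. exp (- \<bar>real_of_int k\<bar>)) summable_on UNIV"
proof -
  have geo: "(\<lambda>n::nat. exp (- real n)) summable_on UNIV"
  proof (rule norm_summable_imp_summable_on)
    have "summable (\<lambda>n. exp (- 1 :: real) ^ n)"
      by (rule summable_geometric) simp
    thus "summable (\<lambda>n. norm (exp (- real n)))"
      by (simp flip: exp_of_nat_mult)
  qed
  have 1: "(\<lambda>k::int. exp (- \<bar>real_of_int k\<bar>)) summable_on range int"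
    using geo by (subst summable_on_reindex) (auto simp: o_def inj_on_def)
  have 2: "(\<lambda>k::int. exp (- \<bar>real_of_int k\<bar>)) summable_on range (\<lambda>n. - int n)"
    using geo by (subst summable_on_reindex) (auto simp: o_def inj_on_def)
  have "UNIV = range int \<union> range (\<lambda>n. - int n)"
    by (auto intro: int_cases2)
  moreover have "(\<lambda>k::int. exp (- \<bar>real_of_int k\<bar>)) summable_on range int \<union> range (\<lambda>n. - int n)"
    by (rule summable_on_union[OF 1 2])
  ultimately show ?thesis by simp
qed

context theta
begin

abbreviation \<theta> :: "complex \<Rightarrow> complex" where "\<theta> \<equiv> theta1 \<tau>"

definition theta_term :: "int \<Rightarrow> complex \<Rightarrow> complex" where
  "theta_term k x = exp (of_real pi * \<i> * \<tau> * (of_int k + 1/2)\<^sup>2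
          + 2 * of_real pi * \<i> * (x + 1/2) * (of_int k + 1/2))"

lemma theta1_eq: "\<theta> x = - (\<Sum>\<^sub>\<infinity>k\<in>UNIV. theta_term k x)"
  by (simp add: theta1_def theta_term_def)

text \<open>Completing the square bounds a quadratic \<open>- a t^2 + b |t|\<close> by
  \<open>b^2 / (4a)\<close>. The 1 in \<open>b = 2\<pi>R + 1\<close> reserves a summable factor
  \<open>exp (- |t|)\<close>, and the second 1 pays for replacing \<open>t = k + 1/2\<close> by
  \<open>k\<close>.\<close>

lemma norm_theta_term_le:
  assumes "norm x \<le> R"
  shows "norm (theta_term k x) \<le> exp ((2 * pi * R + 1)\<^sup>2 / (4 * pi * Im \<tau>) + 1) * exp (- \<bar>real_of_int k\<bar>)"
proof -
  define t where "t = real_of_int k + 1 / 2"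
  define b where "b = 2 * pi * R + 1"
  define a where "a = pi * Im \<tau>"
  have a: "a > 0" using Im_tau_pos by (simp add: a_def)
  have "of_int k + 1/2 = complex_of_real t" by (simp add: t_def)
  hence "Re (of_real pi * \<i> * \<tau> * (of_int k + 1/2)\<^sup>2 + 2 * of_real pi * \<i> * (x + 1/2) * (of_int k + 1/2))
      = - a * t\<^sup>2 - 2 * pi * t * Im x"
    by (simp add: a_def power2_eq_square)
  also have "- 2 * pi * t * Im x \<le> 2 * pi * (\<bar>t\<bar> * R)"
  proof -
    have "- (t * Im x) \<le> \<bar>t\<bar> * \<bar>Im x\<bar>" by (metis abs_ge_minus_self abs_mult)
    also have "\<dots> \<le> \<bar>t\<bar> * R"
      using assms abs_Im_le_cmod[of x] by (intro mult_left_mono) auto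
    finally have "2 * pi * (- (t * Im x)) \<le> 2 * pi * (\<bar>t\<bar> * R)"
      by (intro mult_left_mono) auto
    thus ?thesis by (simp add: algebra_simps)
  qed
  hence "- a * t\<^sup>2 - 2 * pi * t * Im x \<le> - a * t\<^sup>2 + (b - 1) * \<bar>t\<bar>"
    by (simp add: b_def algebra_simps)
  also have "\<dots> \<le> b\<^sup>2 / (4 * a) - \<bar>t\<bar>"
  proof -
    have "0 \<le> (2 * a * \<bar>t\<bar> - b)\<^sup>2 / (4 * a)" using a by simp
    also have "\<dots> = a * t\<^sup>2 - b * \<bar>t\<bar> + b\<^sup>2 / (4 * a)"
      using a by (simp add: field_simps power2_eq_square)
    finally show ?thesis by (simp add: algebra_simps)
  qed
  also have "\<dots> \<le> (b\<^sup>2 / (4 * a) + 1) + (- \<bar>real_of_int k\<bar>)"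
    by (simp add: t_def)
  finally have "norm (theta_term k x) \<le> exp ((b\<^sup>2 / (4 * a) + 1) + (- \<bar>real_of_int k\<bar>))"
    unfolding theta_term_def norm_exp_eq_Re by simp
  thus ?thesis by (simp only: exp_add b_def a_def mult.assoc)
qed

lemma theta1_uniform_limit:
  "uniform_limit (cball 0 R) (\<lambda>X x. - (\<Sum>k\<in>X. theta_term k x)) \<theta> (finite_subsets_at_top UNIV)"
proof -
  have "uniform_limit (cball 0 R) (\<lambda>X x. \<Sum>k\<in>X. theta_term k x) (\<lambda>x. \<Sum>\<^sub>\<infinity>k\<in>UNIV. theta_term k x)
    (finite_subsets_at_top UNIV)"
  proof (rule Weierstrass_m_test_general)
    fix k x assume "x \<in> cball (0::complex) R"
    thus "norm (theta_term k x) \<le> exp ((2 * pi * R + 1)\<^sup>2 / (4 * pi * Im \<tau>) + 1) * exp (- \<bar>real_of_int k\<bar>)"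
      by (intro norm_theta_term_le) simp
  next
    show "(\<lambda>k::int. exp ((2 * pi * R + 1)\<^sup>2 / (4 * pi * Im \<tau>) + 1) * exp (- \<bar>real_of_int k\<bar>)) summable_on UNIV"
      by (intro summable_on_cmult_right exp_minus_abs_summable_on_int)
  qed
  thus ?thesis unfolding theta1_eq[abs_def] by (intro uniform_limit_intros)
qed

lemma theta1_holomorphic: "\<theta> holomorphic_on UNIV"
proof -
  have "\<theta> analytic_on {z}" for z
  proof -
    have "\<theta> holomorphic_on ball 0 (norm z + 1)"
    proof (rule holomorphic_uniform_limit[OF _ theta1_uniform_limit])
      show "\<forall>\<^sub>F X in finite_subsets_at_top UNIV. continuous_on (cball 0 (norm z + 1)) (\<lambda>x. - (\<Sum>k\<in>X. theta_term k x)) \<and>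
        (\<lambda>x. - (\<Sum>k\<in>X. theta_term k x)) holomorphic_on ball 0 (norm z + 1)"
        unfolding theta_term_def
        by (intro always_eventually allI conjI holomorphic_intros continuous_intros)
    qed auto
    thus ?thesis
      by (metis analytic_at centre_in_ball dist_0_norm less_add_one mem_ball open_ball)
  qed
  thus ?thesis by (meson analytic_imp_holomorphic analytic_on_analytic_at)
qed

lemma theta1_minus: "\<theta> (- x) = - \<theta> x"
proof -
  \<comment> \<open>The index change negates \<open>k + 1/2\<close>, which preserves the Gaussian
    part; the shift of \<open>x\<close> by 1/2 then produces the factor
    \<open>exp (- \<pi>i (2k + 1)) = - 1\<close>.\<close>
  have "(\<Sum>\<^sub>\<infinity>k\<in>UNIV. theta_term k (- x)) = (\<Sum>\<^sub>\<infinity>k\<in>UNIV. theta_term (- 1 - k) (- x))"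
    by (rule infsum_reindex_bij_betw[symmetric]) (rule bij_betw_byWitness[where f' = "\<lambda>k. - 1 - k"], auto)
  also have "theta_term (- 1 - k) (- x) = - theta_term k x" for k
  proof -
    have "theta_term (- 1 - k) (- x) = exp ((of_real pi * \<i> * \<tau> * (of_int k + 1/2)\<^sup>2
          + 2 * of_real pi * \<i> * (x + 1/2) * (of_int k + 1/2)) - \<i> * pi + 2 * of_int (- k) * of_real pi * \<i>)"
      unfolding theta_term_def by (rule arg_cong[of _ _ exp]) (simp add: algebra_simps power2_eq_square)
    also have "\<dots> = exp ((of_real pi * \<i> * \<tau> * (of_int k + 1/2)\<^sup>2
          + 2 * of_real pi * \<i> * (x + 1/2) * (of_int k + 1/2)) - \<i> * pi)"
      by (subst exp_eq) (auto intro!: exI[of _ "- k"])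
    also have "\<dots> = - theta_term k x" unfolding theta_term_def by (subst exp_diff) simp
    finally show ?thesis .
  qed
  hence "(\<Sum>\<^sub>\<infinity>k\<in>UNIV. theta_term (- 1 - k) (- x)) = (\<Sum>\<^sub>\<infinity>k\<in>UNIV. - theta_term k x)" by simp
  also have "\<dots> = - (\<Sum>\<^sub>\<infinity>k\<in>UNIV. theta_term k x)" by (rule infsum_uminus)
  finally show ?thesis by (simp add: theta1_eq)
qed

lemma theta1_0 [simp]: "\<theta> 0 = 0"
  using theta1_minus[of 0] by simp

lemma theta1_plus_1: "\<theta> (x + 1) = - \<theta> x"
proof -
  have "theta_term k (x + 1) = - theta_term k x" for k
  proof -
    have "theta_term k (x + 1) = exp ((of_real pi * \<i> * \<tau> * (of_int k + 1/2)\<^sup>2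
          + 2 * of_real pi * \<i> * (x + 1/2) * (of_int k + 1/2)) + \<i> * pi)"
      unfolding theta_term_def by (subst exp_eq) (auto intro!: exI[of _ k] simp: algebra_simps)
    thus ?thesis unfolding theta_term_def by (simp add: exp_add)
  qed
  hence "(\<Sum>\<^sub>\<infinity>k\<in>UNIV. theta_term k (x + 1)) = - (\<Sum>\<^sub>\<infinity>k\<in>UNIV. theta_term k x)"
    by (simp add: infsum_uminus)
  thus ?thesis by (simp add: theta1_eq)
qed

lemma theta1_plus_tau: "\<theta> (x + \<tau>) = - exp (- (pi * \<i> * \<tau>) - 2 * pi * \<i> * x) * \<theta> x"
proof -
  have "theta_term k (x + \<tau>) = - exp (- (pi * \<i> * \<tau>) - 2 * pi * \<i> * x) * theta_term (k + 1) x" for k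
  proof -
    have "exp (- (pi * \<i> * \<tau>) - 2 * pi * \<i> * x) * theta_term (k + 1) x =
      exp ((of_real pi * \<i> * \<tau> * (of_int k + 1/2)\<^sup>2
          + 2 * of_real pi * \<i> * (x + \<tau> + 1/2) * (of_int k + 1/2)) + \<i> * pi)"
      unfolding theta_term_def exp_add[symmetric]
      by (rule arg_cong[of _ _ exp]) (simp add: algebra_simps power2_eq_square)
    thus ?thesis unfolding theta_term_def by (simp add: exp_add)
  qed
  hence "(\<Sum>\<^sub>\<infinity>k\<in>UNIV. theta_term k (x + \<tau>)) =
    (\<Sum>\<^sub>\<infinity>k\<in>UNIV. - exp (- (pi * \<i> * \<tau>) - 2 * pi * \<i> * x) * theta_term (k + 1) x)" by simp
  also have "\<dots> = - exp (- (pi * \<i> * \<tau>) - 2 * pi * \<i> * x) * (\<Sum>\<^sub>\<infinity>k\<in>UNIV. theta_term (k + 1) x)"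
    by (rule infsum_cmult_right')
  also have "(\<Sum>\<^sub>\<infinity>k\<in>UNIV. theta_term (k + 1) x) = (\<Sum>\<^sub>\<infinity>k\<in>UNIV. theta_term k x)"
    by (rule infsum_reindex_bij_betw) (rule bij_betw_byWitness[where f' = "\<lambda>k. k - 1"], auto)
  finally show ?thesis by (simp add: theta1_eq)
qed

lemma theta1_qp: "qp 1 (- 1) (- exp (- (pi * \<i> * \<tau>))) \<theta>"
  unfolding qp_def
proof (intro conjI allI)
  show "\<theta> (x + \<tau>) = - exp (- (pi * \<i> * \<tau>)) * exp (- 2 * pi * \<i> * of_nat 1 * x) * \<theta> x" for x
    unfolding theta1_plus_tau by (simp add: exp_diff exp_minus field_simps)
qed (simp_all add: theta1_holomorphic theta1_plus_1)

text \<open>The series has half-integral frequencies \<open>k + 1/2\<close>. The exponential factor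
  makes them integral, so that the terms become orthogonal on the unit interval.\<close>

lemma theta_term_fourier:
  "((\<lambda>t::real. theta_term k (of_real t) * exp (- (pi * \<i> * of_real t))) has_integral
     (if k = 0 then exp (pi * \<i> * \<tau> / 4 + pi * \<i> / 2) else 0)) {0..1}"
proof -
  define c where "c = exp (of_real pi * \<i> * \<tau> * (of_int k + 1/2)\<^sup>2 + of_real pi * \<i> * (of_int k + 1/2))"
  have eq: "theta_term k (of_real t) * exp (- (pi * \<i> * of_real t)) = c * exp (2 * pi * \<i> * k * of_real t)" for t
    unfolding theta_term_def c_def exp_add[symmetric]
    by (rule arg_cong[of _ _ exp]) (simp add: algebra_simps)
  show ?thesis
  proof (cases "k = 0")
    case True
    have "((\<lambda>t::real. c) has_integral c) {0..1}" using has_integral_const_real[of c 0 1] by simp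
    moreover have "c = exp (pi * \<i> * \<tau> / 4 + pi * \<i> / 2)"
      unfolding c_def True by (simp add: power2_eq_square)
    ultimately show ?thesis by (simp add: eq) (simp add: True)
  next
    case False
    define w where "w = 2 * pi * \<i> * k"
    have w: "w \<noteq> 0" using False by (simp add: w_def)
    have "exp w = 1" unfolding w_def by (subst exp_eq_1) auto
    have "((\<lambda>t::real. c * exp (w * of_real t)) has_integral (c / w * exp (w * of_real 1) - c / w * exp (w * of_real 0))) {0..1}"
    proof (rule fundamental_theorem_of_calculus)
      fix t :: real
      have "((\<lambda>z. c / w * exp (w * z)) has_field_derivative c * exp (w * of_real t)) (at (of_real t))"
        using w by (auto intro!: derivative_eq_intros)
      thus "((\<lambda>t::real. c / w * exp (w * of_real t)) has_vector_derivative c * exp (w * of_real t)) (at t within {0..1})"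
        using has_vector_derivative_real_field by blast
    qed simp
    thus ?thesis using \<open>exp w = 1\<close> False by (simp add: eq w_def)
  qed
qed

text \<open>Otherwise the Fourier coefficient of index \<open>1/2\<close> would vanish.\<close>
lemma theta1_not_identically_zero: "\<exists>x. \<theta> x \<noteq> 0"
proof (rule ccontr)
  assume "\<not> ?thesis"
  hence zero: "\<theta> x = 0" for x by simp
  have "uniform_limit {0..1::real} (\<lambda>X t. - (\<Sum>k\<in>X. theta_term k (of_real t))) (\<lambda>t. \<theta> (of_real t)) (finite_subsets_at_top UNIV)"
    by (rule uniform_limit_compose'[OF theta1_uniform_limit[of 1]]) auto
  hence "uniform_limit {0..1::real} (\<lambda>X t. - (\<Sum>k\<in>X. theta_term k (of_real t)) * exp (- (pi * \<i> * of_real t)))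
    (\<lambda>t. \<theta> (of_real t) * exp (- (pi * \<i> * of_real t))) (finite_subsets_at_top UNIV)"
    by (rule uniform_lim_mult[OF _ uniform_limit_const])
       (auto simp: zero intro!: compact_imp_bounded compact_continuous_image continuous_intros)
  then obtain I J where I: "\<And>X. ((\<lambda>t. - (\<Sum>k\<in>X. theta_term k (of_real t)) * exp (- (pi * \<i> * of_real t))) has_integral I X) {0..1::real}"
    and J: "((\<lambda>t. \<theta> (of_real t) * exp (- (pi * \<i> * of_real t))) has_integral J) {0..1::real}"
    and lim: "(I \<longlongrightarrow> J) (finite_subsets_at_top UNIV)"
    by (rule uniform_limit_integral) (auto simp: theta_term_def intro!: continuous_intros)
  have "J = 0" using J by (simp add: zero)
  define c where "c = exp (pi * \<i> * \<tau> / 4 + pi * \<i> / 2)"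
  \<comment> \<open>Every finite index set containing 0 already yields the full coefficient, so the
    net of integrals is eventually constant.\<close>
  have IX: "I X = - c" if "finite X" "0 \<in> X" for X
  proof -
    have "((\<lambda>t. - (\<Sum>k\<in>X. theta_term k (of_real t) * exp (- (pi * \<i> * of_real t)))) has_integral
      - (\<Sum>k\<in>X. if k = 0 then c else 0)) {0..1}"
      unfolding c_def by (intro has_integral_neg has_integral_sum that theta_term_fourier)
    hence "((\<lambda>t. - (\<Sum>k\<in>X. theta_term k (of_real t)) * exp (- (pi * \<i> * of_real t))) has_integral - c) {0..1}"
      using that by (simp add: sum_distrib_right)
    thus ?thesis using I has_integral_unique by blast
  qed
  have "\<forall>\<^sub>F X in finite_subsets_at_top UNIV. I X = - c"
    unfolding eventually_finite_subsets_at_top using IX by (intro exI[of _ "{0}"]) auto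
  hence "(I \<longlongrightarrow> - c) (finite_subsets_at_top UNIV)"
    by (rule tendsto_eventually)
  hence "c = 0" using lim \<open>J = 0\<close> tendsto_unique[of "finite_subsets_at_top (UNIV :: int set)" I] by force
  thus False by (simp add: c_def)
qed

end

subsection \<open>The infinite product and the zeros of theta\<close>

text \<open>The q-Pochhammer symbol of \<open>q * z\<close>. Exponents start at 1 because in
  \<open>theta_prod\<close> the sine supplies the remaining zeros, at the integers.\<close>

definition euler_prod :: "complex \<Rightarrow> complex \<Rightarrow> complex" where
  "euler_prod q z = (\<Prod>n. 1 - q ^ (n + 1) * z)"

lemma euler_prod_convergent:
  fixes q z :: complex
  assumes "norm q < 1"
  shows "convergent_prod (\<lambda>n. 1 - q ^ (n + 1) * z)"
proof -
  have "summable (\<lambda>n. norm z * norm q * norm q ^ n)"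
    using assms by (intro summable_mult summable_geometric) simp
  moreover have "norm z * norm q * norm q ^ n = norm ((1 - q ^ (n + 1) * z) - 1)" for n
    by (simp add: norm_mult norm_power)
  ultimately have "summable (\<lambda>n. norm ((1 - q ^ (n + 1) * z) - 1))" by simp
  thus ?thesis
    by (intro abs_convergent_prod_imp_convergent_prod) (simp add: abs_convergent_prod_conv_summable)
qed

lemma euler_prod_limit:
  assumes "norm q < 1"
  shows "(\<lambda>N. \<Prod>n<N. 1 - q ^ (n + 1) * z) \<longlonglongrightarrow> euler_prod q z"
  unfolding euler_prod_def LIMSEQ_lessThan_iff_atMost
  by (rule convergent_prod_LIMSEQ[OF euler_prod_convergent[OF assms]])

text \<open>Splitting off the first factor replaces \<open>z\<close> by \<open>q * z\<close>, which
  is the effect of a shift by \<tau>; this is the source of the quasi-periodicity of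
  \<open>theta_prod\<close>.\<close>

lemma euler_prod_rec:
  assumes "norm q < 1"
  shows "euler_prod q z = (1 - q * z) * euler_prod q (q * z)"
proof -
  have "(\<Prod>n<Suc N. 1 - q ^ (n + 1) * z) = (1 - q * z) * (\<Prod>n<N. 1 - q ^ (n + 1) * (q * z))" for N
    by (subst prod.lessThan_Suc_shift) (simp add: mult_ac)
  moreover have "(\<lambda>N. \<Prod>n<Suc N. 1 - q ^ (n + 1) * z) \<longlonglongrightarrow> euler_prod q z"
    using euler_prod_limit[OF assms] LIMSEQ_Suc by blast
  ultimately have "(\<lambda>N. (1 - q * z) * (\<Prod>n<N. 1 - q ^ (n + 1) * (q * z))) \<longlonglongrightarrow> euler_prod q z"
    by simp
  moreover have "(\<lambda>N. (1 - q * z) * (\<Prod>n<N. 1 - q ^ (n + 1) * (q * z))) \<longlonglongrightarrow> (1 - q * z) * euler_prod q (q * z)"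
    by (intro tendsto_intros euler_prod_limit assms)
  ultimately show ?thesis using LIMSEQ_unique by blast
qed

lemma euler_prod_eq_0:
  assumes "norm q < 1" "euler_prod q z = 0"
  shows "\<exists>n. q ^ (n + 1) * z = 1"
  using prodinf_nonzero[OF euler_prod_convergent[OF assms(1)], of z] assms(2)
  by (auto simp: euler_prod_def)

lemma euler_prod_holomorphic:
  assumes "norm q < 1"
  shows "euler_prod q holomorphic_on UNIV"
proof (rule holomorphic_uniform_sequence[of UNIV "\<lambda>N z. \<Prod>n<N. 1 - q ^ (n + 1) * z"])
  fix x :: complex
  have "uniformly_convergent_on (cball x 1) (\<lambda>N z. \<Prod>n<N. 1 - q ^ (n + 1) * z)"
  proof (rule uniformly_convergent_on_prod')
    show "uniformly_convergent_on (cball x 1) (\<lambda>N z. \<Sum>n<N. norm (1 - q ^ (n + 1) * z - 1))"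
    proof (rule Weierstrass_m_test')
      fix n z assume "z \<in> cball x 1"
      hence "norm z \<le> norm x + 1"
        by (smt (verit) dist_norm mem_cball norm_minus_commute norm_triangle_sub)
      thus "norm (norm (1 - q ^ (n + 1) * z - 1)) \<le> (norm x + 1) * norm q * norm q ^ n"
        by (simp add: norm_mult norm_power mult_ac mult_left_mono mult_right_mono)
    next
      show "summable (\<lambda>n. (norm x + 1) * norm q * norm q ^ n)"
        using assms by (intro summable_mult summable_geometric) simp
    qed
  qed (auto intro!: continuous_intros)
  hence "uniform_limit (cball x 1) (\<lambda>N z. \<Prod>n<N. 1 - q ^ (n + 1) * z)
     (\<lambda>z. lim (\<lambda>N. \<Prod>n<N. 1 - q ^ (n + 1) * z)) sequentially"
    by (simp add: uniformly_convergent_uniform_limit_iff)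
  moreover have "lim (\<lambda>N. \<Prod>n<N. 1 - q ^ (n + 1) * z) = euler_prod q z" for z
    using euler_prod_limit[OF assms] by (rule limI)
  ultimately show "\<exists>d>0. cball x d \<subseteq> UNIV \<and>
      uniform_limit (cball x d) (\<lambda>N z. \<Prod>n<N. 1 - q ^ (n + 1) * z) (euler_prod q) sequentially"
    by (intro exI[of _ 1]) simp
qed (auto intro!: holomorphic_intros)

context theta
begin

definition nome :: complex where "nome = exp (2 * pi * \<i> * \<tau>)"

lemma norm_nome: "norm nome < 1"
  using Im_tau_pos by (simp add: nome_def norm_exp_eq_Re)

lemma nome_nonzero: "nome \<noteq> 0" by (simp add: nome_def)

definition theta_prod :: "complex \<Rightarrow> complex" where
  "theta_prod x = sin (of_real pi * x) * euler_prod nome (exp (2 * pi * \<i> * x)) * euler_prod nome (exp (- (2 * pi * \<i> * x)))"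

lemma theta_prod_holomorphic: "theta_prod holomorphic_on UNIV"
  unfolding theta_prod_def[abs_def]
  by (intro holomorphic_intros holomorphic_on_compose_gen[OF _ euler_prod_holomorphic[OF norm_nome], unfolded o_def]) auto

lemma theta_prod_plus_1: "theta_prod (x + 1) = - theta_prod x"
proof -
  have "exp (2 * pi * \<i> * (x + 1)) = exp (2 * pi * \<i> * x)"
    by (subst exp_eq) (auto intro!: exI[of _ 1] simp: algebra_simps)
  moreover have "exp (- (2 * pi * \<i> * (x + 1))) = exp (- (2 * pi * \<i> * x))"
    by (subst exp_eq) (auto intro!: exI[of _ "-1"] simp: algebra_simps)
  moreover have "sin (of_real pi * (x + 1)) = - sin (of_real pi * x)"
    by (simp add: distrib_left sin_plus_pi)
  ultimately show ?thesis by (simp add: theta_prod_def)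
qed

lemma theta_prod_eq_0:
  assumes "theta_prod x = 0" shows "x \<in> period_lattice \<tau>"
proof -
  consider "sin (of_real pi * x) = 0" | "euler_prod nome (exp (2 * pi * \<i> * x)) = 0" | "euler_prod nome (exp (- (2 * pi * \<i> * x))) = 0"
    using assms by (auto simp: theta_prod_def)
  thus ?thesis
  proof cases
    case 1
    then obtain k :: int where "pi * x = of_real (k * pi)"
      unfolding Complex_Transcendental.sin_eq_0 by auto
    hence "x = of_int k + of_int 0 * \<tau>" by simp
    thus ?thesis unfolding period_lattice_def by blast
  next
    case 2
    then obtain n where "nome ^ (n + 1) * exp (2 * pi * \<i> * x) = 1"
      using euler_prod_eq_0[OF norm_nome] by blast
    hence "exp (of_nat (n + 1) * (2 * pi * \<i> * \<tau>) + 2 * pi * \<i> * x) = exp 0"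
      unfolding exp_add nome_def exp_of_nat_mult by simp
    then obtain k :: int where "of_nat (n + 1) * (2 * pi * \<i> * \<tau>) + 2 * pi * \<i> * x = 0 + (of_int (2 * k) * pi) * \<i>"
      unfolding exp_eq by blast
    hence "2 * pi * \<i> * x = 2 * pi * \<i> * (of_int k + of_int (- int (n + 1)) * \<tau>)"
      by (simp add: algebra_simps)
    hence "x = of_int k + of_int (- int (n + 1)) * \<tau>" by (subst (asm) mult_cancel_left) simp
    thus ?thesis unfolding period_lattice_def by blast
  next
    case 3
    then obtain n where "nome ^ (n + 1) * exp (- (2 * pi * \<i> * x)) = 1"
      using euler_prod_eq_0[OF norm_nome] by blast
    hence "exp (of_nat (n + 1) * (2 * pi * \<i> * \<tau>) + - (2 * pi * \<i> * x)) = exp 0"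
      unfolding exp_add nome_def exp_of_nat_mult by simp
    then obtain k :: int where "of_nat (n + 1) * (2 * pi * \<i> * \<tau>) + - (2 * pi * \<i> * x) = 0 + (of_int (2 * k) * pi) * \<i>"
      unfolding exp_eq by blast
    hence "2 * pi * \<i> * x = 2 * pi * \<i> * (of_int (- k) + of_int (int (n + 1)) * \<tau>)"
      by (simp add: algebra_simps)
    hence "x = of_int (- k) + of_int (int (n + 1)) * \<tau>" by (subst (asm) mult_cancel_left) simp
    thus ?thesis unfolding period_lattice_def by blast
  qed
qed

lemma theta_prod_plus_tau: "theta_prod (x + \<tau>) = - exp (- (pi * \<i> * \<tau>) - 2 * pi * \<i> * x) * theta_prod x"
proof -
  \<comment> \<open>The sine involves a square root of the variable \<open>Z\<close> of the Euler
    products. In terms of the half exponentials everything becomes rational.\<close>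
  define e u where "e = exp (pi * \<i> * x)" and "u = exp (pi * \<i> * \<tau>)"
  define Z where "Z = e\<^sup>2"
  have nz: "e \<noteq> 0" "u \<noteq> 0" "Z \<noteq> 0" by (auto simp: e_def u_def Z_def)
  have q: "nome = u\<^sup>2" by (simp add: nome_def u_def mult_ac flip: exp_double)
  have Z: "exp (2 * pi * \<i> * x) = Z" by (simp add: Z_def e_def mult_ac flip: exp_double)
  have Z': "exp (- (2 * pi * \<i> * x)) = 1 / Z" unfolding exp_minus Z by (simp only: inverse_eq_divide)
  have qZ: "exp (2 * pi * \<i> * (x + \<tau>)) = nome * Z"
    unfolding Z[symmetric] nome_def exp_add[symmetric] by (simp add: algebra_simps)
  have qZ': "exp (- (2 * pi * \<i> * (x + \<tau>))) = 1 / (nome * Z)"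
    unfolding exp_minus qZ by (simp only: inverse_eq_divide)
  have s: "sin (of_real pi * x) = (e - 1 / e) / (2 * \<i>)"
  proof -
    have "exp (\<i> * (of_real pi * x)) = e" by (simp add: e_def mult_ac)
    moreover from this have "exp (- \<i> * (of_real pi * x)) = 1 / e" by (simp add: exp_minus inverse_eq_divide)
    ultimately show ?thesis unfolding sin_exp_eq by simp
  qed
  have s': "sin (of_real pi * (x + \<tau>)) = (e * u - 1 / (e * u)) / (2 * \<i>)"
  proof -
    have "exp (\<i> * (of_real pi * (x + \<tau>))) = e * u"
      unfolding e_def u_def exp_add[symmetric] by (simp add: algebra_simps)
    moreover from this have "exp (- \<i> * (of_real pi * (x + \<tau>))) = 1 / (e * u)"
      by (simp only: exp_minus inverse_eq_divide mult_minus_left)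
    ultimately show ?thesis unfolding sin_exp_eq mult_minus_left by (simp only:)
  qed
  \<comment> \<open>The recursion is used once for the function at \<open>x\<close> and once for the
    function at \<open>x + \<tau>\<close>, so that both display the same pair of Euler
    products.\<close>
  have f1: "euler_prod nome Z = (1 - nome * Z) * euler_prod nome (nome * Z)"
    by (rule euler_prod_rec[OF norm_nome])
  have f2: "euler_prod nome (1 / (nome * Z)) = (1 - 1 / Z) * euler_prod nome (1 / Z)"
    using euler_prod_rec[OF norm_nome, of "1 / (nome * Z)"] nome_nonzero nz by simp
  have m: "exp (- (pi * \<i> * \<tau>) - 2 * pi * \<i> * x) = 1 / (u * Z)"
    unfolding exp_diff exp_minus Z u_def[symmetric] by (simp add: field_simps)
  have L: "theta_prod (x + \<tau>) = (e * u - 1 / (e * u)) / (2 * \<i>) * euler_prod nome (nome * Z) * ((1 - 1 / Z) * euler_prod nome (1 / Z))"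
    unfolding theta_prod_def qZ qZ' s' f2 ..
  have R: "theta_prod x = (e - 1 / e) / (2 * \<i>) * ((1 - nome * Z) * euler_prod nome (nome * Z)) * euler_prod nome (1 / Z)"
    unfolding theta_prod_def Z Z' s f1 ..
  have "(e * u - 1 / (e * u)) * (1 - 1 / Z) = - (1 / (u * Z)) * ((e - 1 / e) * (1 - nome * Z))"
    using nz unfolding Z_def q by (simp add: field_simps power2_eq_square)
  moreover have "theta_prod (x + \<tau>) = (e * u - 1 / (e * u)) * (1 - 1 / Z)
      * (euler_prod nome (nome * Z) * euler_prod nome (1 / Z) / (2 * \<i>))"
    unfolding L by (simp only: divide_inverse mult_ac)
  ultimately show ?thesis unfolding R m by (simp only: divide_inverse mult_ac mult_minus_left mult_minus_right)
qed

lemma theta_prod_qp: "qp 1 (- 1) (- exp (- (pi * \<i> * \<tau>))) theta_prod"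
  unfolding qp_def
proof (intro conjI allI)
  show "theta_prod (x + \<tau>) = - exp (- (pi * \<i> * \<tau>)) * exp (- 2 * pi * \<i> * of_nat 1 * x) * theta_prod x" for x
    unfolding theta_prod_plus_tau by (simp add: exp_diff exp_minus field_simps)
qed (simp_all add: theta_prod_holomorphic theta_prod_plus_1)

text \<open>All zeros are lattice translates of 0, so one derivative suffices. It is \<pi> times the
  square of \<open>euler_prod nome 1\<close>, which is nonzero because no positive power of the nome
  equals 1.\<close>

lemma theta_prod_simple_zeros: "simple_zeros theta_prod"
proof -
  define E where "E = (\<lambda>x. euler_prod nome (exp (2 * pi * \<i> * x)) * euler_prod nome (exp (- (2 * pi * \<i> * x))))"
  have "E holomorphic_on UNIV" unfolding E_def
    by (intro holomorphic_intros holomorphic_on_compose_gen[OF _ euler_prod_holomorphic[OF norm_nome], unfolded o_def]) auto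
  hence "(E has_field_derivative deriv E 0) (at 0)"
    by (simp add: holomorphic_derivI)
  hence "((\<lambda>x. sin (of_real pi * x) * E x) has_field_derivative pi * E 0) (at 0)"
    by (auto intro!: derivative_eq_intros)
  moreover have "theta_prod = (\<lambda>x. sin (of_real pi * x) * E x)"
    by (auto simp: theta_prod_def E_def)
  ultimately have "deriv theta_prod 0 = pi * E 0"
    using DERIV_imp_deriv by metis
  moreover have "E 0 \<noteq> 0"
  proof
    assume "E 0 = 0"
    then obtain n where "nome ^ (n + 1) * 1 = 1" using euler_prod_eq_0[OF norm_nome, of 1] by (auto simp: E_def)
    hence "norm nome ^ (n + 1) = 1" by (metis mult.right_neutral norm_one norm_power)
    thus False using norm_nome power_less_one_iff[of "norm nome" "n + 1"] by simp
  qed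
  ultimately have "deriv theta_prod 0 \<noteq> 0" by simp
  moreover have "theta_prod 0 = 0" by (simp add: theta_prod_def)
  ultimately have "deriv theta_prod x \<noteq> 0" if "theta_prod x = 0" for x
    using qp_deriv_shift[OF theta_prod_qp, of 0 x] theta_prod_eq_0[OF that] by simp
  thus ?thesis unfolding simple_zeros_def using theta_prod_holomorphic by blast
qed

lemma theta1_lattice: "x \<in> period_lattice \<tau> \<Longrightarrow> \<theta> x = 0"
  by (rule qp_zero_shift[OF theta1_qp, of 0]) auto

text \<open>Degrees subtract and multipliers divide; cancelling \<open>g\<close> is legitimate also
  at its zeros because these are simple.\<close>

lemma qp_quotient:
  assumes "simple_zeros g" "h holomorphic_on UNIV" "\<And>x. f x = g x * h x" "qp (n + k) \<alpha> \<beta> f" "qp k a b g"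
    "a \<noteq> 0" "b \<noteq> 0"
  shows "qp n (\<alpha> / a) (\<beta> / b) h"
  unfolding qp_def
proof (intro conjI allI)
  have hs: "(\<lambda>x. h (x + c)) holomorphic_on UNIV" for c
    by (rule holomorphic_on_compose_gen[OF _ assms(2), unfolded o_def]) (auto intro!: holomorphic_intros)
  fix x
  show "h (x + 1) = \<alpha> / a * h x"
  proof (rule simple_zeros_mult_cancel[OF assms(1), of "\<lambda>x. h (x + 1)" "\<lambda>x. \<alpha> / a * h x"])
    fix z
    have "\<alpha> * (g z * h z) = a * g z * h (z + 1)"
      using assms(4,5) assms(3)[of "z + 1"] assms(3)[of z] by (simp add: qp_def)
    thus "g z * h (z + 1) = g z * (\<alpha> / a * h z)" using assms(6) by (auto simp: field_simps)
  qed (auto intro!: hs assms(2) holomorphic_intros)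
  show "h (x + \<tau>) = \<beta> / b * exp (- 2 * pi * \<i> * n * x) * h x"
  proof (rule simple_zeros_mult_cancel[OF assms(1), of "\<lambda>x. h (x + \<tau>)" "\<lambda>x. \<beta> / b * exp (- 2 * pi * \<i> * n * x) * h x"])
    fix z
    define A B where "A = exp (- 2 * pi * \<i> * n * z)" and "B = exp (- 2 * pi * \<i> * k * z)"
    have AB: "exp (- 2 * pi * \<i> * of_nat (n + k) * z) = A * B"
      unfolding A_def B_def exp_add[symmetric] by (simp add: algebra_simps)
    have "f (z + \<tau>) = \<beta> * exp (- 2 * pi * \<i> * of_nat (n + k) * z) * f z"
      using assms(4) unfolding qp_def by blast
    hence "f (z + \<tau>) = \<beta> * (A * B) * f z" unfolding AB .
    moreover have "g (z + \<tau>) = b * B * g z"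
      using assms(5) unfolding B_def qp_def by blast
    ultimately have "\<beta> * (A * B) * (g z * h z) = b * B * g z * h (z + \<tau>)"
      using assms(3) by metis
    moreover have "B \<noteq> 0" by (simp add: B_def)
    ultimately show "g z * h (z + \<tau>) = g z * (\<beta> / b * exp (- 2 * pi * \<i> * n * z) * h z)"
      using assms(7) unfolding A_def[symmetric] by (auto simp: field_simps)
  qed (auto intro!: hs assms(2) holomorphic_intros)
qed (rule assms(2))

text \<open>The division is by the product, whose zeros are known: \<open>\<theta>\<close> vanishes
  on the lattice by oddness and quasi-periodicity alone. Equal multipliers make the quotient doubly
  periodic, hence constant. This yields the zeros of the series without the triple product
  identity.\<close>

lemma theta1_eq_prod: "\<exists>c. c \<noteq> 0 \<and> \<theta> = (\<lambda>x. c * theta_prod x)"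
proof -
  obtain h where h: "h holomorphic_on UNIV" "\<And>x. \<theta> x = theta_prod x * h x"
    using entire_divide_simple_zeros[OF theta1_holomorphic theta_prod_simple_zeros]
      theta_prod_eq_0 theta1_lattice by metis
  have "qp 0 1 1 h"
    using qp_quotient[OF theta_prod_simple_zeros h, where n = 0 and k = 1, OF _ theta_prod_qp, simplified, OF theta1_qp[simplified]] by simp
  hence "\<theta> x = h 0 * theta_prod x" for x
    using qp_0_constant[of h x 0] h(2)[of x] by simp
  thus ?thesis using theta1_not_identically_zero by (intro exI[of _ "h 0"]) auto
qed

lemma theta1_eq_0_iff: "\<theta> x = 0 \<longleftrightarrow> x \<in> period_lattice \<tau>"
  using theta1_eq_prod theta_prod_eq_0 theta1_lattice by (metis mult_eq_0_iff)

lemma theta1_simple_zeros: "simple_zeros \<theta>"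
proof -
  obtain c where c: "c \<noteq> 0" "\<theta> = (\<lambda>x. c * theta_prod x)" using theta1_eq_prod by blast
  have "deriv \<theta> x = c * deriv theta_prod x" for x
    unfolding c(2) using theta_prod_holomorphic
    by (intro deriv_cmult) (auto simp: holomorphic_on_def field_differentiable_def)
  thus ?thesis using theta_prod_simple_zeros c theta1_holomorphic by (auto simp: simple_zeros_def)
qed

lemma theta1_shift_qp: "qp 1 (- 1) (- exp (- (pi * \<i> * \<tau>) + 2 * pi * \<i> * a)) (\<lambda>x. \<theta> (x - a))"
  unfolding qp_def
proof (intro conjI allI)
  show "(\<lambda>x. \<theta> (x - a)) holomorphic_on UNIV"
    by (rule holomorphic_on_compose_gen[OF _ theta1_holomorphic, unfolded o_def]) (auto intro!: holomorphic_intros)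
  fix x
  show "\<theta> (x + 1 - a) = - 1 * \<theta> (x - a)" using theta1_plus_1[of "x - a"] by (simp add: algebra_simps)
  show "\<theta> (x + \<tau> - a) = - exp (- (pi * \<i> * \<tau>) + 2 * pi * \<i> * a) * exp (- 2 * pi * \<i> * of_nat 1 * x) * \<theta> (x - a)"
    using theta1_plus_tau[of "x - a"] by (simp add: algebra_simps flip: exp_add)
qed

text \<open>The substitute for counting zeros: one zero is traded for one degree.\<close>

lemma qp_divide_theta:
  assumes "qp (Suc n) \<alpha> \<beta> f" "\<alpha> \<noteq> 0" "\<beta> \<noteq> 0" "f a = 0"
  obtains h where "qp n (- \<alpha>) (- \<beta> * exp (pi * \<i> * \<tau> - 2 * pi * \<i> * a)) h" "\<And>x. f x = \<theta> (x - a) * h x"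
proof -
  have sz: "simple_zeros (\<lambda>x. \<theta> (x - a))" by (rule simple_zeros_shift[OF theta1_simple_zeros])
  have "f z = 0" if "\<theta> (z - a) = 0" for z
    using that assms by (intro qp_zero_shift[OF assms(1-4)]) (simp add: theta1_eq_0_iff)
  then obtain h where h: "h holomorphic_on UNIV" "\<And>x. f x = \<theta> (x - a) * h x"
    using entire_divide_simple_zeros[OF _ sz, of f] assms(1) unfolding qp_def by metis
  have "qp n (\<alpha> / - 1) (\<beta> / - exp (- (pi * \<i> * \<tau>) + 2 * pi * \<i> * a)) h"
    by (rule qp_quotient[OF sz h, where k = 1]) (use assms theta1_shift_qp in auto)
  moreover have "\<beta> / - exp (- (pi * \<i> * \<tau>) + 2 * pi * \<i> * a) = - \<beta> * exp (pi * \<i> * \<tau> - 2 * pi * \<i> * a)"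
    by (simp add: exp_diff exp_add exp_minus field_simps)
  ultimately show ?thesis using that h(2) by simp
qed

end

subsection \<open>Fay's identity and the elliptic Cauchy determinant\<close>

text \<open>Cofactors of the last row do not see the last entry. This splits the term
  \<open>d\<close> off the last diagonal entry, so that the pivot of the Schur complement is a pure
  \<open>Phi\<close> entry.\<close>

lemma det_last_entry_add:
  fixes f :: "nat \<Rightarrow> nat \<Rightarrow> complex"
  shows "Determinant.det (mat (Suc n) (Suc n) (\<lambda>(i, j). f i j + (if i = n \<and> j = n then d else 0)))
    = d * Determinant.det (mat n n (\<lambda>(i, j). f i j)) + Determinant.det (mat (Suc n) (Suc n) (\<lambda>(i, j). f i j))"
proof -
  define A where "A = mat (Suc n) (Suc n) (\<lambda>(i, j). f i j + (if i = n \<and> j = n then d else 0))"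
  define B where "B = mat (Suc n) (Suc n) (\<lambda>(i, j). f i j)"
  have cof: "cofactor A n j = cofactor B n j" for j
  proof -
    have "mat_delete A n j = mat_delete B n j"
      unfolding mat_delete_def by (rule eq_matI) (auto simp: A_def B_def)
    thus ?thesis by (simp add: cofactor_def)
  qed
  have "mat_delete B n n = mat n n (\<lambda>(i, j). f i j)"
    unfolding mat_delete_def by (rule eq_matI) (auto simp: B_def)
  hence cofn: "cofactor B n n = Determinant.det (mat n n (\<lambda>(i, j). f i j))"
    by (simp add: cofactor_def)
  have "Determinant.det A = (\<Sum>j<Suc n. A $$ (n, j) * cofactor B n j)"
    using laplace_expansion_row[of A "Suc n" n] by (simp add: A_def[symmetric] cof) (simp add: A_def)
  also have "\<dots> = (\<Sum>j<Suc n. B $$ (n, j) * cofactor B n j + (if j = n then d * cofactor B n j else 0))"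
    by (intro sum.cong) (auto simp: A_def B_def distrib_right)
  also have "\<dots> = (\<Sum>j<Suc n. B $$ (n, j) * cofactor B n j) + d * cofactor B n n"
    by (subst sum.distrib) (simp add: sum.delta)
  also have "(\<Sum>j<Suc n. B $$ (n, j) * cofactor B n j) = Determinant.det B"
    using laplace_expansion_row[of B "Suc n" n] by (simp add: B_def)
  finally show ?thesis unfolding cofn by (simp add: A_def B_def)
qed

text \<open>One elimination step, written as a block upper triangular matrix times a block lower
  triangular one with unit diagonal.\<close>

lemma det_schur_complement:
  fixes f :: "nat \<Rightarrow> nat \<Rightarrow> complex"
  assumes g: "f n n \<noteq> 0"
  shows "Determinant.det (mat (Suc n) (Suc n) (\<lambda>(i, j). f i j))
    = f n n * Determinant.det (mat n n (\<lambda>(i, j). f i j - f i n * f n j / f n n))"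
proof -
  define S where "S = mat n n (\<lambda>(i, j). f i j - f i n * f n j / f n n)"
  define U where "U = mat n 1 (\<lambda>(i, j). f i n)"
  define V where "V = mat 1 n (\<lambda>(i, j). f n j / f n n)"
  define G where "G = mat 1 1 (\<lambda>(i :: nat, j :: nat). f n n)"
  have c: "S \<in> carrier_mat n n" "U \<in> carrier_mat n 1" "V \<in> carrier_mat 1 n" "G \<in> carrier_mat 1 1"
    by (auto simp: S_def U_def V_def G_def)
  have "mat (Suc n) (Suc n) (\<lambda>(i, j). f i j) =
    four_block_mat S U (0\<^sub>m 1 n) G * four_block_mat (1\<^sub>m n) (0\<^sub>m n 1) V (1\<^sub>m 1)"
  proof -
    have "four_block_mat S U (0\<^sub>m 1 n) G * four_block_mat (1\<^sub>m n) (0\<^sub>m n 1) V (1\<^sub>m 1) =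
      four_block_mat (S * 1\<^sub>m n + U * V) (S * 0\<^sub>m n 1 + U * 1\<^sub>m 1) (0\<^sub>m 1 n * 1\<^sub>m n + G * V) (0\<^sub>m 1 n * 0\<^sub>m n 1 + G * 1\<^sub>m 1)"
      using c by (intro mult_four_block_mat) auto
    also have "\<dots> = four_block_mat (S + U * V) U (G * V) G"
      using c by simp
    also have "\<dots> = mat (Suc n) (Suc n) (\<lambda>(i, j). f i j)"
      using g by (intro eq_matI)
        (auto simp: four_block_mat_def Let_def S_def U_def V_def G_def scalar_prod_def less_Suc_eq)
    finally show ?thesis ..
  qed
  moreover have "four_block_mat S U (0\<^sub>m 1 n) G \<in> carrier_mat (n + 1) (n + 1)"
    "four_block_mat (1\<^sub>m n) (0\<^sub>m n 1) V (1\<^sub>m 1) \<in> carrier_mat (n + 1) (n + 1)"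
    using c by auto
  moreover have "Determinant.det (four_block_mat S U (0\<^sub>m 1 n) G) = Determinant.det S * Determinant.det G"
    by (rule det_four_block_mat_lower_left_zero[OF c(1,2) refl c(4)])
  moreover have "Determinant.det (four_block_mat (1\<^sub>m n) (0\<^sub>m n 1) V (1\<^sub>m 1)) = Determinant.det (1\<^sub>m n :: complex mat) * Determinant.det (1\<^sub>m 1 :: complex mat)"
    by (rule det_four_block_mat_upper_right_zero) (use c in auto)
  moreover have "Determinant.det G = f n n"
    using c(4) by (subst det_single) (auto simp: G_def)
  ultimately show ?thesis
    using det_mult[of "four_block_mat S U (0\<^sub>m 1 n) G" "n + 1" "four_block_mat (1\<^sub>m n) (0\<^sub>m n 1) V (1\<^sub>m 1)"]
    by (simp add: S_def[symmetric])
qed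

context theta
begin

lemma qp_mult:
  assumes "qp n \<alpha> \<beta> f" "qp m \<alpha>' \<beta>' g"
  shows "qp (n + m) (\<alpha> * \<alpha>') (\<beta> * \<beta>') (\<lambda>x. f x * g x)"
proof -
  have "exp (- 2 * pi * \<i> * of_nat (n + m) * x) = exp (- 2 * pi * \<i> * n * x) * exp (- 2 * pi * \<i> * m * x)" for x
    unfolding exp_add[symmetric] by (simp add: algebra_simps)
  thus ?thesis using assms unfolding qp_def by (auto intro!: holomorphic_intros)
qed

lemma qp_add: "qp n \<alpha> \<beta> f \<Longrightarrow> qp n \<alpha> \<beta> g \<Longrightarrow> qp n \<alpha> \<beta> (\<lambda>x. f x + g x)"
  unfolding qp_def by (auto intro!: holomorphic_intros simp: distrib_left)

lemma qp_cmult: "qp n \<alpha> \<beta> f \<Longrightarrow> qp n \<alpha> \<beta> (\<lambda>x. f x * c)"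
  unfolding qp_def by (auto intro!: holomorphic_intros)

text \<open>The contributions of \<open>a\<close> and \<open>- a\<close> to the multiplier cancel.
  Hence all summands of the three-term relation lie in one and the same space of degree 2.\<close>

lemma theta1_pair_qp: "qp 2 1 (exp (- (2 * pi * \<i> * \<tau>))) (\<lambda>x. \<theta> (x + a) * \<theta> (x - a))"
proof -
  have "qp (1 + 1) (- 1 * - 1) (- exp (- (pi * \<i> * \<tau>) + 2 * pi * \<i> * (- a)) * - exp (- (pi * \<i> * \<tau>) + 2 * pi * \<i> * a))
    (\<lambda>x. \<theta> (x - (- a)) * \<theta> (x - a))"
    by (rule qp_mult[OF theta1_shift_qp theta1_shift_qp])
  moreover have "- exp (- (pi * \<i> * \<tau>) + 2 * pi * \<i> * (- a)) * - exp (- (pi * \<i> * \<tau>) + 2 * pi * \<i> * a) = exp (- (2 * pi * \<i> * \<tau>))"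
    by (simp add: mult_ac flip: exp_add)
  ultimately show ?thesis by (simp add: numeral_2_eq_2)
qed

lemma theta1_isCont [continuous_intros]:
  assumes "isCont f x" shows "isCont (\<lambda>x. \<theta> (f x)) x"
  using continuous_at_compose[OF assms entire_isCont[OF theta1_holomorphic]] by (simp add: o_def)

lemma theta1_eventually_nonzero: "eventually (\<lambda>x. \<theta> (x - a) \<noteq> 0) (at x)"
  by (rule simple_zeros_eventually_nonzero[OF simple_zeros_shift[OF theta1_simple_zeros]])

lemma theta1_double_eventually_nonzero: "eventually (\<lambda>x. \<theta> (2 * x) \<noteq> 0) (at x)"
proof -
  have "simple_zeros (\<lambda>x. \<theta> (2 * x))"
    unfolding simple_zeros_def
  proof (intro conjI allI impI)
    show "(\<lambda>x. \<theta> (2 * x)) holomorphic_on UNIV"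
      by (rule holomorphic_on_compose_gen[OF _ theta1_holomorphic, unfolded o_def]) (auto intro!: holomorphic_intros)
    fix z assume "\<theta> (2 * z) = 0"
    hence "deriv \<theta> (2 * z) \<noteq> 0" using theta1_simple_zeros by (simp add: simple_zeros_def)
    moreover have "((\<lambda>x. \<theta> (2 * x)) has_field_derivative deriv \<theta> (2 * z) * 2) (at z)"
      by (rule DERIV_chain'[where f = "\<lambda>x. 2 * x"])
         (auto intro!: derivative_eq_intros holomorphic_derivI[OF theta1_holomorphic])
    ultimately show "deriv (\<lambda>x. \<theta> (2 * x)) z \<noteq> 0" using DERIV_imp_deriv by fastforce
  qed
  thus ?thesis by (rule simple_zeros_eventually_nonzero)
qed

section \<open>The three-term relation of Weierstrass and Fay's identity\<close>

definition weierstrass_sum :: "complex \<Rightarrow> complex \<Rightarrow> complex \<Rightarrow> complex \<Rightarrow> complex" where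
  "weierstrass_sum x a b c = \<theta> (x + a) * \<theta> (x - a) * (\<theta> (b + c) * \<theta> (b - c))
     + \<theta> (x + b) * \<theta> (x - b) * (\<theta> (c + a) * \<theta> (c - a))
     + \<theta> (x + c) * \<theta> (x - c) * (\<theta> (a + b) * \<theta> (a - b))"

lemma theta1_diff_commute: "\<theta> (a - b) = - \<theta> (b - a)"
  using theta1_minus[of "b - a"] by simp

text \<open>In \<open>x\<close> this has degree 2 but vanishes at \<open>a\<close>,
  \<open>- a\<close> and \<open>b\<close>. The hypotheses make these points distinct modulo the
  lattice, so two divisions leave a constant with a zero.\<close>

lemma weierstrass_sum_generic:
  assumes "\<theta> (2 * a) \<noteq> 0" "\<theta> (a - b) \<noteq> 0" "\<theta> (a + b) \<noteq> 0"
  shows "weierstrass_sum x a b c = 0"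
proof -
  define F where "F = (\<lambda>x. weierstrass_sum x a b c)"
  have qF: "qp (Suc 1) 1 (exp (- (2 * pi * \<i> * \<tau>))) F"
    unfolding F_def weierstrass_sum_def using theta1_pair_qp
    by (intro qp_add qp_cmult) (simp_all add: numeral_2_eq_2)
  have Fa: "F a = 0" and Fa': "F (- a) = 0" and Fb: "F b = 0"
    unfolding F_def weierstrass_sum_def
    using theta1_minus[of "a + b"] theta1_minus[of "a + c"] theta1_minus[of "a - b"] theta1_minus[of "a - c"]
      theta1_minus[of "b - c"]
    by (simp_all add: add.commute)
  obtain h where h: "qp (Suc 0) (- 1) (- exp (- (2 * pi * \<i> * \<tau>)) * exp (pi * \<i> * \<tau> - 2 * pi * \<i> * a)) h"
    "\<And>x. F x = \<theta> (x - a) * h x"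
    using qp_divide_theta[OF qF _ _ Fa] by auto
  have "h (- a) = 0"
    using h(2)[of "- a"] Fa' assms(1) theta1_minus[of "2 * a"] by simp
  then obtain k where k: "qp 0 (- (- 1)) (- (- exp (- (2 * pi * \<i> * \<tau>)) * exp (pi * \<i> * \<tau> - 2 * pi * \<i> * a)) * exp (pi * \<i> * \<tau> - 2 * pi * \<i> * (- a))) k"
    "\<And>x. h x = \<theta> (x - (- a)) * k x"
    using qp_divide_theta[OF h(1), of "- a"] by auto
  have "- (- exp (- (2 * pi * \<i> * \<tau>)) * exp (pi * \<i> * \<tau> - 2 * pi * \<i> * a)) * exp (pi * \<i> * \<tau> - 2 * pi * \<i> * (- a)) = 1"
    by (simp flip: exp_add)
  hence "qp 0 1 1 k" using k(1) by simp
  moreover have "k b = 0"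
    using Fb assms(2,3) theta1_diff_commute[of b a] by (simp add: h(2) k(2) add.commute)
  ultimately have "k x = 0" using qp_0_constant[of k x b] by simp
  thus ?thesis using h(2)[of x] k(2)[of x] by (simp add: F_def)
qed

text \<open>For fixed \<open>b\<close> the excluded values of \<open>a\<close> are isolated, so
  continuity in \<open>a\<close> suffices.\<close>

lemma weierstrass_three_term: "weierstrass_sum x a b c = 0"
proof (rule continuous_eq_of_eventually_eq[where u = "\<lambda>a. weierstrass_sum x a b c" and v = "\<lambda>_. 0"])
  show "isCont (\<lambda>a. weierstrass_sum x a b c) a"
    unfolding weierstrass_sum_def by (intro continuous_intros)
  show "\<forall>\<^sub>F a in at a. weierstrass_sum x a b c = 0"
    using theta1_double_eventually_nonzero[of a] theta1_eventually_nonzero[of b a]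
      theta1_eventually_nonzero[of "- b" a]
    by eventually_elim (simp add: weierstrass_sum_generic)
qed simp

text \<open>The three-term relation in other coordinates: \<open>P\<close>, \<open>Q\<close>,
  \<open>Q'\<close>, \<open>S\<close> are the half sums and half differences of paired arguments,
  and the twelve arguments listed in \<open>e\<close> match up to one sign.\<close>

lemma theta1_fay:
  "\<theta> (z + x1 - y1) * \<theta> (z + x2 - y2) * \<theta> (x1 - y2) * \<theta> (x2 - y1)
   - \<theta> (z + x1 - y2) * \<theta> (z + x2 - y1) * \<theta> (x1 - y1) * \<theta> (x2 - y2)
   = \<theta> z * \<theta> (z + x1 + x2 - y1 - y2) * \<theta> (x1 - x2) * \<theta> (y2 - y1)"
proof -
  define P where "P = z + (x1 + x2 - y1 - y2) / 2"
  define Q where "Q = (x1 - x2 - y1 + y2) / 2"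
  define Q' where "Q' = (x1 - x2 + y1 - y2) / 2"
  define S where "S = (x1 + x2 - y1 - y2) / 2"
  have e: "P + Q = z + x1 - y1" "P - Q = z + x2 - y2" "P + Q' = z + x1 - y2" "P - Q' = z + x2 - y1"
    "P + S = z + x1 + x2 - y1 - y2" "P - S = z" "Q' + S = x1 - y2" "Q' - S = y1 - x2" "S + Q = x1 - y1"
    "S - Q = x2 - y2" "Q + Q' = x1 - x2" "Q - Q' = y2 - y1"
    by (simp_all add: P_def Q_def Q'_def S_def field_simps)
  show ?thesis
    using weierstrass_three_term[of P Q Q' S] theta1_diff_commute[of y1 x2]
    unfolding weierstrass_sum_def e by (simp add: algebra_simps)
qed

text \<open>Over a common denominator the left side is Fay's combination. The result is again a
  \<open>Phi\<close>, with \<open>z\<close> shifted by \<open>x2 - y2\<close>, times one factor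
  depending only on \<open>x1\<close> and one only on \<open>y1\<close> (for fixed
  \<open>x2\<close>, \<open>y2\<close>): a rescaling of rows and columns, which lets the induction
  close.\<close>

lemma Phi_schur:
  assumes "\<theta> z \<noteq> 0" "\<theta> (z + x2 - y2) \<noteq> 0"
    "\<theta> (x1 - y1) \<noteq> 0" "\<theta> (x1 - y2) \<noteq> 0" "\<theta> (x2 - y1) \<noteq> 0" "\<theta> (x2 - y2) \<noteq> 0"
  shows "Phi \<tau> (x1 - y1) z - Phi \<tau> (x1 - y2) z * Phi \<tau> (x2 - y1) z / Phi \<tau> (x2 - y2) z
    = \<theta> (x1 - x2) / \<theta> (x1 - y2) * (\<theta> (y2 - y1) / \<theta> (x2 - y1)) * Phi \<tau> (x1 - y1) (z + x2 - y2)"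
proof -
  define A B C D E F G H where defs: "A = \<theta> (z + x1 - y1)" "B = \<theta> (z + x2 - y2)" "C = \<theta> (x1 - y2)" "D = \<theta> (x2 - y1)"
    "E = \<theta> (z + x1 - y2)" "F = \<theta> (z + x2 - y1)" "G = \<theta> (x1 - y1)" "H = \<theta> (x2 - y2)"
  define T X Y Z where defs': "T = \<theta> (z + x1 + x2 - y1 - y2)" "X = \<theta> (x1 - x2)" "Y = \<theta> (y2 - y1)" "Z = \<theta> z"
  have fay: "A * B * C * D - E * F * G * H = Z * T * X * Y"
    using theta1_fay unfolding defs defs' by simp
  have nz: "Z \<noteq> 0" "B \<noteq> 0" "G \<noteq> 0" "C \<noteq> 0" "D \<noteq> 0" "H \<noteq> 0"
    using assms unfolding defs defs' by auto
  have "Phi \<tau> (x1 - y1) z - Phi \<tau> (x1 - y2) z * Phi \<tau> (x2 - y1) z / Phi \<tau> (x2 - y2) z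
    = A / (G * Z) - (E / (C * Z)) * (F / (D * Z)) / (B / (H * Z))"
    unfolding Phi_def defs defs' by (simp add: add_diff_eq)
  also have "\<dots> = (A * B * C * D - E * F * G * H) / (Z * B * C * D * G)"
    using nz by (simp add: field_simps)
  also have "\<dots> = X / C * (Y / D) * (T / (G * B))"
    unfolding fay using nz by (simp add: field_simps)
  also have "T / (G * B) = Phi \<tau> (x1 - y1) (z + x2 - y2)"
    unfolding Phi_def defs defs' by (simp add: algebra_simps)
  finally show ?thesis by (simp add: defs defs')
qed

text \<open>For index set \<open>I\<close> this is the principal minor of \<open>r\<^sub>i c\<^sub>j Phi (x\<^sub>i - y\<^sub>j) z\<close>, up to the factor
  \<open>\<theta> (z + \<Sum> (x\<^sub>i - y\<^sub>i)) / \<theta> z\<close> (Frobenius).\<close>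
definition cauchy_weight :: "(nat \<Rightarrow> complex) \<Rightarrow> (nat \<Rightarrow> complex) \<Rightarrow> (nat \<Rightarrow> complex) \<Rightarrow> (nat \<Rightarrow> complex) \<Rightarrow> nat set \<Rightarrow> complex" where
  "cauchy_weight x y r c I = (\<Prod>i\<in>I. r i * c i / \<theta> (x i - y i) *
     (\<Prod>j\<in>{j \<in> I. j < i}. (\<theta> (x j - x i) / \<theta> (x j - y i)) * (\<theta> (y i - y j) / \<theta> (x i - y j))))"

text \<open>A new largest index is involved only in its own inner product. The pair factors there
  are redistributed to the older indices as exactly the row and column rescalings of
  \<open>Phi_schur\<close>.\<close>

lemma cauchy_weight_insert:
  assumes "finite I" "\<And>i. i \<in> I \<Longrightarrow> i < N"
  shows "cauchy_weight x y r c (insert N I) = r N * c N / \<theta> (x N - y N)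
    * cauchy_weight x y (\<lambda>i. r i * (\<theta> (x i - x N) / \<theta> (x i - y N))) (\<lambda>i. c i * (\<theta> (y N - y i) / \<theta> (x N - y i))) I"
proof -
  have N: "N \<notin> I" using assms(2) by blast
  have "{j \<in> insert N I. j < N} = I" using assms(2) by auto
  moreover have "{j \<in> insert N I. j < i} = {j \<in> I. j < i}" if "i \<in> I" for i
    using assms(2)[OF that] by auto
  ultimately show ?thesis
    unfolding cauchy_weight_def using assms(1) N
    by (simp add: prod.distrib[symmetric] mult_ac divide_inverse cong: prod.cong)
qed

text \<open>The factors \<open>r\<close> and \<open>c\<close> are carried along because elimination
  rescales rows and columns; the diagonal \<open>d\<close> is unaffected by it. Families are indexed
  from 1, matrix entries from 0.\<close>

definition cauchy_mat :: "nat \<Rightarrow> (nat \<Rightarrow> complex) \<Rightarrow> (nat \<Rightarrow> complex) \<Rightarrow> (nat \<Rightarrow> complex) \<Rightarrow> (nat \<Rightarrow> complex) \<Rightarrow> (nat \<Rightarrow> complex) \<Rightarrow> complex \<Rightarrow> complex mat" where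
  "cauchy_mat n d r c x y z = mat n n (\<lambda>(i, j). (if i = j then d (Suc i) else 0)
     + r (Suc i) * c (Suc j) * Phi \<tau> (x (Suc i) - y (Suc j)) z)"

lemma det_cauchy_mat_continuous:
  assumes "\<theta> z \<noteq> 0"
  shows "isCont (\<lambda>z. Determinant.det (cauchy_mat n d r c x y z)) z"
proof -
  have "(\<lambda>z. Determinant.det (cauchy_mat n d r c x y z)) = (\<lambda>z. \<Sum>p | p permutes {0..<n}. signof p *
    (\<Prod>i = 0..<n. (if i = p i then d (Suc i) else 0) + r (Suc i) * c (Suc (p i)) * (\<theta> (z + (x (Suc i) - y (Suc (p i)))) * (inverse (\<theta> (x (Suc i) - y (Suc (p i)))) * inverse (\<theta> z)))))"
    by (rule ext, subst det_def'[of _ n])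
       (auto simp: cauchy_mat_def Phi_def divide_inverse intro!: sum.cong prod.cong dest: permutes_nat_less)
  thus ?thesis using assms by (auto intro!: continuous_intros)
qed

text \<open>The expansion of the determinant of a diagonal matrix plus a Cauchy type matrix by
  principal minors, with the closed form of each minor inserted.\<close>

definition cauchy_sum :: "nat \<Rightarrow> (nat \<Rightarrow> complex) \<Rightarrow> (nat \<Rightarrow> complex) \<Rightarrow> (nat \<Rightarrow> complex) \<Rightarrow> (nat \<Rightarrow> complex) \<Rightarrow> (nat \<Rightarrow> complex) \<Rightarrow> complex \<Rightarrow> complex" where
  "cauchy_sum n d r c x y z = (\<Sum>I\<in>Pow {1..n}. (\<Prod>i\<in>{1..n} - I. d i) * cauchy_weight x y r c I
     * (\<theta> (z + (\<Sum>i\<in>I. x i - y i)) / \<theta> z))"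

text \<open>Subsets without the last index give the first summand, subsets containing it the second.
  The determinant obeys the same recursion by elimination of its last row and column.\<close>

lemma cauchy_sum_Suc:
  fixes x y r c :: "nat \<Rightarrow> complex"
  assumes "\<theta> z \<noteq> 0" "\<theta> (z + x (Suc n) - y (Suc n)) \<noteq> 0"
  defines "r' \<equiv> (\<lambda>i. r i * (\<theta> (x i - x (Suc n)) / \<theta> (x i - y (Suc n))))"
    and "c' \<equiv> (\<lambda>i. c i * (\<theta> (y (Suc n) - y i) / \<theta> (x (Suc n) - y i)))"
  shows "cauchy_sum (Suc n) d r c x y z = d (Suc n) * cauchy_sum n d r c x y z
    + r (Suc n) * c (Suc n) * Phi \<tau> (x (Suc n) - y (Suc n)) z * cauchy_sum n d r' c' x y (z + x (Suc n) - y (Suc n))"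
proof -
  define N where "N = Suc n"
  define t where "t = (\<lambda>I. (\<Prod>i\<in>{1..N} - I. d i) * cauchy_weight x y r c I * (\<theta> (z + (\<Sum>i\<in>I. x i - y i)) / \<theta> z))"
  have ins: "{1..N} = insert N {1..n}" by (auto simp: N_def)
  have inj: "inj_on (insert N) (Pow {1..n})"
    by (auto simp: inj_on_def N_def) (metis Suc_n_not_le_n atLeastAtMost_iff insert_eq_iff insert_ident subsetD)+
  have "cauchy_sum N d r c x y z = (\<Sum>I\<in>Pow {1..n} \<union> insert N ` Pow {1..n}. t I)"
    unfolding cauchy_sum_def t_def by (simp only: ins Pow_insert)
  also have "\<dots> = (\<Sum>I\<in>Pow {1..n}. t I) + (\<Sum>I\<in>insert N ` Pow {1..n}. t I)"
    by (rule sum.union_disjoint) (auto simp: N_def)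
  also have "(\<Sum>I\<in>insert N ` Pow {1..n}. t I) = (\<Sum>I\<in>Pow {1..n}. t (insert N I))"
    by (subst sum.reindex[OF inj]) simp
  also have "(\<Sum>I\<in>Pow {1..n}. t I) = d N * cauchy_sum n d r c x y z"
    unfolding cauchy_sum_def sum_distrib_left
  proof (rule sum.cong[OF refl])
    fix I assume "I \<in> Pow {1..n}"
    hence I: "N \<notin> I" by (auto simp: N_def)
    have "{1..N} - I = insert N ({1..n} - I)" "N \<notin> {1..n} - I" using I by (auto simp: N_def)
    thus "t I = d N * ((\<Prod>i\<in>{1..n} - I. d i) * cauchy_weight x y r c I * (\<theta> (z + (\<Sum>i\<in>I. x i - y i)) / \<theta> z))"
      unfolding t_def by simp
  qed
  also have "(\<Sum>I\<in>Pow {1..n}. t (insert N I)) =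
    r N * c N * Phi \<tau> (x N - y N) z * cauchy_sum n d r' c' x y (z + x N - y N)"
    unfolding cauchy_sum_def sum_distrib_left
  proof (rule sum.cong[OF refl])
    fix I assume I: "I \<in> Pow {1..n}"
    hence fin: "finite I" and NI: "N \<notin> I" and lt: "\<And>i. i \<in> I \<Longrightarrow> i < N"
      by (auto simp: N_def intro: finite_subset)
    have 1: "{1..N} - insert N I = {1..n} - I" using I by (auto simp: N_def)
    have 2: "z + (\<Sum>i\<in>insert N I. x i - y i) = z + x N - y N + (\<Sum>i\<in>I. x i - y i)"
      using fin NI by simp
    have 3: "cauchy_weight x y r c (insert N I) = r N * c N / \<theta> (x N - y N) * cauchy_weight x y r' c' I"
      unfolding r'_def c'_def N_def[symmetric] by (rule cauchy_weight_insert) (use fin lt in auto)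
    show "t (insert N I) = r N * c N * Phi \<tau> (x N - y N) z * ((\<Prod>i\<in>{1..n} - I. d i) * cauchy_weight x y r' c' I
        * (\<theta> (z + x N - y N + (\<Sum>i\<in>I. x i - y i)) / \<theta> (z + x N - y N)))"
      using assms(2) unfolding t_def 1 2 3 N_def[symmetric] Phi_def by (simp add: add_diff_eq)
  qed
  finally show ?thesis unfolding N_def .
qed

lemma cauchy_sum_continuous:
  assumes "\<theta> z \<noteq> 0"
  shows "isCont (\<lambda>z. cauchy_sum n d r c x y z) z"
  unfolding cauchy_sum_def divide_inverse using assms by (auto intro!: continuous_intros)

text \<open>Induction on the size, with the last diagonal entry as pivot: by Fay's identity the Schur
  complement is again a matrix of this shape, with shifted second argument of \<open>Phi\<close>. The pivot
  may vanish for special \<open>z\<close>; these are covered by continuity.\<close>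
lemma det_cauchy_mat:
  assumes "\<theta> z \<noteq> 0"
    and "\<And>i j. i \<in> {1..n} \<Longrightarrow> j \<in> {1..n} \<Longrightarrow> \<theta> (x i - y j) \<noteq> 0"
    and "\<And>i j. i \<in> {1..n} \<Longrightarrow> j \<in> {1..n} \<Longrightarrow> i \<noteq> j \<Longrightarrow> \<theta> (x i - x j) \<noteq> 0 \<and> \<theta> (y i - y j) \<noteq> 0"
    and "\<And>i. i \<in> {1..n} \<Longrightarrow> r i \<noteq> 0 \<and> c i \<noteq> 0"
  shows "Determinant.det (cauchy_mat n d r c x y z) = cauchy_sum n d r c x y z"
  using assms
proof (induction n arbitrary: r c z)
  case 0
  have "cauchy_mat 0 d r c x y z \<in> carrier_mat 0 0" by (auto simp: cauchy_mat_def)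
  thus ?case using 0 by (simp add: cauchy_sum_def cauchy_weight_def)
next
  case (Suc n)
  define N where "N = Suc n"
  define r' where "r' = (\<lambda>i. r i * (\<theta> (x i - x N) / \<theta> (x i - y N)))"
  define c' where "c' = (\<lambda>i. c i * (\<theta> (y N - y i) / \<theta> (x N - y i)))"
  have generic: "Determinant.det (cauchy_mat N d r c x y z) = cauchy_sum N d r c x y z"
    if z: "\<theta> z \<noteq> 0" and z': "\<theta> (z + x N - y N) \<noteq> 0" for z
  proof -
    \<comment> \<open>The diagonal term is left out at the last position only, which makes the pivot
      \<open>f n n\<close> free of \<open>d\<close>.\<close>
    define f where "f = (\<lambda>i j. (if i = j \<and> i \<noteq> n then d (Suc i) else 0) + r (Suc i) * c (Suc j) * Phi \<tau> (x (Suc i) - y (Suc j)) z)"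
    have fnn: "f n n = r N * c N * Phi \<tau> (x N - y N) z" by (simp add: f_def N_def)
    have "Phi \<tau> (x N - y N) z \<noteq> 0"
      unfolding Phi_def using z z' Suc.prems(2)[of N N] by (simp add: N_def add_diff_eq)
    hence fnn0: "f n n \<noteq> 0" unfolding fnn using Suc.prems(4)[of N] by (simp add: N_def)
    have "cauchy_mat N d r c x y z = mat (Suc n) (Suc n) (\<lambda>(i, j). f i j + (if i = n \<and> j = n then d N else 0))"
      unfolding cauchy_mat_def by (rule eq_matI) (auto simp: f_def N_def)
    hence "Determinant.det (cauchy_mat N d r c x y z) = d N * Determinant.det (mat n n (\<lambda>(i, j). f i j))
        + f n n * Determinant.det (mat n n (\<lambda>(i, j). f i j - f i n * f n j / f n n))"
      by (simp only: det_last_entry_add det_schur_complement[of f n, OF fnn0])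
    also have "mat n n (\<lambda>(i, j). f i j) = cauchy_mat n d r c x y z"
      unfolding cauchy_mat_def by (rule eq_matI) (auto simp: f_def)
    also have "mat n n (\<lambda>(i, j). f i j - f i n * f n j / f n n) = cauchy_mat n d r' c' x y (z + x N - y N)"
      unfolding cauchy_mat_def
    proof (rule eq_matI)
      fix i j
      assume "i < dim_row (mat n n (\<lambda>(i, j). (if i = j then d (Suc i) else 0) + r' (Suc i) * c' (Suc j) * Phi \<tau> (x (Suc i) - y (Suc j)) (z + x N - y N)))"
        "j < dim_col (mat n n (\<lambda>(i, j). (if i = j then d (Suc i) else 0) + r' (Suc i) * c' (Suc j) * Phi \<tau> (x (Suc i) - y (Suc j)) (z + x N - y N)))"
      hence ij: "i < n" "j < n" by auto
      have rc: "r N \<noteq> 0" "c N \<noteq> 0" using Suc.prems(4)[of N] by (auto simp: N_def)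
      have "f i n * f n j / f n n = r (Suc i) * c (Suc j) * (Phi \<tau> (x (Suc i) - y N) z * Phi \<tau> (x N - y (Suc j)) z / Phi \<tau> (x N - y N) z)"
        using ij rc unfolding fnn by (simp add: f_def N_def[symmetric] field_simps)
      hence "f i j - f i n * f n j / f n n = (if i = j then d (Suc i) else 0) + r (Suc i) * c (Suc j) *
          (Phi \<tau> (x (Suc i) - y (Suc j)) z - Phi \<tau> (x (Suc i) - y N) z * Phi \<tau> (x N - y (Suc j)) z / Phi \<tau> (x N - y N) z)"
        using ij by (simp add: f_def right_diff_distrib)
      also have "Phi \<tau> (x (Suc i) - y (Suc j)) z - Phi \<tau> (x (Suc i) - y N) z * Phi \<tau> (x N - y (Suc j)) z / Phi \<tau> (x N - y N) z
         = \<theta> (x (Suc i) - x N) / \<theta> (x (Suc i) - y N) * (\<theta> (y N - y (Suc j)) / \<theta> (x N - y (Suc j))) * Phi \<tau> (x (Suc i) - y (Suc j)) (z + x N - y N)"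
        by (rule Phi_schur[OF z z']; rule Suc.prems(2)) (use ij in \<open>auto simp: N_def\<close>)
      finally show "mat n n (\<lambda>(i, j). f i j - f i n * f n j / f n n) $$ (i, j) =
          mat n n (\<lambda>(i, j). (if i = j then d (Suc i) else 0) + r' (Suc i) * c' (Suc j) * Phi \<tau> (x (Suc i) - y (Suc j)) (z + x N - y N)) $$ (i, j)"
        using ij by (simp add: r'_def c'_def mult_ac)
    qed auto
    also have "Determinant.det (cauchy_mat n d r c x y z) = cauchy_sum n d r c x y z"
      by (rule Suc.IH[OF z]) (use Suc.prems in auto)
    also have "Determinant.det (cauchy_mat n d r' c' x y (z + x N - y N)) = cauchy_sum n d r' c' x y (z + x N - y N)"
    proof (rule Suc.IH[OF z'])
      fix i assume i: "i \<in> {1..n}"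
      show "r' i \<noteq> 0 \<and> c' i \<noteq> 0"
        using Suc.prems(2)[of i N] Suc.prems(2)[of N i] Suc.prems(3)[of i N] Suc.prems(3)[of N i] Suc.prems(4)[of i] i
        by (auto simp: r'_def c'_def N_def)
    qed (use Suc.prems in auto)
    finally show ?thesis
      unfolding fnn using cauchy_sum_Suc[of z x n y d r c] z z' by (simp add: N_def[symmetric] r'_def c'_def)
  qed
  show ?case
  proof (rule continuous_eq_of_eventually_eq[where u = "\<lambda>z. Determinant.det (cauchy_mat (Suc n) d r c x y z)"
        and v = "\<lambda>z. cauchy_sum (Suc n) d r c x y z"])
    show "\<forall>\<^sub>F z in at z. Determinant.det (cauchy_mat (Suc n) d r c x y z) = cauchy_sum (Suc n) d r c x y z"
      using theta1_eventually_nonzero[of 0 z] theta1_eventually_nonzero[of "y N - x N" z]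
      by eventually_elim (use generic in \<open>simp add: N_def diff_diff_eq2\<close>)
  qed (rule det_cauchy_mat_continuous cauchy_sum_continuous; fact Suc.prems(1))+
qed

end

subsection \<open>Expansion of the Lame determinant\<close>

locale lame = theta +
  fixes \<eta> :: complex and l :: nat
  assumes generic: "\<And>m :: int. m \<noteq> 0 \<Longrightarrow> of_int m * \<eta> \<notin> period_lattice \<tau>"
begin

abbreviation br :: "int \<Rightarrow> complex" where "br \<equiv> elliptic_num \<tau> \<eta>"

lemma theta1_mult_eta_nonzero: "m \<noteq> 0 \<Longrightarrow> \<theta> (of_int m * \<eta>) \<noteq> 0"
  using generic by (simp add: theta1_eq_0_iff)

lemma theta1_eta_nonzero: "\<theta> \<eta> \<noteq> 0"
  using theta1_mult_eta_nonzero[of 1] by simp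

lemma br_nonzero: "m \<noteq> 0 \<Longrightarrow> br m \<noteq> 0"
  using theta1_mult_eta_nonzero theta1_eta_nonzero by (simp add: elliptic_num_def)

lemma br_minus: "br (- m) = - br m"
  using theta1_minus[of "of_int m * \<eta>"] by (simp add: elliptic_num_def)

lemma theta1_eq_br: "\<theta> (of_int m * \<eta>) = br m * \<theta> \<eta>"
  using theta1_eta_nonzero by (simp add: elliptic_num_def)

definition lame_coeff :: "nat \<Rightarrow> complex" where
  "lame_coeff m = (-1) ^ (l + 1) * \<theta> (2 * of_nat m * \<eta>)
     * (\<Prod>j\<in>{1..l} - {m}. br (int m + int j) / br (int m - int j))"

lemma lame_coeff_nonzero:
  assumes "m \<in> {1..l}"
  shows "lame_coeff m \<noteq> 0"
proof -
  have "\<theta> (2 * of_nat m * \<eta>) \<noteq> 0"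
    using theta1_mult_eta_nonzero[of "2 * int m"] assms by simp
  moreover have "br (int m + int j) / br (int m - int j) \<noteq> 0" if "j \<in> {1..l} - {m}" for j
    using that assms by (simp add: br_nonzero)
  ultimately show ?thesis unfolding lame_coeff_def by simp
qed

lemma lame_mat_eq_cauchy_mat:
  "lame_mat \<tau> \<eta> l K \<zeta> =
    cauchy_mat l (\<lambda>i. K ^ (2 * i)) lame_coeff (\<lambda>_. 1) (\<lambda>i. - (of_nat i * \<eta>)) (\<lambda>i. of_nat i * \<eta>) \<zeta>"
  unfolding lame_mat_def cauchy_mat_def
  by (rule eq_matI) (auto simp: lame_G_def lame_coeff_def algebra_simps)

definition subset_weight :: "nat set \<Rightarrow> complex" where
  "subset_weight J = (\<Prod>k\<in>J. \<Prod>k'\<in>{1..l} - J. br (int k + int k') / br \<bar>int k - int k'\<bar>)"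

text \<open>A pair inside \<open>I\<close> receives both orientations of \<open>a\<close> from the
  coefficients and \<psi> from the Cauchy product; together they give -1. Only brackets joining
  \<open>I\<close> to its complement survive, and the remaining signs combine to the parity of the
  sum of \<open>I\<close>.\<close>

lemma cauchy_weight_lame:
  assumes I: "I \<subseteq> {1..l}"
  shows "cauchy_weight (\<lambda>i. - (of_nat i * \<eta>)) (\<lambda>i. of_nat i * \<eta>) lame_coeff (\<lambda>_. 1) I
    = (-1) ^ (\<Sum>I) * subset_weight I"
proof -
  have fin: "finite I" using I finite_subset by blast
  define a where "a = (\<lambda>m j :: nat. br (int m + int j) / br (int m - int j))"
  define \<psi> where "\<psi> = (\<lambda>j i :: nat. (br (int i - int j) / br (int i + int j))\<^sup>2)"
  have a\<psi>: "a m j * a j m * \<psi> j m = -1" if "m \<in> I" "j \<in> I" "j < m" for m j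
  proof -
    have "br (int m + int j) \<noteq> 0" "br (int m - int j) \<noteq> 0" using that by (auto intro!: br_nonzero)
    moreover have "br (int j - int m) = - br (int m - int j)" using br_minus[of "int m - int j"] by simp
    ultimately show ?thesis by (simp add: a_def \<psi>_def add.commute field_simps power2_eq_square)
  qed
  \<comment> \<open>Oddness of \<open>\<theta>\<close> turns the sign \<open>(-1) ^ (l + 1)\<close>
    of the coefficient into \<open>(-1) ^ l\<close>.\<close>
  have fac: "lame_coeff i * 1 / \<theta> (- (of_nat i * \<eta>) - of_nat i * \<eta>) = (-1) ^ l * (\<Prod>j\<in>{1..l} - {i}. a i j)"
    if "i \<in> I" for i
  proof -
    have "\<theta> (2 * of_nat i * \<eta>) \<noteq> 0"
      using theta1_mult_eta_nonzero[of "2 * int i"] that I by auto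
    moreover have "\<theta> (- (of_nat i * \<eta>) - of_nat i * \<eta>) = - \<theta> (2 * of_nat i * \<eta>)"
      using theta1_minus[of "2 * of_nat i * \<eta>"] by (simp add: algebra_simps)
    ultimately show ?thesis by (simp add: lame_coeff_def a_def)
  qed
  have psi: "\<theta> (- (of_nat j * \<eta>) - - (of_nat i * \<eta>)) / \<theta> (- (of_nat j * \<eta>) - of_nat i * \<eta>) *
      (\<theta> (of_nat i * \<eta> - of_nat j * \<eta>) / \<theta> (- (of_nat i * \<eta>) - of_nat j * \<eta>)) = \<psi> j i" for i j
  proof -
    have e1: "- (of_nat j * \<eta>) - - (of_nat i * \<eta>) = of_int (int i - int j) * \<eta>"
      "of_nat i * \<eta> - of_nat j * \<eta> = of_int (int i - int j) * \<eta>"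
      "- (of_nat j * \<eta>) - of_nat i * \<eta> = of_int (- (int i + int j)) * \<eta>"
      "- (of_nat i * \<eta>) - of_nat j * \<eta> = of_int (- (int i + int j)) * \<eta>"
      by (simp_all add: algebra_simps)
    show ?thesis unfolding e1 theta1_eq_br br_minus \<psi>_def
      using theta1_eta_nonzero by (simp add: power2_eq_square)
  qed
  have split: "(\<Prod>j\<in>{1..l} - {i}. a i j) = (\<Prod>j\<in>{1..l} - I. a i j) * ((\<Prod>j\<in>{j \<in> I. j < i}. a i j) * (\<Prod>j\<in>{j \<in> I. i < j}. a i j))"
    if "i \<in> I" for i
  proof -
    have "{1..l} - {i} = ({1..l} - I) \<union> ({j \<in> I. j < i} \<union> {j \<in> I. i < j})"
      using that I by auto
    hence "(\<Prod>j\<in>{1..l} - {i}. a i j) = (\<Prod>j\<in>({1..l} - I) \<union> ({j \<in> I. j < i} \<union> {j \<in> I. i < j}). a i j)"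
      by (rule arg_cong)
    also have "\<dots> = (\<Prod>j\<in>{1..l} - I. a i j) * (\<Prod>j\<in>{j \<in> I. j < i} \<union> {j \<in> I. i < j}. a i j)"
      by (rule prod.union_disjoint) (use fin in auto)
    also have "(\<Prod>j\<in>{j \<in> I. j < i} \<union> {j \<in> I. i < j}. a i j) = (\<Prod>j\<in>{j \<in> I. j < i}. a i j) * (\<Prod>j\<in>{j \<in> I. i < j}. a i j)"
      by (rule prod.union_disjoint) (use fin in auto)
    finally show ?thesis .
  qed
  \<comment> \<open>Passing to the absolute value in the denominator costs one sign for every
    \<open>j\<close> above \<open>i\<close>.\<close>
  have sgn: "(\<Prod>j\<in>{1..l} - I. a i j) = (\<Prod>j\<in>{1..l} - I. br (int i + int j) / br \<bar>int i - int j\<bar>) * (\<Prod>j\<in>{j \<in> {1..l} - I. i < j}. - 1)"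
    if "i \<in> I" for i
  proof -
    have "(\<Prod>j\<in>{1..l} - I. a i j) = (\<Prod>j\<in>{1..l} - I. br (int i + int j) / br \<bar>int i - int j\<bar> * (if i < j then - 1 else 1))"
    proof (rule prod.cong[OF refl])
      fix j
      show "a i j = br (int i + int j) / br \<bar>int i - int j\<bar> * (if i < j then - 1 else 1)"
      proof (cases "i < j")
        case True
        moreover from True have "\<bar>int i - int j\<bar> = int j - int i" by simp
        moreover have "br (int i - int j) = - br (int j - int i)" using br_minus[of "int j - int i"] by simp
        ultimately show ?thesis by (simp only: a_def) simp
      qed (simp add: a_def)
    qed
    also have "\<dots> = (\<Prod>j\<in>{1..l} - I. br (int i + int j) / br \<bar>int i - int j\<bar>) * (\<Prod>j\<in>{1..l} - I. (if i < j then - 1 else 1))"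
      by (rule prod.distrib)
    also have "(\<Prod>j\<in>{1..l} - I. (if i < j then - 1 else 1)) = (\<Prod>j\<in>{j \<in> {1..l} - I. i < j}. - 1 :: complex)"
      by (rule prod.inter_filter[symmetric]) simp
    finally show ?thesis .
  qed
  have "cauchy_weight (\<lambda>i. - (of_nat i * \<eta>)) (\<lambda>i. of_nat i * \<eta>) lame_coeff (\<lambda>_. 1) I
    = (\<Prod>i\<in>I. (-1) ^ l * (\<Prod>j\<in>{1..l} - {i}. a i j) * (\<Prod>j\<in>{j \<in> I. j < i}. \<psi> j i))"
    unfolding cauchy_weight_def psi by (intro prod.cong) (simp_all only: fac)
  also have "\<dots> = (\<Prod>i\<in>I. ((-1) ^ l * (\<Prod>j\<in>{1..l} - I. a i j)) * ((\<Prod>j\<in>{j \<in> I. j < i}. a i j * \<psi> j i) * (\<Prod>j\<in>{j \<in> I. i < j}. a i j)))"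
    by (rule prod.cong[OF refl], subst split, assumption) (simp only: prod.distrib mult_ac)
  also have "\<dots> = (\<Prod>i\<in>I. (-1) ^ l * (\<Prod>j\<in>{1..l} - I. a i j)) *
      ((\<Prod>i\<in>I. \<Prod>j\<in>{j \<in> I. j < i}. a i j * \<psi> j i) * (\<Prod>i\<in>I. \<Prod>j\<in>{j \<in> I. i < j}. a i j))"
    by (simp only: prod.distrib)
  \<comment> \<open>Interchanging the roles of the two indices brings both orientations of a pair
    under the same double product.\<close>
  also have "(\<Prod>i\<in>I. \<Prod>j\<in>{j \<in> I. i < j}. a i j) = (\<Prod>i\<in>I. \<Prod>j\<in>{j \<in> I. j < i}. a j i)"
    by (rule prod.swap_restrict[OF fin fin])
  also have "(\<Prod>i\<in>I. \<Prod>j\<in>{j \<in> I. j < i}. a i j * \<psi> j i) * \<dots> = (\<Prod>i\<in>I. \<Prod>j\<in>{j \<in> I. j < i}. - 1)"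
    unfolding prod.distrib[symmetric] by (intro prod.cong) (use a\<psi> in \<open>auto simp: mult_ac\<close>)
  \<comment> \<open>The signs are charged to the smaller index of each pair, to be counted together
    with those from \<open>sgn\<close>.\<close>
  also have "\<dots> = (\<Prod>i\<in>I. \<Prod>j\<in>{j \<in> I. i < j}. - 1)"
    by (rule prod.swap_restrict[OF fin fin, symmetric])
  also have "(\<Prod>i\<in>I. (-1) ^ l * (\<Prod>j\<in>{1..l} - I. a i j)) * \<dots> =
      (\<Prod>i\<in>I. (-1) ^ i * (\<Prod>j\<in>{1..l} - I. br (int i + int j) / br \<bar>int i - int j\<bar>))"
    unfolding prod.distrib[symmetric]
  proof (rule prod.cong[OF refl])
    fix i assume i: "i \<in> I"
    have "{i<..l} = {j \<in> {1..l} - I. i < j} \<union> {j \<in> I. i < j}" using I by auto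
    hence "(\<Prod>j\<in>{i<..l}. - 1 :: complex) = (\<Prod>j\<in>{j \<in> {1..l} - I. i < j} \<union> {j \<in> I. i < j}. - 1)"
      by (rule arg_cong)
    also have "\<dots> = (\<Prod>j\<in>{j \<in> {1..l} - I. i < j}. - 1) * (\<Prod>j\<in>{j \<in> I. i < j}. - 1)"
      by (rule prod.union_disjoint) (use fin in auto)
    finally have e: "(\<Prod>j\<in>{j \<in> {1..l} - I. i < j}. - 1 :: complex) * (\<Prod>j\<in>{j \<in> I. i < j}. - 1) = (- 1) ^ (l - i)" by (metis card_greaterThanAtMost prod_constant)
    \<comment> \<open>Inside or outside \<open>I\<close>, there are \<open>l - i\<close> indices
      above \<open>i\<close>, each contributing a sign.\<close>
    have "(- 1 :: complex) ^ l * (- 1) ^ (l - i) = (- 1) ^ (i + 2 * (l - i))"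
      unfolding power_add[symmetric] by (rule arg_cong[of _ _ "\<lambda>k. (- 1 :: complex) ^ k"]) (use i I in auto)
    also have "\<dots> = (- 1) ^ i" by (simp add: power_add)
    finally have e2: "(- 1 :: complex) ^ l * (- 1) ^ (l - i) = (- 1) ^ i" .
    have "(- 1) ^ l * (\<Prod>j\<in>{1..l} - I. a i j) * (\<Prod>j\<in>{j \<in> I. i < j}. - 1) =
        (- 1) ^ l * ((\<Prod>j\<in>{j \<in> {1..l} - I. i < j}. - 1) * (\<Prod>j\<in>{j \<in> I. i < j}. - 1))
          * (\<Prod>j\<in>{1..l} - I. br (int i + int j) / br \<bar>int i - int j\<bar>)"
      unfolding sgn[OF i] by (simp only: mult_ac)
    thus "(- 1) ^ l * (\<Prod>j\<in>{1..l} - I. a i j) * (\<Prod>j\<in>{j \<in> I. i < j}. - 1) =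
        (- 1) ^ i * (\<Prod>j\<in>{1..l} - I. br (int i + int j) / br \<bar>int i - int j\<bar>)"
      unfolding e e2 .
  qed
  also have "\<dots> = (-1) ^ (\<Sum>I) * subset_weight I"
    unfolding subset_weight_def prod.distrib by (simp add: power_sum)
  finally show ?thesis .
qed

lemma sum_atLeast1_atMost: "\<Sum>{1..l} = l * (l + 1) div 2"
  using gauss_sum_from_Suc_0[of l, where ?'a = nat] by simp

text \<open>The factor \<open>\<theta> \<zeta>\<close> clears the denominators of
  \<open>cauchy_sum\<close>. The shift of \<zeta> and, through the complement, the power of
  \<open>K\<close> depend on a subset only through its sum, so subsets of equal sum can be
  collected.\<close>

lemma theta1_zeta_det_lame_mat:
  assumes "\<theta> \<zeta> \<noteq> 0" and N: "N = l * (l + 1) div 2"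
  shows "\<theta> \<zeta> * Determinant.det (lame_mat \<tau> \<eta> l K \<zeta>) =
    (\<Sum>j=0..N. (-1) ^ j * lame_C \<tau> \<eta> l j * \<theta> (\<zeta> - 2 * of_nat j * \<eta>) * K ^ (2 * (N - j)))"
proof -
  have det: "Determinant.det (lame_mat \<tau> \<eta> l K \<zeta>) =
      cauchy_sum l (\<lambda>i. K ^ (2 * i)) lame_coeff (\<lambda>_. 1) (\<lambda>i. - (of_nat i * \<eta>)) (\<lambda>i. of_nat i * \<eta>) \<zeta>"
    unfolding lame_mat_eq_cauchy_mat
  proof (rule det_cauchy_mat[OF assms(1)])
    fix i j assume ij: "i \<in> {1..l}" "j \<in> {1..l}"
    show "\<theta> (- (of_nat i * \<eta>) - of_nat j * \<eta>) \<noteq> 0"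
      using theta1_mult_eta_nonzero[of "- (int i + int j)"] ij by (simp add: algebra_simps)
    show "\<theta> (- (of_nat i * \<eta>) - - (of_nat j * \<eta>)) \<noteq> 0 \<and> \<theta> (of_nat i * \<eta> - of_nat j * \<eta>) \<noteq> 0" if "i \<noteq> j"
      using theta1_mult_eta_nonzero[of "int i - int j"] theta1_mult_eta_nonzero[of "int j - int i"] that
      by (simp add: algebra_simps)
  qed (use lame_coeff_nonzero in auto)
  have "\<theta> \<zeta> * Determinant.det (lame_mat \<tau> \<eta> l K \<zeta>) = (\<Sum>I\<in>Pow {1..l}. (-1) ^ (\<Sum>I) * subset_weight I * \<theta> (\<zeta> - 2 * of_nat (\<Sum>I) * \<eta>) * K ^ (2 * (N - \<Sum>I)))"
    unfolding det cauchy_sum_def sum_distrib_left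
  proof (rule sum.cong[OF refl])
    fix I assume "I \<in> Pow {1..l}"
    hence I: "I \<subseteq> {1..l}" and fin: "finite I" using finite_subset by auto
    have "\<Sum>({1..l} - I) + \<Sum>I = N"
      using sum.subset_diff[OF I, of "\<lambda>x. x"] sum_atLeast1_atMost N by simp
    hence "\<Sum>({1..l} - I) = N - \<Sum>I" by simp
    hence 1: "(\<Prod>i\<in>{1..l} - I. K ^ (2 * i)) = K ^ (2 * (N - \<Sum>I))"
      by (simp add: power_sum[symmetric] sum_distrib_left[symmetric])
    have 2: "\<zeta> + (\<Sum>i\<in>I. - (of_nat i * \<eta>) - of_nat i * \<eta>) = \<zeta> - 2 * of_nat (\<Sum>I) * \<eta>"
    proof -
      have "(\<Sum>i\<in>I. - (of_nat i * \<eta>) - of_nat i * \<eta>) = (\<Sum>i\<in>I. of_nat i * (- 2 * \<eta>))"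
        by (intro sum.cong) (auto simp: algebra_simps)
      also have "\<dots> = of_nat (\<Sum>I) * (- 2 * \<eta>)" by (simp add: sum_distrib_right sum_negf)
      finally show ?thesis by (simp add: algebra_simps)
    qed
    show "\<theta> \<zeta> * ((\<Prod>i\<in>{1..l} - I. K ^ (2 * i)) * cauchy_weight (\<lambda>i. - (of_nat i * \<eta>)) (\<lambda>i. of_nat i * \<eta>) lame_coeff (\<lambda>_. 1) I *
        (\<theta> (\<zeta> + (\<Sum>i\<in>I. - (of_nat i * \<eta>) - of_nat i * \<eta>)) / \<theta> \<zeta>)) =
      (-1) ^ (\<Sum>I) * subset_weight I * \<theta> (\<zeta> - 2 * of_nat (\<Sum>I) * \<eta>) * K ^ (2 * (N - \<Sum>I))"
      unfolding 1 2 cauchy_weight_lame[OF I] using assms(1) by simp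
  qed
  also have "\<dots> = (\<Sum>j\<in>{0..N}. \<Sum>I\<in>{I \<in> Pow {1..l}. \<Sum>I = j}. (-1) ^ (\<Sum>I) * subset_weight I * \<theta> (\<zeta> - 2 * of_nat (\<Sum>I) * \<eta>) * K ^ (2 * (N - \<Sum>I)))"
  proof (rule sum.group[symmetric, where S = "Pow {1..l}" and T = "{0..N}" and g = "\<lambda>I. \<Sum>I"
        and h = "\<lambda>I. (-1) ^ (\<Sum>I) * subset_weight I * \<theta> (\<zeta> - 2 * of_nat (\<Sum>I) * \<eta>) * K ^ (2 * (N - \<Sum>I))"])
    have "\<Sum>I \<le> N" if "I \<subseteq> {1..l}" for I
    proof -
      have "\<Sum>I \<le> \<Sum>{1..l}" by (rule sum_mono2) (use that in auto)
      thus ?thesis unfolding sum_atLeast1_atMost N .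
    qed
    thus "(\<lambda>I. \<Sum>I) ` Pow {1..l} \<subseteq> {0..N}" by auto
  qed auto
  also have "\<dots> = (\<Sum>j=0..N. (-1) ^ j * lame_C \<tau> \<eta> l j * \<theta> (\<zeta> - 2 * of_nat j * \<eta>) * K ^ (2 * (N - j)))"
  proof (rule sum.cong[OF refl])
    fix j
    have "lame_C \<tau> \<eta> l j = (\<Sum>I\<in>{I \<in> Pow {1..l}. \<Sum>I = j}. subset_weight I)"
      unfolding lame_C_def subset_weight_def by (rule sum.cong) auto
    thus "(\<Sum>I\<in>{I \<in> Pow {1..l}. \<Sum>I = j}. (-1) ^ (\<Sum>I) * subset_weight I * \<theta> (\<zeta> - 2 * of_nat (\<Sum>I) * \<eta>) * K ^ (2 * (N - \<Sum>I)))
      = (-1) ^ j * lame_C \<tau> \<eta> l j * \<theta> (\<zeta> - 2 * of_nat j * \<eta>) * K ^ (2 * (N - j))"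
      by (simp add: sum_distrib_left sum_distrib_right)
  qed
  finally show ?thesis .
qed

lemma lame_C_0: "lame_C \<tau> \<eta> l 0 = 1"
proof -
  have "J = {}" if "J \<subseteq> {1..l}" "\<Sum>J = 0" for J
    using that finite_subset[OF that(1)] by (fastforce simp: sum_eq_0_iff)
  hence "{J. J \<subseteq> {1..l} \<and> \<Sum>J = 0} = {{}}" by auto
  thus ?thesis by (simp add: lame_C_def)
qed

text \<open>Complementation exchanges the two products, and each factor is symmetric in
  \<open>k\<close> and \<open>k'\<close> thanks to the absolute value.\<close>

lemma lame_C_sym:
  assumes N: "N = l * (l + 1) div 2" and "j \<le> N"
  shows "lame_C \<tau> \<eta> l j = lame_C \<tau> \<eta> l (N - j)"
  unfolding lame_C_def
proof (rule sum.reindex_bij_witness[where i = "\<lambda>J. {1..l} - J" and j = "\<lambda>J. {1..l} - J"])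
  have sum_compl: "\<Sum>({1..l} - J) + \<Sum>J = N" if "J \<subseteq> {1..l}" for J
    using sum.subset_diff[OF that, of "\<lambda>x. x"] sum_atLeast1_atMost N by simp
  fix J
  show "{1..l} - J \<in> {J. J \<subseteq> {1..l} \<and> \<Sum>J = N - j}" if "J \<in> {J. J \<subseteq> {1..l} \<and> \<Sum>J = j}"
    using sum_compl[of J] that by auto
  show "{1..l} - J \<in> {J. J \<subseteq> {1..l} \<and> \<Sum>J = j}" if "J \<in> {J. J \<subseteq> {1..l} \<and> \<Sum>J = N - j}"
    using sum_compl[of J] that assms(2) by auto
  assume "J \<in> {J. J \<subseteq> {1..l} \<and> \<Sum>J = j}"
  hence "{1..l} - ({1..l} - J) = J" by auto
  thus "(\<Prod>k\<in>{1..l} - J. \<Prod>k'\<in>{1..l} - ({1..l} - J). br (int k + int k') / br \<bar>int k - int k'\<bar>) =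
      (\<Prod>k\<in>J. \<Prod>k'\<in>{1..l} - J. br (int k + int k') / br \<bar>int k - int k'\<bar>)"
    by (simp only:) (subst prod.swap, simp add: add.commute abs_minus_commute)
qed auto

end

subsection \<open>Existence of eigenfunctions\<close>

text \<open>Let \<open>E\<close> be a root of \<open>p\<close>. Either \<open>L v - E v\<close> is
  zero and \<open>v\<close> is an eigenvector, or it is a nonzero vector annihilated by the cofactor
  of \<open>X - E\<close>, of smaller degree. Neither a basis nor a matrix of \<open>L\<close> is
  required.\<close>

lemma polynomial_annihilator_eigenvector:
  fixes V :: "(complex \<Rightarrow> complex) set" and L :: "(complex \<Rightarrow> complex) \<Rightarrow> complex \<Rightarrow> complex"
  assumes lin: "\<And>f g a b. f \<in> V \<Longrightarrow> g \<in> V \<Longrightarrow> (\<lambda>x. a * f x + b * g x) \<in> V"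
    and Lcl: "\<And>f. f \<in> V \<Longrightarrow> L f \<in> V"
    and Llin: "\<And>f g a b. f \<in> V \<Longrightarrow> g \<in> V \<Longrightarrow> L (\<lambda>x. a * f x + b * g x) = (\<lambda>x. a * L f x + b * L g x)"
    and "p \<noteq> 0" "degree p \<le> M" "v \<in> V" "v \<noteq> (\<lambda>x. 0)"
    and "\<And>x. (\<Sum>k\<le>M. coeff p k * (L ^^ k) v x) = 0"
  shows "\<exists>w E. w \<in> V \<and> w \<noteq> (\<lambda>x. 0) \<and> L w = (\<lambda>x. E * w x)"
  using assms(4-)
proof (induction M arbitrary: p v)
  case 0
  hence "coeff p 0 \<noteq> 0" using leading_coeff_0_iff[of p] by simp
  hence "v x = 0" for x using 0(5)[of x] by simp
  thus ?case using 0 by blast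
next
  case (Suc M)
  show ?case
  proof (cases "degree p = 0")
    case True
    hence "coeff p 0 \<noteq> 0" using Suc.prems(1) leading_coeff_0_iff[of p] by simp
    moreover have "coeff p 0 * v x = 0" for x
    proof -
      have "(\<Sum>k\<le>Suc M. coeff p k * (L ^^ k) v x) = (\<Sum>k\<in>{0}. coeff p k * (L ^^ k) v x)"
        by (rule sum.mono_neutral_right) (use True in \<open>auto simp: coeff_eq_0\<close>)
      thus ?thesis using Suc.prems(5)[of x] by simp
    qed
    ultimately show ?thesis using Suc.prems(4) by auto
  next
    case False
    then obtain E where "poly p E = 0"
      using alg_closed_imp_poly_has_root[of p] by auto
    then obtain q where q: "p = [:- E, 1:] * q" using poly_eq_0_iff_dvd by blast
    have q0: "q \<noteq> 0" using q Suc.prems(1) by auto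
    have deg: "degree q \<le> M" using Suc.prems(2) q0 unfolding q by (subst (asm) degree_mult_eq) auto
    define w where "w = (\<lambda>x. 1 * L v x + (- E) * v x)"
    have wV: "w \<in> V" unfolding w_def by (intro lin Lcl Suc.prems(3))
    have LkV: "(L ^^ k) v \<in> V" for k by (induction k) (auto intro: Lcl Suc.prems(3))
    have Lw: "(L ^^ k) w = (\<lambda>x. 1 * (L ^^ Suc k) v x + (- E) * (L ^^ k) v x)" for k
    proof (induction k)
      case (Suc k)
      have "(L ^^ Suc k) w = L (\<lambda>x. 1 * (L ^^ Suc k) v x + (- E) * (L ^^ k) v x)" by (simp add: Suc)
      also have "\<dots> = (\<lambda>x. 1 * L ((L ^^ Suc k) v) x + (- E) * L ((L ^^ k) v) x)"
        by (rule Llin[OF LkV LkV])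
      finally show ?case by simp
    qed (simp add: w_def)
    show ?thesis
    proof (cases "w = (\<lambda>x. 0)")
      case True
      hence "L v x = E * v x" for x unfolding w_def by (metis add.commute add_eq_0_iff minus_mult_left mult_1 neg_equal_iff_equal)
      thus ?thesis using Suc.prems(3,4) by blast
    next
      case False
      have "(\<Sum>k\<le>M. coeff q k * (L ^^ k) w x) = 0" for x
      proof -
        define u where "u = (\<lambda>k. (L ^^ k) v x)"
        \<comment> \<open>Coefficients of \<open>(X - E) q\<close>; by them the sum for
          \<open>q\<close> at \<open>w\<close> becomes the sum for \<open>p\<close> at
          \<open>v\<close>.\<close>
        have c0: "coeff p 0 = - E * coeff q 0" and cS: "coeff p (Suc k) = coeff q k - E * coeff q (Suc k)" for k
          by (simp_all add: q)
        have "(\<Sum>k\<le>M. coeff q k * (L ^^ k) w x) = (\<Sum>k\<le>M. coeff q k * u (Suc k)) - E * (\<Sum>k\<le>M. coeff q k * u k)"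
          unfolding Lw u_def by (simp add: algebra_simps sum_distrib_left sum_subtractf)
        also have "(\<Sum>k\<le>M. coeff q k * u k) = (\<Sum>k\<le>Suc M. coeff q k * u k)"
          using deg by (simp add: coeff_eq_0)
        also have "\<dots> = coeff q 0 * u 0 + (\<Sum>k\<le>M. coeff q (Suc k) * u (Suc k))"
          by (rule sum.atMost_Suc_shift)
        also have "(\<Sum>k\<le>M. coeff q k * u (Suc k)) - E * \<dots> = coeff p 0 * u 0 + (\<Sum>k\<le>M. coeff p (Suc k) * u (Suc k))"
          unfolding c0 cS by (simp add: algebra_simps sum_distrib_left sum_subtractf)
        also have "\<dots> = (\<Sum>k\<le>Suc M. coeff p k * u k)"
          by (rule sum.atMost_Suc_shift[symmetric])
        also have "\<dots> = 0" using Suc.prems(5) by (simp add: u_def)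
        finally show ?thesis .
      qed
      from Suc.IH[OF q0 deg wV False this] show ?thesis .
    qed
  qed
qed

lemma linear_dependence:
  fixes U :: "nat \<Rightarrow> nat \<Rightarrow> complex"
  obtains c where "\<exists>k\<le>n. c k \<noteq> 0" "\<And>i. i < n \<Longrightarrow> (\<Sum>k\<le>n. c k * U i k) = 0"
proof -
  \<comment> \<open>The \<open>n\<close> equations in \<open>n + 1\<close> unknowns are padded by a
    zero row, which makes the matrix square and singular.\<close>
  define A where "A = mat (Suc n) (Suc n) (\<lambda>(i, k). if i < n then U i k else 0)"
  have A: "A \<in> carrier_mat (Suc n) (Suc n)" by (simp add: A_def)
  have "Determinant.det A = 0"
    using laplace_expansion_row[OF A, of n] by (simp add: A_def)
  then obtain v where v: "v \<in> carrier_vec (Suc n)" "v \<noteq> 0\<^sub>v (Suc n)" "A *\<^sub>v v = 0\<^sub>v (Suc n)"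
    using det_0_iff_vec_prod_zero_field[OF A] by blast
  show ?thesis
  proof (rule that[of "\<lambda>k. v $ k"])
    show "\<exists>k\<le>n. v $ k \<noteq> 0"
    proof (rule ccontr)
      assume "\<not> ?thesis"
      hence "v = 0\<^sub>v (Suc n)" using v(1) by (intro eq_vecI) auto
      thus False using v(2) by simp
    qed
    fix i assume i: "i < n"
    have "(A *\<^sub>v v) $ i = 0" using v(3) i by simp
    moreover have "(A *\<^sub>v v) $ i = (\<Sum>k<Suc n. U i k * v $ k)"
      using v(1) i by (auto simp: A_def scalar_prod_def atLeast0LessThan)
    ultimately show "(\<Sum>k\<le>n. v $ k * U i k) = 0"
      by (simp add: mult.commute lessThan_Suc_atMost)
  qed
qed

text \<open>Injective evaluation at \<open>n\<close> points bounds the dimension by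
  \<open>n\<close>: some combination of the \<open>n + 1\<close> iterates of \<open>v\<close>
  vanishes at the points, hence everywhere, and is an annihilating polynomial for
  \<open>v\<close>.\<close>

lemma eigenfunction_exists:
  fixes V :: "(complex \<Rightarrow> complex) set" and L :: "(complex \<Rightarrow> complex) \<Rightarrow> complex \<Rightarrow> complex"
    and n :: nat and pt :: "nat \<Rightarrow> complex"
  assumes lin: "\<And>f g a b. f \<in> V \<Longrightarrow> g \<in> V \<Longrightarrow> (\<lambda>x. a * f x + b * g x) \<in> V"
    and Lcl: "\<And>f. f \<in> V \<Longrightarrow> L f \<in> V"
    and Llin: "\<And>f g a b. f \<in> V \<Longrightarrow> g \<in> V \<Longrightarrow> L (\<lambda>x. a * f x + b * g x) = (\<lambda>x. a * L f x + b * L g x)"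
    and inj: "\<And>f. f \<in> V \<Longrightarrow> (\<And>i. i < n \<Longrightarrow> f (pt i) = 0) \<Longrightarrow> f = (\<lambda>x. 0)"
    and v: "v \<in> V" "v \<noteq> (\<lambda>x. 0)"
  shows "\<exists>w E. w \<in> V \<and> w \<noteq> (\<lambda>x. 0) \<and> L w = (\<lambda>x. E * w x)"
proof -
  obtain c where c: "\<exists>k\<le>n. c k \<noteq> 0" "\<And>i. i < n \<Longrightarrow> (\<Sum>k\<le>n. c k * (L ^^ k) v (pt i)) = 0"
    using linear_dependence[of n "\<lambda>i k. (L ^^ k) v (pt i)"] by metis
  have LkV: "(L ^^ k) v \<in> V" for k by (induction k) (auto intro: Lcl v)
  have "(\<lambda>x. \<Sum>k\<le>m. c k * (L ^^ k) v x) \<in> V" for m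
  proof (induction m)
    case 0
    show ?case using lin[OF v(1) v(1), of "c 0" 0] by simp
  next
    case (Suc m)
    show ?case using lin[OF Suc LkV[of "Suc m"], of 1 "c (Suc m)"] by simp
  qed
  hence "(\<lambda>x. \<Sum>k\<le>n. c k * (L ^^ k) v x) = (\<lambda>x. 0)"
    by (rule inj) (use c(2) in simp)
  hence zero: "(\<Sum>k\<le>n. c k * (L ^^ k) v x) = 0" for x by (rule fun_cong)
  define p where "p = (\<Sum>k\<le>n. monom (c k) k)"
  have coeff: "coeff p k = (if k \<le> n then c k else 0)" for k
    by (simp add: p_def coeff_sum sum.delta)
  have "p \<noteq> 0" using c(1) coeff by (metis coeff_0)
  moreover have "degree p \<le> n" by (rule degree_le) (simp add: coeff)
  moreover have "(\<Sum>k\<le>n. coeff p k * (L ^^ k) v x) = 0" for x using zero by (simp add: coeff)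
  ultimately show ?thesis
    by (intro polynomial_annihilator_eigenvector[of V L p n v, OF lin Lcl Llin]) (use v in auto)
qed

section \<open>Shifts, linear combinations and theta factors of quasi-periodic functions\<close>

context theta
begin

lemma qp_shift_arg:
  assumes "qp n \<alpha> \<beta> f"
  shows "qp n \<alpha> (\<beta> * exp (- 2 * pi * \<i> * n * c)) (\<lambda>x. f (x + c))"
  unfolding qp_def
proof (intro conjI allI)
  show "(\<lambda>x. f (x + c)) holomorphic_on UNIV"
    by (rule holomorphic_on_compose_gen[of _ _ f UNIV, unfolded o_def])
       (use assms in \<open>auto intro!: holomorphic_intros simp: qp_def\<close>)
  fix x
  have s1: "f (y + 1) = \<alpha> * f y" and s2: "f (y + \<tau>) = \<beta> * exp (- 2 * pi * \<i> * n * y) * f y" for y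
    using assms unfolding qp_def by blast+
  show "f (x + 1 + c) = \<alpha> * f (x + c)" using s1[of "x + c"] by (simp add: add_ac)
  have "exp (- 2 * pi * \<i> * n * (x + c)) = exp (- 2 * pi * \<i> * n * c) * exp (- 2 * pi * \<i> * n * x)"
    unfolding exp_add[symmetric] by (simp add: algebra_simps)
  moreover have "x + \<tau> + c = x + c + \<tau>" by simp
  ultimately show "f (x + \<tau> + c) = \<beta> * exp (- 2 * pi * \<i> * n * c) * exp (- 2 * pi * \<i> * n * x) * f (x + c)"
    using s2[of "x + c"] by (simp only: mult.assoc)
qed

lemma qp_zero: "qp n \<alpha> \<beta> (\<lambda>x. 0)"
  by (simp add: qp_def)

lemma qp_sum:
  assumes "\<And>m. m \<in> S \<Longrightarrow> qp n \<alpha> \<beta> (f m)"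
  shows "qp n \<alpha> \<beta> (\<lambda>x. \<Sum>m\<in>S. f m x)"
  using assms by (induction S rule: infinite_finite_induct) (auto simp: qp_zero qp_add)

lemma qp_lincomb: "qp n \<alpha> \<beta> f \<Longrightarrow> qp n \<alpha> \<beta> g \<Longrightarrow> qp n \<alpha> \<beta> (\<lambda>x. a * f x + b * g x)"
  using qp_add[OF qp_cmult[of n \<alpha> \<beta> f a] qp_cmult[of n \<alpha> \<beta> g b]] by (simp add: mult.commute)

definition theta_mult :: "complex \<Rightarrow> complex" where
  "theta_mult a = - exp (- (pi * \<i> * \<tau>) + 2 * pi * \<i> * a)"

lemma theta_mult_nonzero [simp]: "theta_mult a \<noteq> 0" by (simp add: theta_mult_def)

lemma qp_theta_prod:
  assumes "finite J"
  shows "qp (card J) ((-1) ^ card J) (\<Prod>j\<in>J. theta_mult (a j)) (\<lambda>x. \<Prod>j\<in>J. \<theta> (x - a j))"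
  using assms
proof induction
  case empty
  show ?case by (simp add: qp_def)
next
  case (insert j J)
  from qp_mult[OF theta1_shift_qp[of "a j"] insert.IH] insert.hyps show ?case
    by (simp add: theta_mult_def)
qed

text \<open>Since the points are distinct modulo the lattice, dividing by one theta factor leaves
  the other zeros in place for the next division.\<close>

lemma qp_divide_theta_prod:
  assumes "qp (n + k) \<alpha> \<beta> f" "\<alpha> \<noteq> 0" "\<beta> \<noteq> 0" "\<And>j. j \<in> {1..n} \<Longrightarrow> f (a j) = 0"
    "\<And>i j. i \<in> {1..n} \<Longrightarrow> j \<in> {1..n} \<Longrightarrow> i \<noteq> j \<Longrightarrow> \<theta> (a i - a j) \<noteq> 0"
  shows "\<exists>h. qp k (\<alpha> * (-1) ^ n) (\<beta> / (\<Prod>j\<in>{1..n}. theta_mult (a j))) h \<and> (\<forall>x. f x = (\<Prod>j\<in>{1..n}. \<theta> (x - a j)) * h x)"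
  using assms
proof (induction n arbitrary: k)
  case 0
  thus ?case by (intro exI[of _ f]) simp
next
  case (Suc n)
  define B where "B = (\<Prod>j\<in>{1..n}. theta_mult (a j))"
  define N where "N = Suc n"
  have B: "B \<noteq> 0" by (simp add: B_def)
  have "qp (n + Suc k) \<alpha> \<beta> f" using Suc.prems(1) by simp
  from Suc.IH[OF this Suc.prems(2,3)] obtain h where
    h: "qp (Suc k) (\<alpha> * (-1) ^ n) (\<beta> / B) h" "\<And>x. f x = (\<Prod>j\<in>{1..n}. \<theta> (x - a j)) * h x"
    unfolding B_def using Suc.prems(4,5) by auto
  have "(\<Prod>j\<in>{1..n}. \<theta> (a N - a j)) \<noteq> 0"
    using Suc.prems(5) by (simp add: N_def)
  hence "h (a N) = 0" using h(2)[of "a N"] Suc.prems(4)[of N] by (simp add: N_def)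
  then obtain h' where h': "qp k (- (\<alpha> * (-1) ^ n)) (- (\<beta> / B) * exp (pi * \<i> * \<tau> - 2 * pi * \<i> * a N)) h'"
    "\<And>x. h x = \<theta> (x - a N) * h' x"
    using qp_divide_theta[OF h(1), of "a N"] B Suc.prems(2,3) by auto
  have ins: "{1..Suc n} = insert N {1..n}" "N \<notin> {1..n}" by (auto simp: N_def)
  have "- (\<beta> / B) * exp (pi * \<i> * \<tau> - 2 * pi * \<i> * a N) = \<beta> / (\<Prod>j\<in>{1..Suc n}. theta_mult (a j))"
  proof -
    have "(\<Prod>j\<in>{1..Suc n}. theta_mult (a j)) = theta_mult (a N) * B"
      unfolding ins B_def using ins(2) by simp
    thus ?thesis using B by (simp only:) (simp add: theta_mult_def exp_diff exp_add exp_minus field_simps)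
  qed
  moreover have "- (\<alpha> * (-1) ^ n) = \<alpha> * (-1) ^ Suc n" by simp
  moreover have "f x = (\<Prod>j\<in>{1..Suc n}. \<theta> (x - a j)) * h' x" for x
    unfolding ins using ins(2) h(2)[of x] h'(2)[of x] by (simp add: mult_ac)
  ultimately show ?case using h'(1) by (intro exI[of _ h']) simp
qed

end

subsection \<open>The difference Lame equation\<close>

locale lame_spectral = lame +
  fixes K logK \<zeta> :: complex
  assumes l_pos: "l \<ge> 1" and exp_logK: "exp logK = K" and zeta: "\<zeta> \<notin> period_lattice \<tau>"
begin

lemma theta1_zeta_nonzero: "\<theta> \<zeta> \<noteq> 0"
  using zeta by (simp add: theta1_eq_0_iff)

lemma eta_nonzero: "\<eta> \<noteq> 0"
  using theta1_eta_nonzero by auto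

lemma K_nonzero: "K \<noteq> 0"
  using exp_logK by auto

text \<open>The ansatz with its poles cancelled in advance: the denominator of each
  \<open>Phi\<close> is removed from the theta product, which leaves a visibly entire
  function.\<close>

definition ansatz :: "(nat \<Rightarrow> complex) \<Rightarrow> complex \<Rightarrow> complex" where
  "ansatz s x = (\<Sum>m=1..l. exp (x / \<eta> * logK) * ((\<Prod>j\<in>{1..l} - {m}. \<theta> (x - of_nat j * \<eta>))
     * \<theta> (x - (of_nat m * \<eta> - \<zeta>))) * (s m / \<theta> \<zeta>))"

definition mult_one :: complex where "mult_one = exp (logK / \<eta>) * (-1) ^ l"

definition mult_tau :: complex where
  "mult_tau = exp (\<tau> / \<eta> * logK) * ((\<Prod>j\<in>{1..l}. theta_mult (of_nat j * \<eta>)) * exp (- (2 * pi * \<i> * \<zeta>)))"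

lemma mult_nonzero: "mult_one \<noteq> 0" "mult_tau \<noteq> 0"
  by (auto simp: mult_one_def mult_tau_def)

text \<open>The parameter \<open>c\<close> is 1 for the ansatz itself and -1 for stripping the
  exponential in \<open>qp_vanish\<close>.\<close>

lemma exp_qp: "qp 0 (exp (c / \<eta> * logK)) (exp (c * \<tau> / \<eta> * logK)) (\<lambda>x. exp (c * x / \<eta> * logK))"
proof -
  have "exp (c * (x + y) / \<eta> * logK) = exp (c * y / \<eta> * logK) * exp (c * x / \<eta> * logK)" for x y
    unfolding exp_add[symmetric] by (simp add: field_simps add_divide_distrib)
  thus ?thesis unfolding qp_def by (auto intro!: holomorphic_intros simp: eta_nonzero)
qed

text \<open>In summand \<open>m\<close> the theta factor with zero at \<open>m\<eta>\<close> is
  replaced by one with zero at \<open>m\<eta> - \<zeta>\<close>. This changes the multiplier by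
  \<open>exp (- 2\<pi>i\<zeta>)\<close> for every \<open>m\<close>, so all summands share one
  space.\<close>

lemma ansatz_qp: "qp l mult_one mult_tau (ansatz s)"
  unfolding ansatz_def[abs_def]
proof (intro qp_sum qp_cmult)
  fix m assume m: "m \<in> {1..l}"
  define J where "J = {1..l} - {m}"
  have card: "card J + 1 = l" "card J = l - 1" using m by (auto simp: J_def)
  have "qp (0 + (card J + 1)) (exp (1 / \<eta> * logK) * ((-1) ^ card J * - 1))
      (exp (1 * \<tau> / \<eta> * logK) * ((\<Prod>j\<in>J. theta_mult (of_nat j * \<eta>)) * theta_mult (of_nat m * \<eta> - \<zeta>)))
    (\<lambda>x. exp (1 * x / \<eta> * logK) * ((\<Prod>j\<in>J. \<theta> (x - of_nat j * \<eta>)) * \<theta> (x - (of_nat m * \<eta> - \<zeta>))))"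
    unfolding theta_mult_def[of "of_nat m * \<eta> - \<zeta>"]
    by (intro qp_mult exp_qp qp_theta_prod theta1_shift_qp) (simp add: J_def)
  moreover have "exp (1 / \<eta> * logK) * ((-1) ^ card J * - 1) = mult_one"
  proof -
    have "(-1 :: complex) ^ l = (-1) ^ card J * - 1" by (subst card(1)[symmetric]) simp
    thus ?thesis unfolding mult_one_def by simp
  qed
  moreover have "exp (1 * \<tau> / \<eta> * logK) * ((\<Prod>j\<in>J. theta_mult (of_nat j * \<eta>)) * theta_mult (of_nat m * \<eta> - \<zeta>)) = mult_tau"
  proof -
    have "theta_mult (of_nat m * \<eta> - \<zeta>) = theta_mult (of_nat m * \<eta>) * exp (- (2 * pi * \<i> * \<zeta>))"
      unfolding theta_mult_def by (simp add: algebra_simps flip: exp_add)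
    moreover have "(\<Prod>j\<in>{1..l}. theta_mult (of_nat j * \<eta>)) = theta_mult (of_nat m * \<eta>) * (\<Prod>j\<in>J. theta_mult (of_nat j * \<eta>))"
      unfolding J_def using m by (intro prod.remove) auto
    ultimately show ?thesis unfolding mult_tau_def by (simp add: mult_ac)
  qed
  ultimately show "qp l mult_one mult_tau
      (\<lambda>x. exp (x / \<eta> * logK) * ((\<Prod>j\<in>{1..l} - {m}. \<theta> (x - of_nat j * \<eta>)) * \<theta> (x - (of_nat m * \<eta> - \<zeta>))))"
    by (simp only: card(1) J_def[symmetric] mult_1 add_0)
qed

lemma lame_ansatz_eq: "lame_ansatz \<tau> \<eta> l logK \<zeta> s = ansatz s"
proof (rule ext)
  fix x
  define raw where "raw = (\<lambda>x. exp (x / \<eta> * logK) * (\<Prod>j=1..l. \<theta> (x - of_nat j * \<eta>))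
       * (\<Sum>m=1..l. s m * Phi \<tau> (x - of_nat m * \<eta>) \<zeta>))"
  have "eventually (\<lambda>w. \<forall>j\<in>{1..l}. \<theta> (w - of_nat j * \<eta>) \<noteq> 0) (at x)"
    by (intro eventually_ball_finite ballI theta1_eventually_nonzero) auto
  hence "eventually (\<lambda>w. ansatz s w = raw w) (at x)"
  proof eventually_elim
    case (elim w)
    have "exp (w / \<eta> * logK) * ((\<Prod>j\<in>{1..l} - {m}. \<theta> (w - of_nat j * \<eta>)) * \<theta> (w - (of_nat m * \<eta> - \<zeta>))) * (s m / \<theta> \<zeta>)
      = exp (w / \<eta> * logK) * (\<Prod>j=1..l. \<theta> (w - of_nat j * \<eta>)) * (s m * Phi \<tau> (w - of_nat m * \<eta>) \<zeta>)" if m: "m \<in> {1..l}" for m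
    proof -
      have p: "(\<Prod>j=1..l. \<theta> (w - of_nat j * \<eta>)) = \<theta> (w - of_nat m * \<eta>) * (\<Prod>j\<in>{1..l} - {m}. \<theta> (w - of_nat j * \<eta>))"
        using m by (intro prod.remove) auto
      have a: "w - (of_nat m * \<eta> - \<zeta>) = \<zeta> + (w - of_nat m * \<eta>)" by simp
      show ?thesis unfolding p a Phi_def using elim m by simp
    qed
    thus ?case unfolding ansatz_def raw_def sum_distrib_left by (intro sum.cong) auto
  qed
  moreover have "isCont (ansatz s) x"
    by (rule entire_isCont) (use ansatz_qp in \<open>simp add: qp_def\<close>)
  ultimately have "raw \<midarrow>x\<rightarrow> ansatz s x"
    unfolding isCont_def by (rule Lim_transform_eventually[rotated])
  thus "lame_ansatz \<tau> \<eta> l logK \<zeta> s x = ansatz s x"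
    unfolding lame_ansatz_def raw_def by (rule remove_sings_eqI)
qed

section \<open>Values of the ansatz at the nodes and the kernel of the matrix\<close>

definition node_prod :: "nat \<Rightarrow> complex" where
  "node_prod m = (\<Prod>j\<in>{1..l} - {m}. \<theta> (of_int (int m - int j) * \<eta>))"

definition reflected_prod :: "nat \<Rightarrow> complex" where
  "reflected_prod m = (\<Prod>j\<in>{1..l}. \<theta> (of_int (- (int m + int j)) * \<eta>))"

lemma node_prod_nonzero: "node_prod m \<noteq> 0"
proof -
  have "\<theta> (of_int (int m - int j) * \<eta>) \<noteq> 0" if "j \<in> {1..l} - {m}" for j
    by (rule theta1_mult_eta_nonzero) (use that in auto)
  thus ?thesis unfolding node_prod_def by (simp only: prod_zero_iff finite_Diff finite_atLeastAtMost) blast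
qed

lemma exp_mult_logK: "exp (of_nat m * \<eta> / \<eta> * logK) = K ^ m" "exp (- (of_nat m * \<eta>) / \<eta> * logK) = 1 / K ^ m"
proof -
  show "exp (of_nat m * \<eta> / \<eta> * logK) = K ^ m"
    using eta_nonzero exp_logK by (simp add: exp_of_nat_mult)
  moreover have "- (of_nat m * \<eta>) / \<eta> * logK = - (of_nat m * \<eta> / \<eta> * logK)" by simp
  ultimately show "exp (- (of_nat m * \<eta>) / \<eta> * logK) = 1 / K ^ m"
    by (simp only: exp_minus inverse_eq_divide)
qed

text \<open>As in Lagrange interpolation, only one summand survives at a node, so the coefficients
  can be read off from the values there.\<close>

lemma ansatz_node:
  assumes m: "m \<in> {1..l}"
  shows "ansatz s (of_nat m * \<eta>) = K ^ m * node_prod m * s m"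
proof -
  let ?t = "\<lambda>n. exp (of_nat m * \<eta> / \<eta> * logK) * ((\<Prod>j\<in>{1..l} - {n}. \<theta> (of_nat m * \<eta> - of_nat j * \<eta>))
     * \<theta> (of_nat m * \<eta> - (of_nat n * \<eta> - \<zeta>))) * (s n / \<theta> \<zeta>)"
  have "?t n = 0" if "n \<noteq> m" for n
  proof -
    have "(\<Prod>j\<in>{1..l} - {n}. \<theta> (of_nat m * \<eta> - of_nat j * \<eta>)) = 0"
      by (rule prod_zero) (use m that in \<open>auto intro!: bexI[of _ m]\<close>)
    thus ?thesis by simp
  qed
  hence "ansatz s (of_nat m * \<eta>) = (\<Sum>n\<in>{m}. ?t n)"
    unfolding ansatz_def by (intro sum.mono_neutral_right) (use m in auto)
  moreover have "(\<Prod>j\<in>{1..l} - {m}. \<theta> (of_nat m * \<eta> - of_nat j * \<eta>)) = node_prod m"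
    unfolding node_prod_def by (intro prod.cong) (auto simp: algebra_simps)
  ultimately show ?thesis
    unfolding exp_mult_logK using theta1_zeta_nonzero by simp
qed

text \<open>No factor of the theta product vanishes at a reflected node, so every coefficient
  contributes; this becomes row \<open>m\<close> of the matrix.\<close>

lemma ansatz_reflected_node:
  assumes m: "m \<in> {1..l}"
  shows "ansatz s (- (of_nat m * \<eta>)) = reflected_prod m / K ^ m * (\<Sum>n=1..l. Phi \<tau> (- (of_nat m + of_nat n) * \<eta>) \<zeta> * s n)"
  unfolding ansatz_def sum_distrib_left
proof (rule sum.cong[OF refl])
  fix n assume n: "n \<in> {1..l}"
  have nz: "\<theta> (- (of_nat m + of_nat n) * \<eta>) \<noteq> 0"
    using theta1_mult_eta_nonzero[of "- (int m + int n)"] m by simp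
  have "reflected_prod m = \<theta> (of_int (- (int m + int n)) * \<eta>) * (\<Prod>j\<in>{1..l} - {n}. \<theta> (of_int (- (int m + int j)) * \<eta>))"
    unfolding reflected_prod_def using n by (intro prod.remove) auto
  also have "(\<Prod>j\<in>{1..l} - {n}. \<theta> (of_int (- (int m + int j)) * \<eta>)) = (\<Prod>j\<in>{1..l} - {n}. \<theta> (- (of_nat m * \<eta>) - of_nat j * \<eta>))"
    by (intro prod.cong refl arg_cong[of _ _ \<theta>]) (simp add: algebra_simps)
  finally have p: "reflected_prod m = \<theta> (- (of_nat m + of_nat n) * \<eta>) * (\<Prod>j\<in>{1..l} - {n}. \<theta> (- (of_nat m * \<eta>) - of_nat j * \<eta>))"
    by simp
  have a: "- (of_nat m * \<eta>) - (of_nat n * \<eta> - \<zeta>) = \<zeta> + - (of_nat m + of_nat n) * \<eta>"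
    by (simp add: algebra_simps)
  show "exp (- (of_nat m * \<eta>) / \<eta> * logK) * ((\<Prod>j\<in>{1..l} - {n}. \<theta> (- (of_nat m * \<eta>) - of_nat j * \<eta>))
      * \<theta> (- (of_nat m * \<eta>) - (of_nat n * \<eta> - \<zeta>))) * (s n / \<theta> \<zeta>) =
    reflected_prod m / K ^ m * (Phi \<tau> (- (of_nat m + of_nat n) * \<eta>) \<zeta> * s n)"
    unfolding exp_mult_logK a p Phi_def using nz by simp
qed

text \<open>The origin of the prefactor of \<open>lame_G\<close>: it is minus the ratio of the theta
  products at \<open>- m\<eta>\<close> and \<open>m\<eta>\<close>. Oddness in the \<open>l\<close>
  reflected factors accounts for the sign.\<close>

lemma lame_coeff_node_prod:
  assumes m: "m \<in> {1..l}"
  shows "lame_coeff m * node_prod m = - reflected_prod m"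
proof -
  have P: "(\<Prod>j\<in>{1..l} - {m}. br (int m + int j) / br (int m - int j)) * node_prod m
    = (\<Prod>j\<in>{1..l} - {m}. \<theta> (of_int (int m + int j) * \<eta>))"
    unfolding node_prod_def prod.distrib[symmetric]
    by (rule prod.cong[OF refl]) (use br_nonzero in \<open>auto simp: theta1_eq_br simp del: of_int_add of_int_diff\<close>)
  have two: "2 * of_nat m * \<eta> = of_int (int m + int m) * \<eta>" by simp
  have 1: "lame_coeff m * node_prod m = (-1) ^ (l + 1) * (\<theta> (of_int (int m + int m) * \<eta>) * (\<Prod>j\<in>{1..l} - {m}. \<theta> (of_int (int m + int j) * \<eta>)))"
    unfolding lame_coeff_def two P[symmetric] by (simp only: mult_ac)
  have "reflected_prod m = (\<Prod>j\<in>{1..l}. (- 1) * \<theta> (of_int (int m + int j) * \<eta>))"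
    unfolding reflected_prod_def
  proof (rule prod.cong[OF refl])
    fix j
    show "\<theta> (of_int (- (int m + int j)) * \<eta>) = - 1 * \<theta> (of_int (int m + int j) * \<eta>)"
      using theta1_minus[of "of_int (int m + int j) * \<eta>"] by (simp add: algebra_simps)
  qed
  also have "\<dots> = (-1) ^ l * (\<Prod>j\<in>{1..l}. \<theta> (of_int (int m + int j) * \<eta>))"
    unfolding prod.distrib by simp
  also have "(\<Prod>j\<in>{1..l}. \<theta> (of_int (int m + int j) * \<eta>)) = \<theta> (of_int (int m + int m) * \<eta>) * (\<Prod>j\<in>{1..l} - {m}. \<theta> (of_int (int m + int j) * \<eta>))"
    using m by (intro prod.remove) auto
  finally show ?thesis unfolding 1 by simp
qed

definition symmetric_nodes :: "(complex \<Rightarrow> complex) \<Rightarrow> bool" where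
  "symmetric_nodes f \<longleftrightarrow> (\<forall>m\<in>{1..l}. f (of_nat m * \<eta>) = f (- (of_nat m * \<eta>)))"

text \<open>The exponential contributes \<open>K ^ m\<close> at the node and its inverse at the
  reflected node. Normalising the difference by these and by \<open>node_prod m\<close> leaves the
  square \<open>K ^ (2 * m)\<close>.\<close>

lemma symmetric_nodes_ansatz_iff:
  "symmetric_nodes (ansatz s) \<longleftrightarrow>
    (\<forall>m\<in>{1..l}. K ^ (2 * m) * s m + (\<Sum>n=1..l. lame_G \<tau> \<eta> l \<zeta> m n * s n) = 0)"
  unfolding symmetric_nodes_def
proof (rule ball_cong[OF refl])
  fix m assume m: "m \<in> {1..l}"
  define S where "S = (\<Sum>n=1..l. Phi \<tau> (- (of_nat m + of_nat n) * \<eta>) \<zeta> * s n)"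
  have G: "(\<Sum>n=1..l. lame_G \<tau> \<eta> l \<zeta> m n * s n) = lame_coeff m * S"
    unfolding S_def sum_distrib_left lame_G_def lame_coeff_def by (intro sum.cong) auto
  have "ansatz s (of_nat m * \<eta>) - ansatz s (- (of_nat m * \<eta>)) = K ^ m * node_prod m * s m + lame_coeff m * node_prod m / K ^ m * S"
    unfolding ansatz_node[OF m] ansatz_reflected_node[OF m] S_def[symmetric] lame_coeff_node_prod[OF m] by simp
  also have "\<dots> = node_prod m / K ^ m * (K ^ (2 * m) * s m + lame_coeff m * S)"
    using K_nonzero by (simp add: field_simps power_mult power2_eq_square mult_2 power_add)
  finally show "ansatz s (of_nat m * \<eta>) = ansatz s (- (of_nat m * \<eta>)) \<longleftrightarrow>
      K ^ (2 * m) * s m + (\<Sum>n=1..l. lame_G \<tau> \<eta> l \<zeta> m n * s n) = 0"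
    unfolding G using node_prod_nonzero[of m] K_nonzero
    by (metis divide_eq_0_iff eq_iff_diff_eq_0 mult_eq_0_iff power_not_zero)
qed

lemma ansatz_zero_iff: "ansatz s = (\<lambda>x. 0) \<longleftrightarrow> (\<forall>m\<in>{1..l}. s m = 0)"
proof
  assume "ansatz s = (\<lambda>x. 0)"
  thus "\<forall>m\<in>{1..l}. s m = 0"
    using ansatz_node node_prod_nonzero K_nonzero by (metis mult_eq_0_iff power_not_zero)
next
  assume "\<forall>m\<in>{1..l}. s m = 0"
  thus "ansatz s = (\<lambda>x. 0)" by (auto simp: ansatz_def)
qed

lemma det_lame_mat_eq_0_iff:
  "Determinant.det (lame_mat \<tau> \<eta> l K \<zeta>) = 0 \<longleftrightarrow> (\<exists>s. symmetric_nodes (ansatz s) \<and> ansatz s \<noteq> (\<lambda>x. 0))"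
proof -
  define A where "A = lame_mat \<tau> \<eta> l K \<zeta>"
  have A: "A \<in> carrier_mat l l" by (simp add: A_def lame_mat_def)
  have entry: "(A *\<^sub>v v) $ i = K ^ (2 * Suc i) * v $ i + (\<Sum>n=1..l. lame_G \<tau> \<eta> l \<zeta> (Suc i) n * v $ (n - 1))"
    if "i < l" "v \<in> carrier_vec l" for i v
  proof -
    have "(A *\<^sub>v v) $ i = (\<Sum>j<l. ((if i = j then K ^ (2 * Suc i) else 0) + lame_G \<tau> \<eta> l \<zeta> (Suc i) (Suc j)) * v $ j)"
      using that by (auto simp: A_def lame_mat_def scalar_prod_def atLeast0LessThan intro!: sum.cong)
    also have "\<dots> = (\<Sum>j<l. if i = j then K ^ (2 * Suc i) * v $ j else 0) + (\<Sum>j<l. lame_G \<tau> \<eta> l \<zeta> (Suc i) (Suc j) * v $ j)"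
      unfolding sum.distrib[symmetric] by (intro sum.cong) (auto simp: distrib_right)
    also have "(\<Sum>j<l. if i = j then K ^ (2 * Suc i) * v $ j else 0) = K ^ (2 * Suc i) * v $ i"
      using that by (simp add: sum.delta)
    also have "(\<Sum>j<l. lame_G \<tau> \<eta> l \<zeta> (Suc i) (Suc j) * v $ j) = (\<Sum>n=1..l. lame_G \<tau> \<eta> l \<zeta> (Suc i) n * v $ (n - 1))"
      by (simp add: sum.atLeast1_atMost_eq)
    finally show ?thesis .
  qed
  have "Determinant.det A = 0 \<longleftrightarrow> (\<exists>v. v \<in> carrier_vec l \<and> v \<noteq> 0\<^sub>v l \<and> A *\<^sub>v v = 0\<^sub>v l)"
    by (rule det_0_iff_vec_prod_zero_field[OF A])
  also have "\<dots> \<longleftrightarrow> (\<exists>s. symmetric_nodes (ansatz s) \<and> ansatz s \<noteq> (\<lambda>x. 0))"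
  proof
    assume "\<exists>v. v \<in> carrier_vec l \<and> v \<noteq> 0\<^sub>v l \<and> A *\<^sub>v v = 0\<^sub>v l"
    then obtain v where v: "v \<in> carrier_vec l" "v \<noteq> 0\<^sub>v l" "A *\<^sub>v v = 0\<^sub>v l" by blast
    \<comment> \<open>Vectors are indexed from 0 and coefficients from 1. The value
      \<open>s 0\<close> merely repeats \<open>s 1\<close> and never enters the ansatz.\<close>
    define s where "s = (\<lambda>m. v $ (m - 1))"
    have "K ^ (2 * m) * s m + (\<Sum>n=1..l. lame_G \<tau> \<eta> l \<zeta> m n * s n) = 0" if m: "m \<in> {1..l}" for m
    proof -
      obtain i where i: "m = Suc i" "i < l" using m by (cases m) auto
      show ?thesis using entry[OF i(2) v(1)] i v(3) by (simp add: s_def)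
    qed
    hence "symmetric_nodes (ansatz s)" by (simp add: symmetric_nodes_ansatz_iff)
    moreover have "ansatz s \<noteq> (\<lambda>x. 0)"
    proof
      assume "ansatz s = (\<lambda>x. 0)"
      hence s0: "s m = 0" if "m \<in> {1..l}" for m using that by (simp add: ansatz_zero_iff)
      have "v $ i = 0" if "i < l" for i using s0[of "Suc i"] that by (simp add: s_def)
      hence "v = 0\<^sub>v l" using v(1) by (intro eq_vecI) auto
      thus False using v(2) by simp
    qed
    ultimately show "\<exists>s. symmetric_nodes (ansatz s) \<and> ansatz s \<noteq> (\<lambda>x. 0)" by blast
  next
    assume "\<exists>s. symmetric_nodes (ansatz s) \<and> ansatz s \<noteq> (\<lambda>x. 0)"
    then obtain s where s: "symmetric_nodes (ansatz s)" "ansatz s \<noteq> (\<lambda>x. 0)" by blast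
    define v where "v = vec l (\<lambda>i. s (Suc i))"
    have v: "v \<in> carrier_vec l" by (simp add: v_def)
    have "A *\<^sub>v v = 0\<^sub>v l"
    proof (rule eq_vecI)
      fix i assume "i < dim_vec (0\<^sub>v l :: complex vec)"
      hence i: "i < l" by simp
      have "(\<Sum>n=1..l. lame_G \<tau> \<eta> l \<zeta> (Suc i) n * v $ (n - 1)) = (\<Sum>n=1..l. lame_G \<tau> \<eta> l \<zeta> (Suc i) n * s n)"
        by (intro sum.cong) (auto simp: v_def)
      hence "(A *\<^sub>v v) $ i = K ^ (2 * Suc i) * s (Suc i) + (\<Sum>n=1..l. lame_G \<tau> \<eta> l \<zeta> (Suc i) n * s n)"
        unfolding entry[OF i v] using i by (simp add: v_def)
      also have "\<dots> = 0"
        by (rule bspec[OF s(1)[unfolded symmetric_nodes_ansatz_iff]]) (use i in auto)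
      finally show "(A *\<^sub>v v) $ i = 0\<^sub>v l $ i" using i by simp
    qed (use A in auto)
    moreover have "v \<noteq> 0\<^sub>v l"
    proof
      assume v0: "v = 0\<^sub>v l"
      have "s m = 0" if m: "m \<in> {1..l}" for m
      proof -
        obtain i where i: "m = Suc i" "i < l" using m by (cases m) auto
        have "v $ i = 0" using v0 i by simp
        thus ?thesis using i by (simp add: v_def)
      qed
      thus False using s(2) by (simp add: ansatz_zero_iff)
    qed
    ultimately show "\<exists>v. v \<in> carrier_vec l \<and> v \<noteq> 0\<^sub>v l \<and> A *\<^sub>v v = 0\<^sub>v l" using v by blast
  qed
  finally show ?thesis by (simp add: A_def)
qed

text \<open>The operator multiplied by \<open>\<theta> x\<close>, so that it can be evaluated at the
  poles of its coefficients, above all at 0.\<close>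

definition lame_numerator :: "(complex \<Rightarrow> complex) \<Rightarrow> complex \<Rightarrow> complex" where
  "lame_numerator f x = \<theta> (x - of_nat l * \<eta>) * f (x + \<eta>) + \<theta> (x + of_nat l * \<eta>) * f (x - \<eta>)"

lemma difference_lame_iff:
  "difference_lame \<tau> \<eta> l E f \<longleftrightarrow> (\<forall>x. \<theta> x \<noteq> 0 \<longrightarrow> lame_numerator f x = E * \<theta> x * f x)"
  unfolding difference_lame_def lame_numerator_def
  by (intro all_cong1 imp_cong refl) (simp add: field_simps)

text \<open>By oddness the coefficients at opposite points are opposite. The hypothesis cancels the
  inner values of \<open>f\<close>, and the outer ones share a coefficient that vanishes precisely
  when the argument \<open>(m - l)\<eta>\<close> is a lattice point.\<close>

lemma lame_numerator_reflect:
  assumes "f ((of_nat m - 1) * \<eta>) = f (- ((of_nat m - 1) * \<eta>))"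
  shows "lame_numerator f (of_nat m * \<eta>) + lame_numerator f (- (of_nat m * \<eta>))
    = \<theta> ((of_nat m - of_nat l) * \<eta>) * (f (of_nat (Suc m) * \<eta>) - f (- (of_nat (Suc m) * \<eta>)))"
proof -
  have "of_nat m * \<eta> - of_nat l * \<eta> = (of_nat m - of_nat l) * \<eta>"
    "of_nat m * \<eta> + \<eta> = of_nat (Suc m) * \<eta>" "of_nat m * \<eta> - \<eta> = (of_nat m - 1) * \<eta>"
    "- (of_nat m * \<eta>) - of_nat l * \<eta> = - (of_nat m * \<eta> + of_nat l * \<eta>)"
    "- (of_nat m * \<eta>) + of_nat l * \<eta> = - ((of_nat m - of_nat l) * \<eta>)"
    "- (of_nat m * \<eta>) + \<eta> = - ((of_nat m - 1) * \<eta>)" "- (of_nat m * \<eta>) - \<eta> = - (of_nat (Suc m) * \<eta>)"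
    by (simp_all add: algebra_simps)
  thus ?thesis unfolding lame_numerator_def using assms
    by (simp only: theta1_minus) (simp add: algebra_simps)
qed

lemma difference_lame_imp_symmetric:
  assumes f: "f holomorphic_on UNIV" and "difference_lame \<tau> \<eta> l E f"
  shows "symmetric_nodes f"
proof -
  have comp: "(\<lambda>x. f (x + c)) holomorphic_on UNIV" for c
    by (rule holomorphic_on_compose_gen[OF _ f, unfolded o_def]) (auto intro!: holomorphic_intros)
  \<comment> \<open>The equation is required only where \<open>\<theta>\<close> does not vanish, but
    is first used at 0; clearing denominators extends it by continuity.\<close>
  have eq: "lame_numerator f x = E * \<theta> x * f x" for x
  proof (rule continuous_eq_of_eventually_eq[where u = "lame_numerator f" and v = "\<lambda>x. E * \<theta> x * f x"])
    have "isCont (\<lambda>x. f (x + \<eta>)) x" "isCont (\<lambda>x. f (x - \<eta>)) x"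
      using entire_isCont[OF comp[of \<eta>]] entire_isCont[OF comp[of "- \<eta>"]] by simp_all
    thus "isCont (lame_numerator f) x" unfolding lame_numerator_def[abs_def] by (intro continuous_intros)
    show "isCont (\<lambda>x. E * \<theta> x * f x) x" by (intro continuous_intros entire_isCont[OF f])
    show "eventually (\<lambda>x. lame_numerator f x = E * \<theta> x * f x) (at x)"
      using theta1_eventually_nonzero[of 0 x]
      by eventually_elim (use assms(2) in \<open>simp add: difference_lame_iff\<close>)
  qed
  have nz: "\<theta> ((of_nat m - of_nat l) * \<eta>) \<noteq> 0" if "m < l" for m
    using theta1_mult_eta_nonzero[of "int m - int l"] that by simp
  have sym: "f (of_nat m * \<eta>) = f (- (of_nat m * \<eta>))" if "m \<le> l" for m
    using that
  proof (induction m rule: less_induct)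
    case (less m)
    consider "m = 0" | "m = 1" | k where "m = Suc (Suc k)" by (metis One_nat_def not0_implies_Suc)
    thus ?case
    proof cases
      case 2
      have "\<theta> (- (of_nat l * \<eta>)) * (f \<eta> - f (- \<eta>)) = 0"
        using eq[of 0] theta1_minus[of "of_nat l * \<eta>"] by (simp add: lame_numerator_def algebra_simps)
      moreover have "\<theta> (- (of_nat l * \<eta>)) \<noteq> 0" using nz[of 0] l_pos by simp
      ultimately show ?thesis using 2 by simp
    next
      case 3
      have m1: "Suc k < l" "(of_nat (Suc k) - 1 :: complex) = of_nat k" using 3 less.prems by auto
      have ih: "f (of_nat k * \<eta>) = f (- (of_nat k * \<eta>))" "f (of_nat (Suc k) * \<eta>) = f (- (of_nat (Suc k) * \<eta>))"
        using less.IH[of k] less.IH[of "Suc k"] 3 less.prems by auto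
      \<comment> \<open>The right side \<open>E * \<theta> x * f x\<close> takes opposite values at
        the two points, since \<open>f\<close> is already known to be symmetric there.\<close>
      have "lame_numerator f (of_nat (Suc k) * \<eta>) + lame_numerator f (- (of_nat (Suc k) * \<eta>)) = 0"
        unfolding eq theta1_minus ih(2) by simp
      hence "\<theta> ((of_nat (Suc k) - of_nat l) * \<eta>) * (f (of_nat (Suc (Suc k)) * \<eta>) - f (- (of_nat (Suc (Suc k)) * \<eta>))) = 0"
        using lame_numerator_reflect[of f "Suc k"] m1 ih(1) by simp
      thus ?thesis using nz[OF m1(1)] 3 by simp
    qed simp
  qed
  thus ?thesis by (simp add: symmetric_nodes_def)
qed

section \<open>The invariant space and its eigenfunctions\<close>

definition symmetric_space :: "(complex \<Rightarrow> complex) set" where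
  "symmetric_space = {f. qp l mult_one mult_tau f \<and> symmetric_nodes f}"

text \<open>Dividing out all \<open>l\<close> zeros reduces the degree to 0. Once the exponential in
  \<open>K\<close> is removed, the multipliers are 1 and \<open>exp (- 2\<pi>i\<zeta>)\<close>,
  which no nonzero entire function has for this \<zeta>.\<close>

lemma qp_vanish:
  assumes "qp l mult_one mult_tau f" "\<And>m. m \<in> {1..l} \<Longrightarrow> f (of_nat m * \<eta>) = 0"
  shows "f = (\<lambda>x. 0)"
proof -
  define B where "B = (\<Prod>j\<in>{1..l}. theta_mult (of_nat j * \<eta>))"
  have B: "B \<noteq> 0" by (simp add: B_def)
  have "\<theta> (of_nat i * \<eta> - of_nat j * \<eta>) \<noteq> 0" if "i \<noteq> j" for i j :: nat
    using theta1_mult_eta_nonzero[of "int i - int j"] that by (simp add: algebra_simps)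
  then obtain h where h: "qp 0 (mult_one * (-1) ^ l) (mult_tau / B) h"
    "\<And>x. f x = (\<Prod>j\<in>{1..l}. \<theta> (x - of_nat j * \<eta>)) * h x"
    using qp_divide_theta_prod[of l 0 mult_one mult_tau f "\<lambda>j. of_nat j * \<eta>"] assms mult_nonzero
    unfolding B_def by auto
  have "qp (0 + 0) (mult_one * (-1) ^ l * exp (- 1 / \<eta> * logK)) (mult_tau / B * exp (- 1 * \<tau> / \<eta> * logK)) (\<lambda>x. h x * exp (- 1 * x / \<eta> * logK))"
    by (rule qp_mult[OF h(1) exp_qp])
  moreover have "mult_one * (-1) ^ l * exp (- 1 / \<eta> * logK) = 1"
  proof -
    have "exp (logK / \<eta>) * exp (- 1 / \<eta> * logK) = 1" by (simp flip: exp_add)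
    moreover have "(-1 :: complex) ^ l * (-1) ^ l = 1" by (simp flip: power_mult_distrib)
    ultimately show ?thesis unfolding mult_one_def by (metis (no_types, lifting) mult.assoc mult.commute mult.left_neutral)
  qed
  moreover have "mult_tau / B * exp (- 1 * \<tau> / \<eta> * logK) = exp (- (2 * pi * \<i> * \<zeta>))"
  proof -
    have "exp (\<tau> / \<eta> * logK) * exp (- 1 * \<tau> / \<eta> * logK) = 1" by (simp flip: exp_add)
    moreover have "mult_tau / B * exp (- 1 * \<tau> / \<eta> * logK) =
        exp (\<tau> / \<eta> * logK) * exp (- 1 * \<tau> / \<eta> * logK) * exp (- (2 * pi * \<i> * \<zeta>))"
      unfolding mult_tau_def B_def[symmetric] using B by simp
    ultimately show ?thesis by simp
  qed
  ultimately have "qp 0 1 (exp (- (2 * pi * \<i> * \<zeta>))) (\<lambda>x. h x * exp (- 1 * x / \<eta> * logK))" by simp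
  from qp_0_zero[OF this zeta] have "h x = 0" for x by simp
  thus ?thesis using h(2) by auto
qed

text \<open>Symmetry at the first node makes the numerator vanish at 0, hence on the whole lattice,
  so it is divisible by \<open>\<theta>\<close>. The image is again symmetric by
  \<open>lame_numerator_reflect\<close>.\<close>

lemma lame_operator_exists:
  assumes f: "f \<in> symmetric_space"
  shows "\<exists>g. g \<in> symmetric_space \<and> (\<forall>x. \<theta> x * g x = lame_numerator f x)"
proof -
  have qf: "qp l mult_one mult_tau f" and sf: "symmetric_nodes f" using f by (auto simp: symmetric_space_def)
  \<comment> \<open>Shifting the argument of a function of degree \<open>l\<close> by \<eta> costs a
    constant that the theta factor shifted by \<open>l\<eta>\<close> restores; thus both summands of
    the numerator have the same multipliers.\<close>
  have beta: "theta_mult (of_nat l * \<eta>) * (mult_tau * exp (- 2 * pi * \<i> * of_nat l * \<eta>)) = - exp (- (pi * \<i> * \<tau>)) * mult_tau"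
    "theta_mult (- (of_nat l * \<eta>)) * (mult_tau * exp (- 2 * pi * \<i> * of_nat l * (- \<eta>))) = - exp (- (pi * \<i> * \<tau>)) * mult_tau"
  proof -
    have e: "exp (- (pi * \<i> * \<tau>) + 2 * pi * \<i> * (of_nat l * a)) * exp (- 2 * pi * \<i> * of_nat l * a) = exp (- (pi * \<i> * \<tau>))" for a
      unfolding exp_add[symmetric] by (simp add: algebra_simps)
    have "theta_mult (of_nat l * a) * (mult_tau * exp (- 2 * pi * \<i> * of_nat l * a)) = - exp (- (pi * \<i> * \<tau>)) * mult_tau" for a
      unfolding theta_mult_def e[of a, symmetric] by (simp only: mult_ac mult_minus_left mult_minus_right)
    from this[of \<eta>] this[of "- \<eta>"] show
      "theta_mult (of_nat l * \<eta>) * (mult_tau * exp (- 2 * pi * \<i> * of_nat l * \<eta>)) = - exp (- (pi * \<i> * \<tau>)) * mult_tau"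
      "theta_mult (- (of_nat l * \<eta>)) * (mult_tau * exp (- 2 * pi * \<i> * of_nat l * (- \<eta>))) = - exp (- (pi * \<i> * \<tau>)) * mult_tau"
      by (simp_all only: mult_minus_right)
  qed
  have "qp (1 + l) (- 1 * mult_one) (theta_mult (of_nat l * \<eta>) * (mult_tau * exp (- 2 * pi * \<i> * of_nat l * \<eta>)))
    (\<lambda>x. \<theta> (x - of_nat l * \<eta>) * f (x + \<eta>))"
    unfolding theta_mult_def by (intro qp_mult theta1_shift_qp qp_shift_arg qf)
  moreover have "qp (1 + l) (- 1 * mult_one) (theta_mult (- (of_nat l * \<eta>)) * (mult_tau * exp (- 2 * pi * \<i> * of_nat l * (- \<eta>))))
    (\<lambda>x. \<theta> (x - (- (of_nat l * \<eta>))) * f (x + (- \<eta>)))"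
    unfolding theta_mult_def by (intro qp_mult theta1_shift_qp qp_shift_arg qf)
  ultimately have "qp (Suc l) (- mult_one) (- exp (- (pi * \<i> * \<tau>)) * mult_tau) (lame_numerator f)"
    unfolding beta lame_numerator_def[abs_def] using qp_add by simp
  moreover have "lame_numerator f 0 = 0"
  proof -
    have "f \<eta> = f (- \<eta>)" using sf l_pos by (auto simp: symmetric_nodes_def dest: bspec[of _ _ 1])
    thus ?thesis using theta1_minus[of "of_nat l * \<eta>"] by (simp add: lame_numerator_def)
  qed
  ultimately obtain g where g: "qp l (- (- mult_one)) (- (- exp (- (pi * \<i> * \<tau>)) * mult_tau) * exp (pi * \<i> * \<tau> - 2 * pi * \<i> * 0)) g"
    "\<And>x. lame_numerator f x = \<theta> (x - 0) * g x"
    using qp_divide_theta[of l "- mult_one" "- exp (- (pi * \<i> * \<tau>)) * mult_tau" "lame_numerator f" 0] mult_nonzero by auto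
  have "- (- exp (- (pi * \<i> * \<tau>)) * mult_tau) * exp (pi * \<i> * \<tau> - 2 * pi * \<i> * 0) = mult_tau"
    by (simp add: exp_minus)
  hence qg: "qp l mult_one mult_tau g" using g(1) by (simp only: minus_minus)
  have eq: "\<theta> x * g x = lame_numerator f x" for x using g(2) by simp
  have "symmetric_nodes g"
    unfolding symmetric_nodes_def
  proof
    fix m assume m: "m \<in> {1..l}"
    have "f ((of_nat m - 1) * \<eta>) = f (- ((of_nat m - 1) * \<eta>))"
    proof (cases "m = 1")
      case False
      hence "m - 1 \<in> {1..l}" "of_nat (m - 1) = (of_nat m - 1 :: complex)" using m by (auto simp: of_nat_diff)
      thus ?thesis using sf unfolding symmetric_nodes_def by metis
    qed simp
    have "lame_numerator f (of_nat m * \<eta>) + lame_numerator f (- (of_nat m * \<eta>))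
      = \<theta> ((of_nat m - of_nat l) * \<eta>) * (f (of_nat (Suc m) * \<eta>) - f (- (of_nat (Suc m) * \<eta>)))"
      by (rule lame_numerator_reflect) fact
    also have "\<dots> = 0"
    \<comment> \<open>Nothing is known about \<open>f\<close> at \<open>(l + 1)\<eta>\<close>, but
      for \<open>m = l\<close> its coefficient is \<open>\<theta> 0 = 0\<close>.\<close>
    proof (cases "m = l")
      case False
      hence "Suc m \<in> {1..l}" using m by auto
      thus ?thesis using sf unfolding symmetric_nodes_def by (metis diff_self mult_zero_right)
    qed simp
    finally have "\<theta> (of_nat m * \<eta>) * (g (of_nat m * \<eta>) - g (- (of_nat m * \<eta>))) = 0"
      unfolding eq[symmetric] theta1_minus by (simp add: algebra_simps)
    moreover have "\<theta> (of_nat m * \<eta>) \<noteq> 0" using theta1_mult_eta_nonzero[of "int m"] m by simp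
    ultimately show "g (of_nat m * \<eta>) = g (- (of_nat m * \<eta>))" by simp
  qed
  thus ?thesis using qg eq by (auto simp: symmetric_space_def)
qed

lemma lame_eigenfunction_exists:
  assumes "v \<in> symmetric_space" "v \<noteq> (\<lambda>x. 0)"
  shows "\<exists>w E. w \<in> symmetric_space \<and> w \<noteq> (\<lambda>x. 0) \<and> (\<forall>x. lame_numerator w x = E * \<theta> x * w x)"
proof -
  obtain L where L: "\<And>f. f \<in> symmetric_space \<Longrightarrow> L f \<in> symmetric_space"
    "\<And>f x. f \<in> symmetric_space \<Longrightarrow> \<theta> x * L f x = lame_numerator f x"
    using lame_operator_exists by metis
  have lin: "(\<lambda>x. a * f x + b * g x) \<in> symmetric_space" if "f \<in> symmetric_space" "g \<in> symmetric_space" for f g a b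
    using that by (auto simp: symmetric_space_def symmetric_nodes_def intro!: qp_lincomb)
  have hol: "f holomorphic_on UNIV" if "f \<in> symmetric_space" for f
    using that by (simp add: symmetric_space_def qp_def)
  have "\<exists>w E. w \<in> symmetric_space \<and> w \<noteq> (\<lambda>x. 0) \<and> L w = (\<lambda>x. E * w x)"
  proof (rule eigenfunction_exists[where V = symmetric_space and L = L and n = l and pt = "\<lambda>i. of_nat (Suc i) * \<eta>"])
    fix f g a b assume fg: "f \<in> symmetric_space" "g \<in> symmetric_space"
    show "L (\<lambda>x. a * f x + b * g x) = (\<lambda>x. a * L f x + b * L g x)"
    \<comment> \<open>The images under \<open>L\<close> are chosen separately for each function, so
      linearity is recovered from that of the numerator by cancelling
      \<open>\<theta>\<close>.\<close>
    proof (rule ext, rule simple_zeros_mult_cancel[OF theta1_simple_zeros,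
          where u = "L (\<lambda>x. a * f x + b * g x)" and v = "\<lambda>x. a * L f x + b * L g x"])
      show "L (\<lambda>x. a * f x + b * g x) holomorphic_on UNIV" by (intro hol L(1) lin fg)
      show "(\<lambda>x. a * L f x + b * L g x) holomorphic_on UNIV" by (intro hol lin L(1) fg)
      fix z
      have "\<theta> z * L (\<lambda>x. a * f x + b * g x) z = lame_numerator (\<lambda>x. a * f x + b * g x) z"
        by (rule L(2)[OF lin[OF fg]])
      also have "\<dots> = a * lame_numerator f z + b * lame_numerator g z"
        by (simp add: lame_numerator_def algebra_simps)
      also have "\<dots> = a * (\<theta> z * L f z) + b * (\<theta> z * L g z)" unfolding L(2)[OF fg(1)] L(2)[OF fg(2)] ..
      finally show "\<theta> z * L (\<lambda>x. a * f x + b * g x) z = \<theta> z * (a * L f z + b * L g z)" by (simp add: algebra_simps)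
    qed
  next
    fix f assume f: "f \<in> symmetric_space" "\<And>i. i < l \<Longrightarrow> f (of_nat (Suc i) * \<eta>) = 0"
    show "f = (\<lambda>x. 0)"
    proof (rule qp_vanish)
      fix m assume "m \<in> {1..l}"
      thus "f (of_nat m * \<eta>) = 0" using f(2)[of "m - 1"] by auto
    qed (use f(1) in \<open>simp add: symmetric_space_def\<close>)
  qed (use L lin assms in auto)
  then obtain w E where w: "w \<in> symmetric_space" "w \<noteq> (\<lambda>x. 0)" "L w = (\<lambda>x. E * w x)" by blast
  have "lame_numerator w x = E * \<theta> x * w x" for x
    using L(2)[OF w(1), of x] unfolding w(3) by (simp add: mult_ac)
  thus ?thesis using w by blast
qed

lemma symmetric_space_imp_ansatz:
  assumes "f \<in> symmetric_space"
  shows "\<exists>s. f = ansatz s"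
proof -
  \<comment> \<open>The interpolation coefficients dictated by \<open>ansatz_node\<close>; the
    difference then vanishes at all nodes.\<close>
  define s where "s = (\<lambda>m. f (of_nat m * \<eta>) / (K ^ m * node_prod m))"
  have "(\<lambda>x. 1 * f x + (- 1) * ansatz s x) = (\<lambda>x. 0)"
  proof (rule qp_vanish)
    show "qp l mult_one mult_tau (\<lambda>x. 1 * f x + (- 1) * ansatz s x)"
      using assms by (intro qp_lincomb ansatz_qp) (simp add: symmetric_space_def)
    fix m assume "m \<in> {1..l}"
    thus "1 * f (of_nat m * \<eta>) + (- 1) * ansatz s (of_nat m * \<eta>) = 0"
      using K_nonzero node_prod_nonzero by (simp add: ansatz_node s_def)
  qed
  hence "1 * f x + (- 1) * ansatz s x = 0" for x by (rule fun_cong)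
  thus ?thesis by (intro exI[of _ s]) auto
qed

text \<open>A kernel vector of the matrix only shows that the invariant space is nonzero. The
  eigenfunction found there may have other coefficients, and its eigenvalue is the required
  \<open>E\<close>.\<close>

lemma lame_solvable_iff:
  "(\<exists>E s. difference_lame \<tau> \<eta> l E (lame_ansatz \<tau> \<eta> l logK \<zeta> s) \<and> lame_ansatz \<tau> \<eta> l logK \<zeta> s \<noteq> (\<lambda>x. 0))
    \<longleftrightarrow> Determinant.det (lame_mat \<tau> \<eta> l K \<zeta>) = 0"
  unfolding lame_ansatz_eq det_lame_mat_eq_0_iff
proof
  assume "\<exists>E s. difference_lame \<tau> \<eta> l E (ansatz s) \<and> ansatz s \<noteq> (\<lambda>x. 0)"
  thus "\<exists>s. symmetric_nodes (ansatz s) \<and> ansatz s \<noteq> (\<lambda>x. 0)"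
    using difference_lame_imp_symmetric ansatz_qp unfolding qp_def by blast
next
  assume "\<exists>s. symmetric_nodes (ansatz s) \<and> ansatz s \<noteq> (\<lambda>x. 0)"
  then obtain s where "ansatz s \<in> symmetric_space" "ansatz s \<noteq> (\<lambda>x. 0)"
    using ansatz_qp by (auto simp: symmetric_space_def)
  then obtain w E where w: "w \<in> symmetric_space" "w \<noteq> (\<lambda>x. 0)" "\<And>x. lame_numerator w x = E * \<theta> x * w x"
    using lame_eigenfunction_exists by blast
  obtain s' where "w = ansatz s'" using symmetric_space_imp_ansatz[OF w(1)] by blast
  thus "\<exists>E s. difference_lame \<tau> \<eta> l E (ansatz s) \<and> ansatz s \<noteq> (\<lambda>x. 0)"
    using w(2,3) by (auto simp: difference_lame_iff)
qed

end

theorem mainTheorem3: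
  fixes l N :: nat and \<tau> \<eta> K logK \<zeta> :: complex
  assumes "l \<ge> 1"
    and "N = l * (l + 1) div 2"
    and "Im \<tau> > 0"
    and "\<And>m :: int. m \<noteq> 0 \<Longrightarrow> of_int m * \<eta> \<notin> period_lattice \<tau>"
    and "K \<noteq> 0"
    and "exp logK = K"
    and "\<zeta> \<notin> period_lattice \<tau>"
  shows "((\<exists>E s. difference_lame \<tau> \<eta> l E (lame_ansatz \<tau> \<eta> l logK \<zeta> s)
              \<and> lame_ansatz \<tau> \<eta> l logK \<zeta> s \<noteq> (\<lambda>x. 0))
           \<longleftrightarrow> Determinant.det (lame_mat \<tau> \<eta> l K \<zeta>) = 0)
       \<and> (Determinant.det (lame_mat \<tau> \<eta> l K \<zeta>) = 0
           \<longleftrightarrow> (\<Sum>j=0..N. (-1) ^ j * lame_C \<tau> \<eta> l j * theta1 \<tau> (\<zeta> - 2 * of_nat j * \<eta>)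
                   * K ^ (2 * (N - j))) = 0)
       \<and> lame_C \<tau> \<eta> l 0 = 1
       \<and> (\<forall>j\<le>N. lame_C \<tau> \<eta> l j = lame_C \<tau> \<eta> l (N - j))"
proof -
  interpret lame_spectral \<tau> \<eta> l K logK \<zeta>
    using assms by unfold_locales auto
  have "Determinant.det (lame_mat \<tau> \<eta> l K \<zeta>) = 0
           \<longleftrightarrow> (\<Sum>j=0..N. (-1) ^ j * lame_C \<tau> \<eta> l j * theta1 \<tau> (\<zeta> - 2 * of_nat j * \<eta>) * K ^ (2 * (N - j))) = 0"
    unfolding theta1_zeta_det_lame_mat[OF theta1_zeta_nonzero assms(2), symmetric]
    using theta1_zeta_nonzero by simp
  thus ?thesis using lame_solvable_iff lame_C_0 lame_C_sym[OF assms(2)] by blast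
qed

end
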